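(* Let $0<\alpha<n$, $1<p_0,q_0<\infty$, $\vec p=(p_1,\dots,p_n)$, $\vec q=(q_1,\dots,q_n)$ with $1<p_i,q_i<\infty$, $\frac n{p_0}<\sum_i\frac1{p_i}$ and $\frac n{q_0}<\sum_i\frac1{q_i}$, and let $b$ be locally integrable. If $[b,I_\alpha]$ is bounded from $\mathcal M^{p_0}_{\vec p}(\mathbb{R}^n)$ to $\mathcal M^{q_0}_{\vec q}(\mathbb{R}^n)$, then there is $C>0$ such that for all $f\in\mathcal{B}^{q_0'}_{\vec q\,'}(\mathbb{R}^n)$, $$\|[b,I_\alpha]f\|_{\mathcal{B}^{p_0'}_{\vec p\,'}(\mathbb{R}^n)}\le C\|f\|_{\mathcal{B}^{q_0'}_{\vec q\,'}(\mathbb{R}^n)}.$$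
   Context: $[b,I_\alpha]f(x)=\int_{\mathbb{R}^n}\frac{(b(x)-b(y))f(y)}{|x-y|^{n-\alpha}}dy$. Cubes have sides parallel to the axes. $L^{\vec r}(\mathbb{R}^n)$ is the mixed-norm Lebesgue space with norm $\|f\|_{L^{\vec r}}=\big(\int_{\mathbb{R}}\cdots(\int_{\mathbb{R}}|f|^{r_1}dx_1)^{r_2/r_1}\cdots dx_n\big)^{1/r_n}$; $\vec r\,'$ is the componentwise conjugate exponent and $r_0'$ the conjugate of $r_0$. The mixed Morrey space $\mathcal M^{r_0}_{\vec r}(\mathbb{R}^n)$ is the set of measurable $f$ with $\|f\|_{\mathcal M^{r_0}_{\vec r}}=\sup_Q|Q|^{\frac1{r_0}-\frac1n\sum_j\frac1{r_j}}\|f\chi_Q\|_{L^{\vec r}}<\infty$. A $(r_0',\vec r\,')$-block is a measurable $b$ with $\operatorname{supp}b\subset Q$ and $\|b\|_{L^{\vec r\,'}}\le|Q|^{\frac1{r_0}-\frac1n\sum_i\frac1{r_i}}$ for some cube $Q$; the block space $\mathcal{B}^{r_0'}_{\vec r\,'}(\mathbb{R}^n)$ (for $\frac n{r_0}<\sum_i\frac1{r_i}$) consists of $f=\sum_i\lambda_ib_i$ (convergent in $L^1_{\mathrm{loc}}$ and a.e.) with $\{\lambda_i\}\in\ell^1$ and $b_i$ blocks, with norm $\inf\|\{\lambda_i\}\|_{\ell^1}$ over such decompositions. *)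

theory Defs
  imports "HOL-Analysis.Analysis"
begin

text \<open>Points of R^n are vectors real^'n; the index type 'n is finite and linearly
ordered, the order fixing which coordinate is x_1, x_2, ..., x_n. n = CARD('n).\<close>

definition coord_upd :: "real^'n \<Rightarrow> 'n \<Rightarrow> real \<Rightarrow> real^'n" where
  "coord_upd x i t = (\<chi> j. if j = i then t else x $ j)"

definition epow :: "ennreal \<Rightarrow> real \<Rightarrow> ennreal" where
  "epow x s = (if x = \<infinity> then \<infinity> else ennreal (enn2real x powr s))"

fun mixed_iter :: "(real^'n \<Rightarrow> ennreal) \<Rightarrow> ('n \<times> real) list \<Rightarrow> (real^'n \<Rightarrow> ennreal)" where
  "mixed_iter F [] = F"
| "mixed_iter F ((i, r) # rest) =
     mixed_iter (\<lambda>x. epow (\<integral>\<^sup>+ t. epow (F (coord_upd x i t)) r \<partial>lborel) (1 / r)) rest"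

definition coords :: "('n::{finite,linorder}) list" where
  "coords = sorted_list_of_set UNIV"

definition mixed_norm :: "real^('n::{finite,linorder}) \<Rightarrow> (real^('n::{finite,linorder}) \<Rightarrow> real) \<Rightarrow> ennreal" where
  "mixed_norm r f = mixed_iter (\<lambda>x. ennreal \<bar>f x\<bar>) (map (\<lambda>i. (i, r $ i)) coords) 0"

definition conj_exp :: "real \<Rightarrow> real" where
  "conj_exp r = r / (r - 1)"

definition conj_vec :: "real^'n \<Rightarrow> real^'n" where
  "conj_vec r = (\<chi> i. conj_exp (r $ i))"

definition cube :: "real^'n \<Rightarrow> real \<Rightarrow> (real^'n) set" where
  "cube a h = cbox a (a + h *\<^sub>R One)"

definition morrey_exp :: "real \<Rightarrow> real^'n \<Rightarrow> real" where
  "morrey_exp r0 r = 1 / r0 - (1 / real CARD('n)) * (\<Sum>j\<in>UNIV. 1 / r $ j)"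

text \<open>Mixed Morrey norm; f is in M^{r0}_r iff f measurable and the norm is finite.\<close>
definition morrey_norm :: "real \<Rightarrow> real^('n::{finite,linorder}) \<Rightarrow> (real^('n::{finite,linorder}) \<Rightarrow> real) \<Rightarrow> ennreal" where
  "morrey_norm r0 r f = (SUP (a, h) \<in> UNIV \<times> {0<..}.
      ennreal (measure lebesgue (cube a h) powr morrey_exp r0 r)
      * mixed_norm r (\<lambda>x. indicator (cube a h) x * f x))"

definition is_block :: "real \<Rightarrow> real^('n::{finite,linorder}) \<Rightarrow> (real^('n::{finite,linorder}) \<Rightarrow> real) \<Rightarrow> bool" where
  "is_block r0 r b \<longleftrightarrow> b \<in> borel_measurable lebesgue \<and>
     (\<exists>a h. h > 0 \<and> {x. b x \<noteq> 0} \<subseteq> cube a h \<and>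
        mixed_norm (conj_vec r) b \<le> ennreal (measure lebesgue (cube a h) powr morrey_exp r0 r))"

text \<open>Decomposition f = sum lam_i b_i converging in L^1_loc and a.e.
  (finite decompositions are included by padding with zeros).\<close>
definition block_decomp :: "real \<Rightarrow> real^('n::{finite,linorder}) \<Rightarrow> (real^('n::{finite,linorder}) \<Rightarrow> real)
    \<Rightarrow> (nat \<Rightarrow> real) \<Rightarrow> (nat \<Rightarrow> real^('n::{finite,linorder}) \<Rightarrow> real) \<Rightarrow> bool" where
  "block_decomp r0 r f lam B \<longleftrightarrow>
     summable (\<lambda>i. \<bar>lam i\<bar>) \<and> (\<forall>i. is_block r0 r (B i)) \<and>
     (\<forall>K. compact K \<longrightarrow>
        (\<lambda>N. \<integral>\<^sup>+ x\<in>K. ennreal \<bar>f x - (\<Sum>i<N. lam i * B i x)\<bar> \<partial>lebesgue) \<longlonglongrightarrow> 0) \<and>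
     (AE x in lebesgue. (\<lambda>N. \<Sum>i<N. lam i * B i x) \<longlonglongrightarrow> f x)"

text \<open>Block space norm ||f||_{B^{r0'}_{r'}}; it is \<infinity> iff f is not in the block space.\<close>
definition block_norm :: "real \<Rightarrow> real^('n::{finite,linorder}) \<Rightarrow> (real^('n::{finite,linorder}) \<Rightarrow> real) \<Rightarrow> ennreal" where
  "block_norm r0 r f = (INF (lam, B) \<in> {(lam, B). block_decomp r0 r f lam B}.
      ennreal (\<Sum>i. \<bar>lam i\<bar>))"

definition comm_riesz :: "(real^'n \<Rightarrow> real) \<Rightarrow> real \<Rightarrow> (real^'n \<Rightarrow> real) \<Rightarrow> real^'n \<Rightarrow> real" where
  "comm_riesz b \<alpha> f x = (\<integral> y. (b x - b y) * f y / norm (x - y) powr (real CARD('n) - \<alpha>) \<partial>lebesgue)"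

definition locally_integrable :: "(real^'n \<Rightarrow> real) \<Rightarrow> bool" where
  "locally_integrable b \<longleftrightarrow> (\<forall>K. compact K \<longrightarrow> set_integrable lebesgue K b)"

end

theory Submission
  imports Defs
begin

text \<open>
  The kernel of the commutator is antisymmetric, so for a block combination \<open>f\<close> and a bounded \<open>g\<close> of bounded
  support \<open>\<integral> g [b, I]f = - \<integral> f [b, I]g\<close>, and the hypothesis on Morrey spaces bounds this pairing by the
  Morrey norm of \<open>g\<close>. It remains to recover a block decomposition of \<open>F = [b, I]f\<close> from that bound, i.e.
  the block space is the whole Koethe dual of the Morrey space. A gliding hump argument shows that \<open>F\<close> has absolutely
  continuous norm, because disjointly supported functions satisfy an upper \<open>s\<close>-estimate in the Morrey
  space with \<open>s = min p\<^sub>i > 1\<close>; so \<open>F\<close> reduces to bounded functions of bounded support, and these to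
  functions constant on the cells of a grid. For the latter a separating functional exists, which is again constant
  on the cells, and the extremizers of the mixed-norm Hoelder inequality show that its Morrey norm is bounded.

  The use of Fubini needs absolute convergence of \<open>\<integral> \<integral> \<bar>b x - b y\<bar> \<bar>f y\<bar> \<bar>x - y\<bar>\<^sup>\<alpha>\<^sup>-\<^sup>n\<close>
  over \<open>x\<close> in a ball. Near the ball this follows from the integrability of \<open>b\<close> forced by testing the
  hypothesis on the indicator of a distant ball; far away the kernel is dominated by images of test functions.
\<close>

section \<open>Iterated integrals and mixed norms\<close>

text \<open>The block norm is an infimum over infinite series, and no compactness of its unit ball
  is at hand. Two devices replace it. A function carried by a cube of side h with dual mixed norm at
  most \<open>c * h powr - \<theta>\<close> is c times one block, so an error that is small in the
  mixed norm on a fixed cube costs only a small coefficient: approximation in norm suffices, and no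
  limit of decompositions is taken. On grid functions the separating functional comes from an
  explicit variation in L^2 around an approximate minimizer, which makes the functional a grid
  function by construction. The price is the factor \<open>2 * (2 + 12 * 3 powr \<theta>)\<close>:
  the base 3 comes from enlarging a cube to whole grid cells, the summand 2 from two approximation
  errors, 12 = 4 * 3 from separating a grid function whose dual bound has tripled, and the outer 2
  from a geometric series of layers. A second obstacle is that b is only locally integrable while f
  may have unbounded support, so convergence of the integral defining [b, I]f is not given; only
  images of Morrey functions are controlled. Hence the dual norm is tested on bounded functions of
  bounded support only.\<close>

lemma coord_upd_nth [simp]: "coord_upd x i t $ j = (if j = i then t else x $ j)"
  by (simp add: coord_upd_def)

lemma continuous_on_coord_upd_component:
  "continuous_on S (\<lambda>x. if j = i then snd x else fst x $ j)" for j i :: "'n::finite"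
  by (cases "j = i") (auto intro!: continuous_intros)

lemma measurable_coord_upd [measurable]:
  "(\<lambda>z. coord_upd (fst z) i (snd z) :: real^'n) \<in> borel_measurable (borel \<Otimes>\<^sub>M borel)"
proof -
  have "continuous_on UNIV (\<lambda>z. coord_upd (fst z) i (snd z) :: real^'n)"
    unfolding coord_upd_def
    by (intro continuous_on_vec_lambda) (rule continuous_on_coord_upd_component)
  then show ?thesis
    by (simp add: borel_prod borel_measurable_continuous_onI)
qed

lemma epow_ennreal [simp]: "0 \<le> a \<Longrightarrow> epow (ennreal a) s = ennreal (a powr s)"
  by (simp add: epow_def)

lemma epow_top [simp]: "epow \<infinity> s = \<infinity>" "epow top s = top"
  by (simp_all add: epow_def)

lemma epow_zero [simp]: "epow 0 s = 0"
  by (simp add: epow_def)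

lemma epow_one [simp]: "epow x 1 = x"
  by (cases x) (auto simp: top_ennreal.rep_eq)

lemma borel_measurable_epow [measurable]:
  assumes [measurable]: "F \<in> borel_measurable M"
  shows "(\<lambda>x. epow (F x) s) \<in> borel_measurable M"
  unfolding epow_def by measurable

lemma epow_mono: "0 < s \<Longrightarrow> x \<le> y \<Longrightarrow> epow x s \<le> epow y s"
  by (cases x; cases y) (auto simp: powr_mono2 ennreal_leI top_unique)

lemma epow_epow: "epow (epow x r) s = epow x (r * s)"
  by (cases x) (auto simp: powr_powr)

lemma epow_inverse [simp]: "0 < r \<Longrightarrow> epow (epow x r) (1 / r) = x"
  "0 < r \<Longrightarrow> epow (epow x (1 / r)) r = x"
  by (simp_all add: epow_epow)

lemma epow_mult: "0 < s \<Longrightarrow> epow (x * y) s = epow x s * epow y s"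
proof (cases x; cases y)
  fix a b assume "0 < s" "x = ennreal a" "y = ennreal b" "0 \<le> a" "0 \<le> b"
  then show ?thesis
    by (simp add: powr_mult flip: ennreal_mult)
next
  fix a assume "0 < s" "x = ennreal a" "0 \<le> a" "y = top"
  then show ?thesis
    by (cases "a = 0") (auto simp: ennreal_mult_top)
next
  fix b assume "0 < s" "y = ennreal b" "0 \<le> b" "x = top"
  then show ?thesis
    by (cases "b = 0") (auto simp: ennreal_top_mult)
qed (auto simp: ennreal_top_mult)

lemma epow_eq_0_iff [simp]: "epow x s = 0 \<longleftrightarrow> x = 0"
  by (cases x) auto

lemma epow_eq_top_iff [simp]: "epow x s = top \<longleftrightarrow> x = top"
  by (cases x) auto

text \<open>One stage of \<open>mixed_iter\<close>. The coordinate i stays as a dummy argument, so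
  that every stage has the type of F and the iteration is a plain recursion on the list.\<close>

definition sec_norm :: "'n \<Rightarrow> real \<Rightarrow> (real^'n \<Rightarrow> ennreal) \<Rightarrow> real^'n \<Rightarrow> ennreal" where
  "sec_norm i r F x = epow (\<integral>\<^sup>+ t. epow (F (coord_upd x i t)) r \<partial>lborel) (1 / r)"

lemma mixed_iter_Cons: "mixed_iter F ((i, r) # L) = mixed_iter (sec_norm i r F) L"
  by (simp add: sec_norm_def[abs_def])

lemma mixed_iter_append: "mixed_iter F (L @ M) = mixed_iter (mixed_iter F L) M"
  by (induction L arbitrary: F) auto

lemma borel_measurable_sec_norm [measurable (raw)]:
  fixes F :: "real^'n \<Rightarrow> ennreal"
  assumes [measurable]: "F \<in> borel_measurable borel"
  shows "sec_norm i r F \<in> borel_measurable borel"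
proof -
  have "(\<lambda>z. epow (F (coord_upd (fst z) i (snd z))) r) \<in> borel_measurable (borel \<Otimes>\<^sub>M lborel)"
    by measurable
  then have "(\<lambda>x. \<integral>\<^sup>+ t. epow (F (coord_upd x i t)) r \<partial>lborel) \<in> borel_measurable borel"
    using lborel.borel_measurable_nn_integral_fst by fastforce
  then show ?thesis
    unfolding sec_norm_def[abs_def] by measurable
qed

lemma borel_measurable_coord_upd [measurable]: "(\<lambda>t. coord_upd x i t) \<in> borel_measurable borel"
  using measurable_Pair2[OF measurable_coord_upd, of x i] by simp

lemma sec_norm_mono:
  "0 < r \<Longrightarrow> (\<And>y. F y \<le> G y) \<Longrightarrow> sec_norm i r F x \<le> sec_norm i r G x"
  unfolding sec_norm_def by (intro epow_mono nn_integral_mono) auto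

lemma mixed_iter_mono:
  assumes "\<And>i r. (i, r) \<in> set L \<Longrightarrow> 0 < r" "\<And>y. F y \<le> G y"
  shows "mixed_iter F L x \<le> mixed_iter G L x"
  using assms
proof (induction L arbitrary: F G)
  case (Cons a L)
  obtain i r where a: "a = (i, r)" by force
  show ?case
    unfolding a mixed_iter_Cons using Cons.prems a
    by (intro Cons.IH sec_norm_mono) auto
qed auto

text \<open>D holds the coordinates on which F no longer depends; each stage adds the coordinate
  that it integrates out.\<close>

lemma mixed_iter_depends:
  assumes "\<And>x y. (\<And>j. j \<notin> D \<Longrightarrow> x $ j = y $ j) \<Longrightarrow> F x = F y"
    and "\<And>j. j \<notin> D \<Longrightarrow> j \<notin> fst ` set L \<Longrightarrow> x $ j = y $ j"
  shows "mixed_iter F L x = mixed_iter F L y"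
  using assms
proof (induction L arbitrary: D F)
  case (Cons a L)
  obtain i r where a: "a = (i, r)" by force
  show ?case
    unfolding a mixed_iter_Cons
  proof (rule Cons.IH[of "insert i D"])
    fix x y :: "real^'a" assume xy: "\<And>j. j \<notin> insert i D \<Longrightarrow> x $ j = y $ j"
    have "F (coord_upd x i t) = F (coord_upd y i t)" for t
      by (rule Cons.prems(1)) (use xy in auto)
    then show "sec_norm i r F x = sec_norm i r F y"
      by (simp add: sec_norm_def)
  next
    fix j assume "j \<notin> insert i D" "j \<notin> fst ` set L"
    with a show "x $ j = y $ j" by (intro Cons.prems(2)) auto
  qed
next
  case Nil
  show ?case unfolding mixed_iter.simps
    by (rule Nil(1)) (rule Nil(2), simp_all)
qed

text \<open>The full norm is a constant function, so the base point 0 in \<open>mixed_norm\<close>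
  is immaterial: what is proved for almost every base point holds for the norm itself.\<close>

lemma mixed_iter_full:
  assumes "fst ` set L = UNIV"
  shows "mixed_iter F L x = mixed_iter F L y"
proof (rule mixed_iter_depends[of "{}"])
  fix x y :: "real^'a" assume "\<And>j. j \<notin> {} \<Longrightarrow> x $ j = y $ j"
  then have "x = y" by (simp add: vec_eq_iff)
  then show "F x = F y" by simp
qed (simp add: assms)

section \<open>Lebesgue measure as a product measure, and Tonelli in single coordinates\<close>

lemma measurable_vec_lambda_PiM [measurable]:
  "(\<lambda>f. (\<chi> i. f i) :: real^'n) \<in> borel_measurable (\<Pi>\<^sub>M i\<in>UNIV. lborel)"
  by (subst borel_measurable_euclidean_space) (auto simp: Basis_vec_def inner_axis)

text \<open>Both measures give a box the product of its side lengths, which characterizes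
  \<open>lborel\<close>. The product form permits integration one coordinate at a time.\<close>

lemma lborel_vec_eq:
  "(lborel :: (real^'n) measure) = distr (\<Pi>\<^sub>M i\<in>UNIV. lborel) borel (\<lambda>f. \<chi> i. f i)"
proof (rule lborel_eqI)
  interpret product_sigma_finite "\<lambda>_::'n. lborel :: real measure" ..
  fix l u :: "real^'n" assume lu: "\<And>b. b \<in> Basis \<Longrightarrow> l \<bullet> b \<le> u \<bullet> b"
  have le: "l $ i \<le> u $ i" for i
    using lu[of "axis i 1"] by (simp add: inner_axis)
  have "(\<lambda>f. (\<chi> i. f i) :: real^'n) -` box l u \<inter> space (\<Pi>\<^sub>M i\<in>UNIV. lborel)
      = (\<Pi>\<^sub>E i\<in>UNIV. {l $ i <..< u $ i})"
    by (auto simp: space_PiM mem_box_cart PiE_def Pi_iff)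
  then have "emeasure (distr (\<Pi>\<^sub>M i\<in>UNIV. lborel) borel (\<lambda>f. \<chi> i. f i)) (box l u)
      = emeasure (\<Pi>\<^sub>M i\<in>(UNIV::'n set). lborel) (\<Pi>\<^sub>E i\<in>UNIV. {l $ i <..< u $ i})"
    by (subst emeasure_distr) auto
  also have "\<dots> = (\<Prod>i\<in>UNIV. ennreal (u $ i - l $ i))"
    by (subst emeasure_PiM) (auto simp: le)
  also have "\<dots> = ennreal (\<Prod>i\<in>UNIV. (u $ i - l $ i))"
    by (rule prod_ennreal) (simp add: le)
  also have "(\<Prod>i\<in>UNIV. (u $ i - l $ i)) = (\<Prod>b\<in>(\<lambda>i. axis i 1) ` UNIV. (u - l) \<bullet> b)"
    by (subst prod.reindex) (auto simp: inj_on_def axis_eq_axis inner_axis)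
  also have "(\<lambda>i. axis i 1) ` UNIV = (Basis :: (real^'n) set)"
    by (auto simp: Basis_vec_def)
  finally show "emeasure (distr (\<Pi>\<^sub>M i\<in>UNIV. lborel) borel (\<lambda>f. \<chi> i. f i)) (box l u) = (\<Prod>b\<in>Basis. (u - l) \<bullet> b)" .
qed simp

lemma sec_norm_one: "sec_norm i 1 F x = (\<integral>\<^sup>+ t. F (coord_upd x i t) \<partial>lborel)"
  by (simp add: sec_norm_def)

lemma measurable_merge_coords [measurable]:
  "(\<lambda>f. (\<chi> j. if j \<in> I then f j else x $ j) :: real^'n) \<in> borel_measurable (\<Pi>\<^sub>M i\<in>I. lborel)"
proof (subst borel_measurable_euclidean_space, safe)
  fix b :: "real^'n" assume "b \<in> Basis"
  then obtain j where b: "b = axis j 1" by (auto simp: Basis_vec_def)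
  show "(\<lambda>f. (\<chi> j. if j \<in> I then f j else x $ j) \<bullet> b) \<in> borel_measurable (\<Pi>\<^sub>M i\<in>I. lborel)"
    by (cases "j \<in> I") (auto simp: b inner_axis)
qed

text \<open>With all exponents 1 the iteration is Tonelli's theorem. Coordinates outside L are
  frozen at those of x, which makes an induction over L possible.\<close>

lemma mixed_iter_ones:
  fixes F :: "real^'n \<Rightarrow> ennreal"
  assumes "F \<in> borel_measurable borel" "distinct L"
  shows "mixed_iter F (map (\<lambda>i. (i, 1)) L) x =
    (\<integral>\<^sup>+ f. F (\<chi> j. if j \<in> set L then f j else x $ j) \<partial>(\<Pi>\<^sub>M i\<in>set L. lborel))"
  using assms
proof (induction L arbitrary: F)
  case Nil
  interpret product_sigma_finite "\<lambda>_::'n. lborel :: real measure" ..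
  have "mixed_iter F (map (\<lambda>i. (i, 1)) []) x = F (\<chi> j. if j \<in> set [] then undefined else x $ j)" by simp
  then show ?case unfolding list.set by (subst nn_integral_empty) auto
next
  case (Cons i L)
  interpret product_sigma_finite "\<lambda>_::'n. lborel :: real measure" ..
  note [measurable] = Cons.prems(1)
  have i: "i \<notin> set L" and L: "distinct L" using Cons.prems by auto
  have eq: "coord_upd (\<chi> j. if j \<in> set L then f j else x $ j) i t
     = (\<chi> j. if j \<in> set (i # L) then (f(i := t)) j else x $ j)" for f t
    using i by (auto simp: vec_eq_iff)
  have "mixed_iter F (map (\<lambda>i. (i, 1)) (i # L)) x = mixed_iter (sec_norm i 1 F) (map (\<lambda>i. (i, 1)) L) x"
    by (simp only: list.map mixed_iter_Cons)
  also have "\<dots> = (\<integral>\<^sup>+ f. sec_norm i 1 F (\<chi> j. if j \<in> set L then f j else x $ j) \<partial>(\<Pi>\<^sub>M i\<in>set L. lborel))"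
    by (rule Cons.IH) (auto intro: L)
  also have "\<dots> = (\<integral>\<^sup>+ f. F (\<chi> j. if j \<in> set (i # L) then f j else x $ j) \<partial>(\<Pi>\<^sub>M i\<in>insert i (set L). lborel))"
    by (subst product_nn_integral_insert) (auto simp: i sec_norm_one eq simp del: list.set intro!: measurable_compose[OF measurable_merge_coords] simp flip: list.set(2))
  finally show ?case by simp
qed

lemma nn_integral_lborel_vec:
  fixes F :: "real^'n \<Rightarrow> ennreal"
  assumes [measurable]: "F \<in> borel_measurable borel" and "distinct L" "set L = UNIV"
  shows "(\<integral>\<^sup>+ x. F x \<partial>lborel) = mixed_iter F (map (\<lambda>i. (i, 1)) L) x"
  by (subst lborel_vec_eq, subst nn_integral_distr) (simp_all add: mixed_iter_ones assms)

text \<open>Fubini for null sets along lines in direction i: the indicator of a null set is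
  integrated in direction i first, and the resulting function G is shown to have integral 0.\<close>

lemma AE_coord_upd:
  fixes P :: "real^'n \<Rightarrow> bool"
  assumes "AE x in lborel. P x"
  shows "AE x in lborel. AE t in lborel. P (coord_upd x i t)"
proof -
  obtain N where N: "{x. \<not> P x} \<subseteq> N" "N \<in> null_sets lborel"
    using assms by (force simp: eventually_ae_filter)
  then have [measurable]: "N \<in> sets borel" by auto
  define F :: "real^'n \<Rightarrow> ennreal" where "F = indicator N"
  have F [measurable]: "F \<in> borel_measurable borel" unfolding F_def by measurable
  obtain L where L: "set L = UNIV - {i}" "distinct L"
    using finite_distinct_list[of "UNIV - {i}"] by auto
  define G where "G = sec_norm i 1 F"
  have G [measurable]: "G \<in> borel_measurable borel" unfolding G_def by measurable
  have "mixed_iter G (map (\<lambda>i. (i, 1)) L) x = 0" for x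
  proof -
    have "mixed_iter G (map (\<lambda>i. (i, 1)) L) x = mixed_iter F (map (\<lambda>i. (i, 1)) (i # L)) x"
      by (simp only: G_def list.map mixed_iter_Cons)
    also have "\<dots> = (\<integral>\<^sup>+ x. F x \<partial>lborel)"
      by (rule nn_integral_lborel_vec[symmetric]) (use L in auto)
    also have "\<dots> = 0" using N by (simp add: F_def null_sets_def)
    finally show ?thesis .
  qed
  \<comment> \<open>G is already integrated in direction i; integrating it over the whole space
    needs direction i once more. The value stays 0 because the integral over the other coordinates
    vanishes at every base point.\<close>
  then have "sec_norm i 1 (mixed_iter G (map (\<lambda>i. (i, 1)) L)) x = 0" for x
    by (simp add: sec_norm_one)
  then have "mixed_iter G (map (\<lambda>i. (i, 1)) (L @ [i])) 0 = 0"
    by (simp add: mixed_iter_append mixed_iter_Cons del: mixed_iter.simps(2))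
  then have "(\<integral>\<^sup>+ x. G x \<partial>lborel) = 0"
    by (subst nn_integral_lborel_vec[of _ "L @ [i]" 0]) (use L in auto)
  then have "AE x in lborel. G x = 0"
    by (simp add: nn_integral_0_iff_AE)
  then show ?thesis
  proof eventually_elim
    case (elim x)
    then have "AE t in lborel. F (coord_upd x i t) = 0"
      by (simp add: G_def sec_norm_one nn_integral_0_iff_AE)
    then show ?case
      by eventually_elim (use N in \<open>auto simp: F_def indicator_def split: if_splits\<close>)
  qed
qed

text \<open>Only equality almost everywhere survives a stage, since F and G may differ along a whole
  line. \<open>AE_coord_upd\<close> says that almost every line is good.\<close>

lemma mixed_iter_cong_AE:
  fixes F G :: "real^'n \<Rightarrow> ennreal"
  assumes "AE x in lborel. F x = G x"
  shows "AE x in lborel. mixed_iter F L x = mixed_iter G L x"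
  using assms
proof (induction L arbitrary: F G)
  case (Cons a L)
  obtain i r where a: "a = (i, r)" by force
  have "AE x in lborel. sec_norm i r F x = sec_norm i r G x"
    using AE_coord_upd[OF Cons.prems, of i]
  proof eventually_elim
    case (elim x)
    then have "(\<integral>\<^sup>+ t. epow (F (coord_upd x i t)) r \<partial>lborel) = (\<integral>\<^sup>+ t. epow (G (coord_upd x i t)) r \<partial>lborel)"
      by (intro nn_integral_cong_AE) (auto elim: eventually_mono)
    then show ?case by (simp add: sec_norm_def)
  qed
  then show ?case unfolding a mixed_iter_Cons by (rule Cons.IH)
qed auto

lemma AE_lborel_exists:
  assumes "AE x in (lborel :: 'a::euclidean_space measure). P x"
  shows "\<exists>x. P x"
proof (rule ccontr)
  assume "\<nexists>x. P x"
  with assms have "AE x in (lborel :: 'a measure). False" by auto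
  then have "emeasure lborel (UNIV :: 'a set) = 0"
    by (simp add: AE_iff_measurable[OF _ refl])
  then show False by simp
qed

lemma set_coords [simp]: "set coords = UNIV" "distinct coords"
  by (simp_all add: coords_def)

lemma mixed_norm_cong_AE:
  fixes f g :: "real^('n::{finite,linorder}) \<Rightarrow> real"
  assumes "AE x in lebesgue. f x = g x"
  shows "mixed_norm r f = mixed_norm r g"
proof -
  let ?L = "map (\<lambda>i. (i, r $ i)) coords"
  have "AE x in lborel. f x = g x"
    using assms by (simp add: AE_completion_iff)
  then have "AE x in lborel. ennreal \<bar>f x\<bar> = ennreal \<bar>g x\<bar>"
    by eventually_elim auto
  from AE_lborel_exists[OF mixed_iter_cong_AE[OF this, of ?L]]
  obtain x where "mixed_iter (\<lambda>x. ennreal \<bar>f x\<bar>) ?L x = mixed_iter (\<lambda>x. ennreal \<bar>g x\<bar>) ?L x" ..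
  moreover have "fst ` set ?L = UNIV" by (simp add: image_image)
  ultimately show ?thesis
    unfolding mixed_norm_def by (metis mixed_iter_full)
qed

section \<open>Hoelder's inequality for mixed norms\<close>

lemma Holder_nn_integral:
  fixes u v :: "'a \<Rightarrow> ennreal"
  assumes [measurable]: "u \<in> borel_measurable M" "v \<in> borel_measurable M"
    and rs: "0 < r" "0 < s" "1 / r + 1 / s = 1"
  shows "(\<integral>\<^sup>+ t. u t * v t \<partial>M) \<le>
    epow (\<integral>\<^sup>+ t. epow (u t) r \<partial>M) (1 / r) * epow (\<integral>\<^sup>+ t. epow (v t) s \<partial>M) (1 / s)"
    (is "?I \<le> epow ?A _ * epow ?B _")
proof -
  have r1: "1 < r" "1 < s"
  proof -
    have "0 < 1 / r" "0 < 1 / s" using rs by auto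
    then have "1 / r < 1" "1 / s < 1" using rs(3) by linarith+
    then show "1 < r" "1 < s" using rs by auto
  qed
  \<comment> \<open>Young's inequality is applied to u and v divided by their norms, which must lie
    strictly between 0 and infinity. A zero norm makes the product vanish almost everywhere; an
    infinite norm next to a nonzero one makes the right-hand side infinite.\<close>
  consider "?A = 0" | "?B = 0" | "?A \<noteq> 0" "?B \<noteq> 0" "?A = top \<or> ?B = top"
    | "?A \<noteq> 0" "?B \<noteq> 0" "?A \<noteq> top" "?B \<noteq> top" by blast
  then show ?thesis
  proof cases
    case 1
    then have "AE t in M. u t = 0" by (simp add: nn_integral_0_iff_AE)
    then have "AE t in M. u t * v t = 0" by eventually_elim auto
    then show ?thesis by (simp add: nn_integral_0_iff_AE[THEN iffD2])
  next
    case 2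
    then have "AE t in M. v t = 0" by (simp add: nn_integral_0_iff_AE)
    then have "AE t in M. u t * v t = 0" by eventually_elim auto
    then show ?thesis by (simp add: nn_integral_0_iff_AE[THEN iffD2])
  next
    case 3
    then have "epow ?A (1 / r) * epow ?B (1 / s) = top"
      by (auto simp: ennreal_mult_eq_top_iff)
    then show ?thesis by simp
  next
    case 4
    then obtain A B where AB: "?A = ennreal A" "?B = ennreal B" "0 < A" "0 < B"
      by (cases ?A; cases ?B) (auto simp: less_le)
    define a b where "a = A powr (1 / r)" and "b = B powr (1 / s)"
    have ab: "0 < a" "0 < b" "a powr r = A" "b powr s = B"
      using AB rs by (auto simp: a_def b_def powr_powr)
    have le: "u t * v t \<le> ennreal (a * b) * (ennreal (1 / (r * A)) * epow (u t) r + ennreal (1 / (s * B)) * epow (v t) s)" for t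
    proof (cases "u t = top \<or> v t = top")
      case True
      then have "ennreal (1 / (r * A)) * epow (u t) r + ennreal (1 / (s * B)) * epow (v t) s = top"
        using rs AB by (auto simp: ennreal_mult_eq_top_iff)
      moreover have "ennreal (a * b) \<noteq> 0" using ab by simp
      ultimately show ?thesis by (simp only: ennreal_mult_top if_False top_greatest)
    next
      case False
      then obtain x y where xy: "u t = ennreal x" "v t = ennreal y" "0 \<le> x" "0 \<le> y"
        by (cases "u t"; cases "v t") auto
      have "(x / a) * (y / b) \<le> (x / a) powr r / r + (y / b) powr s / s"
        by (rule Youngs_inequality) (use r1 rs ab xy in auto)
      moreover have "(x / a) powr r = x powr r / A" "(y / b) powr s = y powr s / B"
        using ab xy by (simp_all add: powr_divide)
      ultimately have "x / a * (y / b) \<le> x powr r / A / r + y powr s / B / s"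
        by simp
      then have "(a * b) * (x / a * (y / b)) \<le> (a * b) * (x powr r / A / r + y powr s / B / s)"
        using ab by (intro mult_left_mono) auto
      moreover have "(a * b) * (x / a * (y / b)) = x * y"
        using ab by simp
      ultimately have "x * y \<le> (a * b) * (1 / (r * A) * x powr r + 1 / (s * B) * y powr s)"
        by (simp add: field_simps)
      then show ?thesis
        using xy ab rs AB by (simp flip: ennreal_mult ennreal_plus add: ennreal_leI)
    qed
    have "?I \<le> (\<integral>\<^sup>+ t. ennreal (a * b) * (ennreal (1 / (r * A)) * epow (u t) r + ennreal (1 / (s * B)) * epow (v t) s) \<partial>M)"
      by (intro nn_integral_mono le)
    also have "\<dots> = ennreal (a * b) * (ennreal (1 / (r * A)) * ?A + ennreal (1 / (s * B)) * ?B)"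
      by (simp add: nn_integral_cmult nn_integral_add)
    also have "\<dots> = ennreal (a * b * (1 / (r * A) * A + 1 / (s * B) * B))"
      using AB ab rs by (simp flip: ennreal_mult ennreal_plus)
    also have "a * b * (1 / (r * A) * A + 1 / (s * B) * B) = a * b"
      using AB rs by (simp add: field_simps)
    also have "ennreal (a * b) = epow ?A (1 / r) * epow ?B (1 / s)"
      using AB by (simp add: a_def b_def ennreal_mult)
    finally show ?thesis .
  qed
qed

lemma conj_exp_props:
  assumes "1 < r"
  shows "1 < conj_exp r" "1 / r + 1 / conj_exp r = 1" "conj_exp r * (r - 1) = r"
  using assms by (auto simp: conj_exp_def field_simps)

text \<open>One-dimensional Hoelder in the innermost variable, then induction for the two section
  norms.\<close>

lemma Holder_mixed_iter:
  fixes F H :: "real^'n \<Rightarrow> ennreal"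
  assumes "F \<in> borel_measurable borel" "H \<in> borel_measurable borel" "\<And>i r. (i, r) \<in> set L \<Longrightarrow> 1 < r"
  shows "mixed_iter (\<lambda>x. F x * H x) (map (\<lambda>(i, r). (i, 1)) L) x
     \<le> mixed_iter F L x * mixed_iter H (map (\<lambda>(i, r). (i, conj_exp r)) L) x"
  using assms
proof (induction L arbitrary: F H)
  case (Cons a L)
  obtain i r where a: "a = (i, r)" by force
  have r: "1 < r" using Cons.prems a by auto
  note [measurable] = Cons.prems(1,2)
  note c = conj_exp_props[OF r]
  have "mixed_iter (\<lambda>x. F x * H x) (map (\<lambda>(i, r). (i, 1)) (a # L)) x
     = mixed_iter (sec_norm i 1 (\<lambda>x. F x * H x)) (map (\<lambda>(i, r). (i, 1)) L) x"
    by (simp only: a list.map prod.case mixed_iter_Cons)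
  also have "\<dots> \<le> mixed_iter (\<lambda>x. sec_norm i r F x * sec_norm i (conj_exp r) H x) (map (\<lambda>(i, r). (i, 1)) L) x"
  proof (rule mixed_iter_mono)
    fix y
    show "sec_norm i 1 (\<lambda>x. F x * H x) y \<le> sec_norm i r F y * sec_norm i (conj_exp r) H y"
      unfolding sec_norm_one unfolding sec_norm_def
      by (rule Holder_nn_integral) (use r c in auto)
  qed auto
  also have "\<dots> \<le> mixed_iter (sec_norm i r F) L x * mixed_iter (sec_norm i (conj_exp r) H) (map (\<lambda>(i, r). (i, conj_exp r)) L) x"
    by (rule Cons.IH) (use Cons.prems in auto)
  finally show ?case
    by (simp only: a list.map prod.case mixed_iter_Cons)
qed auto

lemma lebesgue_borel_AE_eq:
  fixes f :: "'a::euclidean_space \<Rightarrow> real"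
  assumes "f \<in> borel_measurable lebesgue"
  obtains f' where "f' \<in> borel_measurable borel" "AE x in lebesgue. f x = f' x"
  using completion_ex_borel_measurable_real[OF assms] by (auto simp: AE_completion)

lemma Holder_mixed_norm:
  fixes f h :: "real^('n::{finite,linorder}) \<Rightarrow> real"
  assumes f: "f \<in> borel_measurable lebesgue" and h: "h \<in> borel_measurable lebesgue" and r: "\<And>i. 1 < r $ i"
  shows "(\<integral>\<^sup>+ x. ennreal \<bar>f x * h x\<bar> \<partial>lebesgue) \<le> mixed_norm r f * mixed_norm (conj_vec r) h"
proof -
  obtain f' where f'[measurable]: "f' \<in> borel_measurable borel" and fe: "AE x in lebesgue. f x = f' x"
    using f by (rule lebesgue_borel_AE_eq)
  obtain h' where h'[measurable]: "h' \<in> borel_measurable borel" and he: "AE x in lebesgue. h x = h' x"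
    using h by (rule lebesgue_borel_AE_eq)
  have "(\<integral>\<^sup>+ x. ennreal \<bar>f x * h x\<bar> \<partial>lebesgue) = (\<integral>\<^sup>+ x. ennreal \<bar>f' x\<bar> * ennreal \<bar>h' x\<bar> \<partial>lebesgue)"
    using fe he by (intro nn_integral_cong_AE, eventually_elim) (simp add: abs_mult ennreal_mult)
  also have "\<dots> = (\<integral>\<^sup>+ x. ennreal \<bar>f' x\<bar> * ennreal \<bar>h' x\<bar> \<partial>lborel)"
    by (simp add: nn_integral_completion)
  also have "\<dots> = mixed_iter (\<lambda>x. ennreal \<bar>f' x\<bar> * ennreal \<bar>h' x\<bar>) (map (\<lambda>(i, r). (i, 1)) (map (\<lambda>i. (i, r $ i)) coords)) 0"
    by (subst nn_integral_lborel_vec[of _ coords 0]) (auto simp: comp_def)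
  also have "\<dots> \<le> mixed_norm r f' * mixed_norm (conj_vec r) h'"
    using Holder_mixed_iter[of "\<lambda>x. ennreal \<bar>f' x\<bar>" "\<lambda>x. ennreal \<bar>h' x\<bar>" "map (\<lambda>i. (i, r $ i)) coords" 0] r
    by (auto simp: mixed_norm_def comp_def conj_vec_def)
  finally show ?thesis
    using mixed_norm_cong_AE[OF fe] mixed_norm_cong_AE[OF he] by simp
qed

section \<open>Minkowski's inequality and s-convexity of mixed norms\<close>

lemma powr_convex_combination:
  fixes x y t \<rho> :: real
  assumes "1 \<le> \<rho>" "0 \<le> x" "0 \<le> y" "0 \<le> t" "t \<le> 1"
  shows "(t * x + (1 - t) * y) powr \<rho> \<le> t * x powr \<rho> + (1 - t) * y powr \<rho>"
proof -
  \<comment> \<open>At the endpoint 0 of the half-line convexity reduces to this inequality;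
    \<open>powr_convex\<close> covers positive arguments.\<close>
  have small: "t powr \<rho> \<le> t" if "0 \<le> t" "t \<le> 1" for t :: real
    using powr_mono'[of 1 \<rho> t] that assms(1) by (cases "t = 0") auto
  consider "x = 0" | "y = 0" | "0 < x" "0 < y" using assms by linarith
  then show ?thesis
  proof cases
    case 1
    then show ?thesis
      using assms small[of "1 - t"] by (auto simp: powr_mult intro!: mult_right_mono)
  next
    case 2
    then show ?thesis
      using assms small[of t] by (auto simp: powr_mult intro!: mult_right_mono)
  next
    case 3
    then show ?thesis
      using convex_onD[OF powr_convex[OF assms(1)], of "1 - t" x y] assms by simp
  qed
qed

text \<open>Convexity of the power r: with a and b the two norms, u + v is a + b times the convex
  combination of u / a and v / b with weights a / (a + b) and b / (a + b).\<close>

lemma Minkowski_nn_integral: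
  fixes u v :: "'a \<Rightarrow> ennreal"
  assumes [measurable]: "u \<in> borel_measurable M" "v \<in> borel_measurable M" and r: "1 \<le> r"
  shows "epow (\<integral>\<^sup>+ t. epow (u t + v t) r \<partial>M) (1 / r) \<le>
    epow (\<integral>\<^sup>+ t. epow (u t) r \<partial>M) (1 / r) + epow (\<integral>\<^sup>+ t. epow (v t) r \<partial>M) (1 / r)"
    (is "?C \<le> epow ?A _ + epow ?B _")
proof -
  consider "?A = 0" | "?B = 0" | "?A = top \<or> ?B = top"
    | "?A \<noteq> 0" "?B \<noteq> 0" "?A \<noteq> top" "?B \<noteq> top" by blast
  then show ?thesis
  proof cases
    case 1
    then have "AE t in M. u t = 0" by (simp add: nn_integral_0_iff_AE)
    then have "(\<integral>\<^sup>+ t. epow (u t + v t) r \<partial>M) = ?B"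
      by (intro nn_integral_cong_AE) (auto elim: eventually_mono)
    then show ?thesis by simp
  next
    case 2
    then have "AE t in M. v t = 0" by (simp add: nn_integral_0_iff_AE)
    then have "(\<integral>\<^sup>+ t. epow (u t + v t) r \<partial>M) = ?A"
      by (intro nn_integral_cong_AE) (auto elim: eventually_mono)
    then show ?thesis by simp
  next
    case 3
    then show ?thesis by auto
  next
    case 4
    then obtain A B where AB: "?A = ennreal A" "?B = ennreal B" "0 < A" "0 < B"
      by (cases ?A; cases ?B) (auto simp: less_le)
    define a b where "a = A powr (1 / r)" and "b = B powr (1 / r)"
    have ab: "0 < a" "0 < b" "a powr r = A" "b powr r = B"
      using AB r by (auto simp: a_def b_def powr_powr)
    define t where "t = a / (a + b)"
    have t: "0 < t" "t < 1" "1 - t = b / (a + b)"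
      using ab by (auto simp: t_def field_simps)
    define c where "c = (a + b) powr r"
    have c: "0 < c" using ab by (simp add: c_def)
    have le: "epow (u z + v z) r \<le> ennreal c * (ennreal (t / A) * epow (u z) r + ennreal ((1 - t) / B) * epow (v z) r)" for z
    proof (cases "u z = top \<or> v z = top")
      case True
      then have "ennreal (t / A) * epow (u z) r + ennreal ((1 - t) / B) * epow (v z) r = top"
        using t(1,2) AB by (auto simp: ennreal_mult_eq_top_iff ennreal_eq_0_iff divide_le_0_iff simp del: t(3))
      moreover have "ennreal c \<noteq> 0" using c by simp
      ultimately show ?thesis by (simp only: ennreal_mult_top if_False top_greatest)
    next
      case False
      then obtain x y where xy: "u z = ennreal x" "v z = ennreal y" "0 \<le> x" "0 \<le> y"
        by (cases "u z"; cases "v z") auto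
      have "x + y = (a + b) * (t * (x / a) + (1 - t) * (y / b))"
      proof -
        have "(a + b) * (t * (x / a)) = x" "(a + b) * ((1 - t) * (y / b)) = y"
          using ab unfolding t(3) by (simp_all add: t_def)
        then show ?thesis by (simp only: distrib_left)
      qed
      then have "(x + y) powr r = c * (t * (x / a) + (1 - t) * (y / b)) powr r"
        using ab t xy by (simp add: powr_mult c_def)
      also have "\<dots> \<le> c * (t * (x / a) powr r + (1 - t) * (y / b) powr r)"
        by (intro mult_left_mono powr_convex_combination) (use r c ab t xy in auto)
      also have "(x / a) powr r = x powr r / A"
        using ab xy by (simp add: powr_divide)
      also have "(y / b) powr r = y powr r / B"
        using ab xy by (simp add: powr_divide)
      finally have "(x + y) powr r \<le> c * (t / A * x powr r + (1 - t) / B * y powr r)" by simp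
      moreover have "0 \<le> t / A" "0 \<le> (1 - t) / B" using t(1,2) AB by auto
      ultimately show ?thesis
        using xy c by (simp del: t(3) flip: ennreal_mult ennreal_plus times_divide_eq_left add: ennreal_leI)
    qed
    have "(\<integral>\<^sup>+ t. epow (u t + v t) r \<partial>M) \<le> (\<integral>\<^sup>+ z. ennreal c * (ennreal (t / A) * epow (u z) r + ennreal ((1 - t) / B) * epow (v z) r) \<partial>M)"
      by (intro nn_integral_mono le)
    also have "\<dots> = ennreal c * (ennreal (t / A) * ?A + ennreal ((1 - t) / B) * ?B)"
      by (simp add: nn_integral_cmult nn_integral_add)
    also have "\<dots> = ennreal (c * (t / A * A + (1 - t) / B * B))"
    proof -
      have "0 \<le> t / A" "0 \<le> (1 - t) / B" using t(1,2) AB by auto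
      then show ?thesis unfolding AB(1,2)
        using AB(3,4) c by (simp del: t(3) flip: ennreal_mult ennreal_plus times_divide_eq_left)
    qed
    also have "c * (t / A * A + (1 - t) / B * B) = c"
      using AB by simp
    finally have "?C \<le> epow (ennreal c) (1 / r)"
      using r by (intro epow_mono) auto
    also have "\<dots> = ennreal (a + b)"
      using ab r c by (simp add: c_def powr_powr)
    also have "\<dots> = epow ?A (1 / r) + epow ?B (1 / r)"
      using AB by (simp add: a_def b_def)
    finally show ?thesis .
  qed
qed

lemma Minkowski_nn_integral_sum:
  fixes u :: "'i \<Rightarrow> 'a \<Rightarrow> ennreal"
  assumes "finite I" and m: "\<And>i. i \<in> I \<Longrightarrow> u i \<in> borel_measurable M" and r: "1 \<le> r"
  shows "epow (\<integral>\<^sup>+ t. epow (\<Sum>i\<in>I. u i t) r \<partial>M) (1 / r) \<le>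
    (\<Sum>i\<in>I. epow (\<integral>\<^sup>+ t. epow (u i t) r \<partial>M) (1 / r))"
  using assms(1,2)
proof (induction I rule: finite_induct)
  case (insert i I)
  have [measurable]: "u j \<in> borel_measurable M" if "j \<in> insert i I" for j
    using insert.prems that by blast
  have "(\<lambda>t. \<Sum>j\<in>I. u j t) \<in> borel_measurable M"
    using insert.prems by (intro borel_measurable_sum) auto
  then have "epow (\<integral>\<^sup>+ t. epow (u i t + (\<Sum>j\<in>I. u j t)) r \<partial>M) (1 / r) \<le>
     epow (\<integral>\<^sup>+ t. epow (u i t) r \<partial>M) (1 / r) + epow (\<integral>\<^sup>+ t. epow (\<Sum>j\<in>I. u j t) r \<partial>M) (1 / r)"
    using insert.prems by (intro Minkowski_nn_integral r) auto
  also have "\<dots> \<le> epow (\<integral>\<^sup>+ t. epow (u i t) r \<partial>M) (1 / r) + (\<Sum>j\<in>I. epow (\<integral>\<^sup>+ t. epow (u j t) r \<partial>M) (1 / r))"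
    using insert.IH insert.prems by (intro add_left_mono) auto
  finally show ?case using insert.hyps by simp
qed simp

text \<open>L^r is s-convex with constant 1 for s at most r: this is Minkowski's inequality in
  L^(r/s) for the powers \<open>epow (F j x) s\<close>.\<close>

lemma sec_norm_convexity:
  fixes F :: "'i \<Rightarrow> real^'n \<Rightarrow> ennreal"
  assumes fin: "finite I" and [measurable]: "\<And>j. F j \<in> borel_measurable borel" and s: "0 < s" "s \<le> r"
  shows "sec_norm i r (\<lambda>x. epow (\<Sum>j\<in>I. epow (F j x) s) (1 / s)) x
     \<le> epow (\<Sum>j\<in>I. epow (sec_norm i r (F j) x) s) (1 / s)"
proof -
  let ?u = "\<lambda>j t. epow (F j (coord_upd x i t)) s"
  have r: "0 < r" using s by simp
  have "sec_norm i r (\<lambda>x. epow (\<Sum>j\<in>I. epow (F j x) s) (1 / s)) x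
     = epow (epow (\<integral>\<^sup>+ t. epow (\<Sum>j\<in>I. ?u j t) (r / s) \<partial>lborel) (1 / (r / s))) (1 / s)"
    using s by (simp add: sec_norm_def epow_epow)
  also have "\<dots> \<le> epow (\<Sum>j\<in>I. epow (\<integral>\<^sup>+ t. epow (?u j t) (r / s) \<partial>lborel) (1 / (r / s))) (1 / s)"
    using s by (intro epow_mono Minkowski_nn_integral_sum fin) auto
  also have "(\<lambda>j. epow (\<integral>\<^sup>+ t. epow (?u j t) (r / s) \<partial>lborel) (1 / (r / s))) = (\<lambda>j. epow (sec_norm i r (F j) x) s)"
    using s by (simp add: sec_norm_def epow_epow)
  finally show ?thesis .
qed

text \<open>s-convexity survives the iteration as long as s is at most every exponent, which is why
  the minimum of the exponents appears later. For disjointly supported F j the left-hand side is the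
  norm of their sum.\<close>

lemma mixed_iter_convexity:
  fixes F :: "'i \<Rightarrow> real^'n \<Rightarrow> ennreal"
  assumes fin: "finite I" and "\<And>j. F j \<in> borel_measurable borel" and s: "0 < s"
    and "\<And>i r. (i, r) \<in> set L \<Longrightarrow> s \<le> r"
  shows "mixed_iter (\<lambda>x. epow (\<Sum>j\<in>I. epow (F j x) s) (1 / s)) L x
     \<le> epow (\<Sum>j\<in>I. epow (mixed_iter (F j) L x) s) (1 / s)"
  using assms(2,4)
proof (induction L arbitrary: F)
  case (Cons a L)
  obtain i r where a: "a = (i, r)" by force
  then have r: "s \<le> r" using Cons.prems by auto
  have "mixed_iter (sec_norm i r (\<lambda>x. epow (\<Sum>j\<in>I. epow (F j x) s) (1 / s))) L x
     \<le> mixed_iter (\<lambda>x. epow (\<Sum>j\<in>I. epow (sec_norm i r (F j) x) s) (1 / s)) L x"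
    using Cons.prems s r
    by (intro mixed_iter_mono sec_norm_convexity fin) fastforce+
  also have "\<dots> \<le> epow (\<Sum>j\<in>I. epow (mixed_iter (sec_norm i r (F j)) L x) s) (1 / s)"
    using Cons.prems by (intro Cons.IH borel_measurable_sec_norm) auto
  finally show ?case unfolding a mixed_iter_Cons .
qed auto

section \<open>Mixed norms of bounded functions on cubes\<close>

lemma One_nth [simp]: "(One :: real^'n) $ i = 1"
proof -
  have "(One :: real^'n) $ i = One \<bullet> axis i (1::real)" by (simp add: inner_axis)
  also have "\<dots> = 1" by (rule inner_sum_Basis) (auto simp: Basis_vec_def)
  finally show ?thesis .
qed

lemma mem_cube: "x \<in> cube a h \<longleftrightarrow> (\<forall>i. x $ i \<in> {a $ i..a $ i + h})"
  by (simp add: cube_def mem_box_cart del: sum_component)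

lemma sum_list_exps_coords:
  "(\<Sum>(i, r)\<leftarrow>map (\<lambda>i. (i, r $ i)) coords. 1 / r) = (\<Sum>i\<in>UNIV. 1 / r $ i)" for r :: "real^('n::{finite,linorder})"
  by (simp add: comp_def sum_list_distinct_conv_sum_set)

lemma sec_norm_box_le:
  assumes r: "0 < r" and h: "0 \<le> h" and c: "0 \<le> c"
    and le: "\<And>x. F x \<le> ennreal c" and z: "\<And>x. x $ i \<notin> {a..a + h} \<Longrightarrow> F x = 0"
  shows "sec_norm i r F x \<le> ennreal (c * h powr (1 / r))"
proof -
  have "epow (F (coord_upd x i t)) r \<le> ennreal (c powr r) * indicator {a..a + h} t" for t
    using epow_mono[OF r le[of "coord_upd x i t"]] z[of "coord_upd x i t"] c by (auto simp: indicator_def)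
  then have "(\<integral>\<^sup>+ t. epow (F (coord_upd x i t)) r \<partial>lborel) \<le> (\<integral>\<^sup>+ t. ennreal (c powr r) * indicator {a..a + h} t \<partial>lborel)"
    by (intro nn_integral_mono)
  also have "\<dots> = ennreal (c powr r * h)"
    using h by (simp add: nn_integral_cmult_indicator ennreal_mult)
  finally have "sec_norm i r F x \<le> epow (ennreal (c powr r * h)) (1 / r)"
    unfolding sec_norm_def using r by (intro epow_mono) auto
  also have "\<dots> = ennreal (c * h powr (1 / r))"
    using r c h by (simp add: powr_mult powr_powr)
  finally show ?thesis .
qed

lemma sec_norm_zero_off:
  assumes "\<And>x. x $ j \<notin> A \<Longrightarrow> F x = 0" "j \<noteq> i" "x $ j \<notin> A"
  shows "sec_norm i r F x = 0"
proof -
  have "F (coord_upd x i t) = 0" for t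
    by (rule assms(1)) (use assms in simp)
  then show ?thesis by (simp add: sec_norm_def)
qed

lemma mixed_iter_box_le:
  assumes "0 < h" "0 \<le> c" "\<And>x. F x \<le> ennreal c"
    and "\<And>x i. i \<in> fst ` set L \<Longrightarrow> x $ i \<notin> {a $ i..a $ i + h} \<Longrightarrow> F x = 0"
    and "\<And>i r. (i, r) \<in> set L \<Longrightarrow> 0 < r" "distinct (map fst L)"
  shows "mixed_iter F L x \<le> ennreal (c * h powr (\<Sum>(i, r)\<leftarrow>L. 1 / r))"
  using assms
proof (induction L arbitrary: F c)
  case (Cons b L)
  obtain i r where b: "b = (i, r)" by force
  have r: "0 < r" using Cons.prems(5)[of i r] b by simp
  have h: "0 < h" by fact
  have "mixed_iter (sec_norm i r F) L x \<le> ennreal (c * h powr (1 / r) * h powr (\<Sum>(i, r)\<leftarrow>L. 1 / r))"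
  proof (rule Cons.IH)
    show "sec_norm i r F y \<le> ennreal (c * h powr (1 / r))" for y
      using h b by (intro sec_norm_box_le[where a = "a $ i"] r Cons.prems(2,3) Cons.prems(4)[of i]) auto
    fix y j assume j: "j \<in> fst ` set L" "y $ j \<notin> {a $ j..a $ j + h}"
    then have "j \<noteq> i" using Cons.prems b by auto
    then show "sec_norm i r F y = 0"
      by (intro sec_norm_zero_off[where j = j and A = "{a $ j..a $ j + h}"] Cons.prems(4)) (use j in auto)
  next
    show "0 < r'" if "(i', r') \<in> set L" for i' r' using Cons.prems(5)[of i' r'] that by simp
  qed (use Cons.prems h b in auto)
  then show ?case unfolding b mixed_iter_Cons
    by (simp add: powr_add mult.assoc)
qed simp

lemma tendsto_epow_0:
  assumes X: "(X \<longlongrightarrow> 0) F" and s: "0 < s"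
  shows "((\<lambda>k. epow (X k) s) \<longlongrightarrow> 0) F"
proof -
  have ev: "eventually (\<lambda>k. X k < 1) F"
    using X by (rule order_tendstoD) simp
  have "((\<lambda>k. enn2real (X k)) \<longlongrightarrow> enn2real 0) F"
    using X by (intro tendsto_enn2real) auto
  then have "((\<lambda>k. enn2real (X k) powr s) \<longlongrightarrow> 0 powr s) F"
    using s by (intro tendsto_powr') auto
  then have "((\<lambda>k. ennreal (enn2real (X k) powr s)) \<longlongrightarrow> ennreal 0) F"
    by (intro tendsto_ennrealI) simp
  then show ?thesis
  proof -
    have "\<forall>\<^sub>F k in F. ennreal (enn2real (X k) powr s) = epow (X k) s"
      using ev by eventually_elim (auto simp: epow_def)
    with \<open>((\<lambda>k. ennreal (enn2real (X k) powr s)) \<longlongrightarrow> ennreal 0) F\<close>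
    show ?thesis by (auto intro: Lim_transform_eventually)
  qed
qed

text \<open>Dominated convergence on almost every line. The dominating function is constant on an
  interval of length h, and the bound c grows by the factor \<open>h powr (1 / r)\<close> per stage,
  so c is general in the induction.\<close>

lemma mixed_iter_dominated_convergence:
  fixes F :: "nat \<Rightarrow> real^'n \<Rightarrow> ennreal"
  assumes "\<And>k. F k \<in> borel_measurable borel" and "0 \<le> h" "0 \<le> c" "\<And>k x. F k x \<le> ennreal c"
    and "\<And>k x i. i \<in> fst ` set L \<Longrightarrow> x $ i \<notin> {a $ i..a $ i + h} \<Longrightarrow> F k x = 0"
    and "\<And>i r. (i, r) \<in> set L \<Longrightarrow> 0 < r" "distinct (map fst L)"
    and "AE x in lborel. (\<lambda>k. F k x) \<longlonglongrightarrow> 0"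
  shows "AE x in lborel. (\<lambda>k. mixed_iter (F k) L x) \<longlonglongrightarrow> 0"
  using assms
proof (induction L arbitrary: F c)
  case (Cons b L)
  obtain i r where b: "b = (i, r)" by force
  have r: "0 < r" using Cons.prems(6)[of i r] b by simp
  have [measurable]: "F k \<in> borel_measurable borel" for k by (rule Cons.prems(1))
  have "AE x in lborel. (\<lambda>k. mixed_iter (sec_norm i r (F k)) L x) \<longlonglongrightarrow> 0"
  proof (rule Cons.IH)
    show "sec_norm i r (F k) y \<le> ennreal (c * h powr (1 / r))" for k y
      using b by (intro sec_norm_box_le[where a = "a $ i"] r Cons.prems(2-4) Cons.prems(5)[of i]) auto
    fix k y j assume j: "j \<in> fst ` set L" "y $ j \<notin> {a $ j..a $ j + h}"
    then have "j \<noteq> i" using Cons.prems b by auto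
    then show "sec_norm i r (F k) y = 0"
      by (intro sec_norm_zero_off[where j = j and A = "{a $ j..a $ j + h}"] Cons.prems(5)) (use j in auto)
  next
    show "AE x in lborel. (\<lambda>k. sec_norm i r (F k) x) \<longlonglongrightarrow> 0"
      using AE_coord_upd[OF Cons.prems(8), of i]
    proof eventually_elim
      case (elim x)
      have "(\<lambda>k. \<integral>\<^sup>+ t. epow (F k (coord_upd x i t)) r \<partial>lborel) \<longlonglongrightarrow> (\<integral>\<^sup>+ (t::real). 0 \<partial>lborel)"
      proof (rule nn_integral_dominated_convergence[where w = "\<lambda>t. ennreal (c powr r) * indicator {a $ i..a $ i + h} t"])
        show "AE t in lborel. epow (F k (coord_upd x i t)) r \<le> ennreal (c powr r) * indicator {a $ i..a $ i + h} t" for k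
        proof (rule AE_I2)
          fix t
          show "epow (F k (coord_upd x i t)) r \<le> ennreal (c powr r) * indicator {a $ i..a $ i + h} t"
            using epow_mono[OF r Cons.prems(4)[of k "coord_upd x i t"]] Cons.prems(5)[of i "coord_upd x i t" k] Cons.prems(3) b
            by (auto simp: indicator_def)
        qed
        show "(\<integral>\<^sup>+ t. ennreal (c powr r) * indicator {a $ i..a $ i + h} t \<partial>lborel) < \<infinity>"
          using Cons.prems by (simp add: nn_integral_cmult_indicator ennreal_mult_less_top)
        show "AE t in lborel. (\<lambda>k. epow (F k (coord_upd x i t)) r) \<longlonglongrightarrow> 0"
          using elim by eventually_elim (rule tendsto_epow_0[OF _ r])
      qed (simp_all)
      then show ?case
        unfolding sec_norm_def using r by (intro tendsto_epow_0) auto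
    qed
  next
    show "0 < r'" if "(i', r') \<in> set L" for i' r' using Cons.prems(6)[of i' r'] that by simp
  qed (use Cons.prems(2,3,7) in \<open>auto intro: mult_nonneg_nonneg\<close>)
  then show ?case unfolding b mixed_iter_Cons .
qed auto

lemma mixed_norm_dominated_convergence:
  fixes F :: "nat \<Rightarrow> real^('n::{finite,linorder}) \<Rightarrow> real"
  assumes "\<And>k. F k \<in> borel_measurable borel" "0 \<le> h" "\<And>k x. \<bar>F k x\<bar> \<le> c"
    and "\<And>k x. x \<notin> cube a h \<Longrightarrow> F k x = 0"
    and "\<And>i. 0 < r $ i"
    and "AE x in lborel. (\<lambda>k. F k x) \<longlonglongrightarrow> 0"
  shows "(\<lambda>k. mixed_norm r (F k)) \<longlonglongrightarrow> 0"
proof -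
  let ?L = "map (\<lambda>i. (i, r $ i)) coords"
  have [measurable]: "F k \<in> borel_measurable borel" for k by fact
  have c: "0 \<le> c" using assms(3)[of 0 0] by linarith
  have "AE x in lborel. (\<lambda>k. mixed_iter (\<lambda>x. ennreal \<bar>F k x\<bar>) ?L x) \<longlonglongrightarrow> 0"
  proof (rule mixed_iter_dominated_convergence[where a = a and h = h and c = c])
    fix k x i assume "x $ i \<notin> {a $ i..a $ i + h}"
    then have "x \<notin> cube a h" by (auto simp: mem_cube)
    then show "ennreal \<bar>F k x\<bar> = 0" using assms(4) by simp
  next
    show "AE x in lborel. (\<lambda>k. ennreal \<bar>F k x\<bar>) \<longlonglongrightarrow> 0"
      using assms(6)
    proof eventually_elim
      case (elim x)
      from tendsto_rabs_zero[OF this] have "(\<lambda>k. ennreal \<bar>F k x\<bar>) \<longlonglongrightarrow> ennreal 0"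
        by (rule tendsto_ennrealI)
      then show ?case by simp
    qed
  qed (use assms c in \<open>auto simp: ennreal_leI comp_def\<close>)
  from AE_lborel_exists[OF this]
  obtain x where "(\<lambda>k. mixed_iter (\<lambda>x. ennreal \<bar>F k x\<bar>) ?L x) \<longlonglongrightarrow> 0" ..
  moreover have "mixed_iter (\<lambda>x. ennreal \<bar>F k x\<bar>) ?L x = mixed_norm r (F k)" for k
    unfolding mixed_norm_def by (rule mixed_iter_full) (simp add: image_image)
  ultimately show ?thesis by simp
qed

lemma mixed_norm_box_le:
  fixes F :: "real^('n::{finite,linorder}) \<Rightarrow> real"
  assumes "0 < h" "\<And>x. \<bar>F x\<bar> \<le> c" "\<And>x. x \<notin> cube a h \<Longrightarrow> F x = 0" "\<And>i. 0 < r $ i"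
  shows "mixed_norm r F \<le> ennreal (c * h powr (\<Sum>i\<in>UNIV. 1 / r $ i))"
proof -
  have c: "0 \<le> c" using assms(2)[of 0] by linarith
  show ?thesis
    unfolding mixed_norm_def sum_list_exps_coords[symmetric]
  proof (rule mixed_iter_box_le[where a = a])
    fix x i assume "x $ i \<notin> {a $ i..a $ i + h}"
    then have "x \<notin> cube a h" by (auto simp: mem_cube)
    then show "ennreal \<bar>F x\<bar> = 0" using assms(3) by simp
  qed (use assms c in \<open>auto simp: ennreal_leI comp_def\<close>)
qed

section \<open>Extremizers of the mixed-norm Hoelder inequality\<close>

lemma mixed_norm_mono:
  fixes f g :: "real^('n::{finite,linorder}) \<Rightarrow> real"
  assumes "\<And>i. 0 < r $ i" "\<And>x. \<bar>f x\<bar> \<le> \<bar>g x\<bar>"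
  shows "mixed_norm r f \<le> mixed_norm r g"
  unfolding mixed_norm_def using assms by (intro mixed_iter_mono) (auto simp: ennreal_leI)

text \<open>Covers two maps at once: setting one coordinate to 0, whose invariant functions do not
  depend on that coordinate, and rounding to a grid, whose invariant functions are constant on
  cells. A single invariance clause gives the extremizer both properties.\<close>

definition coordwise_projection :: "(real^'n \<Rightarrow> real^'n) \<Rightarrow> bool" where
  "coordwise_projection P \<longleftrightarrow> (\<exists>\<phi>. \<forall>x i. P x $ i = \<phi> i (x $ i) \<and> \<phi> i (\<phi> i (x $ i)) = \<phi> i (x $ i))"

lemma coordwise_projection_upd:
  assumes "coordwise_projection P"
  shows "P (coord_upd (P x) i t) = P (coord_upd x i t)"
  using assms unfolding coordwise_projection_def by (auto simp: vec_eq_iff)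

lemma coordwise_projection_coord_upd: "coordwise_projection (\<lambda>x. coord_upd x i 0)"
  unfolding coordwise_projection_def
  by (rule exI[of _ "\<lambda>j t. if j = i then 0 else t"]) auto

lemma sec_norm_projection:
  assumes "coordwise_projection P" "\<And>x. F (P x) = F x"
  shows "sec_norm i r F (P x) = sec_norm i r F x"
proof -
  have "F (coord_upd (P x) i t) = F (coord_upd x i t)" for t
    by (metis assms coordwise_projection_upd)
  then show ?thesis by (simp add: sec_norm_def)
qed

text \<open>With \<open>F\<^sub>k\<close> the norm of \<open>F\<close> in the first \<open>k\<close> coordinates, the extremizer is the product of
  the factors \<open>(F\<^sub>k\<^sub>-\<^sub>1 / F\<^sub>k) powr (r\<^sub>k - 1)\<close>; the convention \<open>x / 0 = 0\<close> makes it vanish where \<open>F\<close> does.\<close>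

lemma mixed_iter_extremizer:
  fixes F :: "real^'n \<Rightarrow> real"
  assumes "F \<in> borel_measurable borel" "0 < h" "\<And>x. 0 \<le> F x" "\<And>x. F x \<le> c"
    and "\<And>x i. i \<in> fst ` set L \<Longrightarrow> x $ i \<notin> {a $ i..a $ i + h} \<Longrightarrow> F x = 0"
    and "\<And>i r. (i, r) \<in> set L \<Longrightarrow> 1 < r" "distinct (map fst L)"
  shows "\<exists>H \<in> borel_measurable borel. (\<forall>x. 0 \<le> H x) \<and> (\<forall>x. F x = 0 \<longrightarrow> H x = 0) \<and>
    (\<forall>P. coordwise_projection P \<longrightarrow> (\<forall>x. F (P x) = F x) \<longrightarrow> (\<forall>x. H (P x) = H x)) \<and>
    (\<forall>x. mixed_iter (\<lambda>x. ennreal (H x)) (map (\<lambda>(i, r). (i, conj_exp r)) L) x \<le> 1) \<and>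
    (\<forall>x. mixed_iter (\<lambda>x. ennreal (F x * H x)) (map (\<lambda>(i, r). (i, 1)) L) x = mixed_iter (\<lambda>x. ennreal (F x)) L x)"
  using assms
proof (induction L arbitrary: F c)
  case Nil
  note [measurable] = Nil(1)
  \<comment> \<open>With no coordinates left the norm is the value itself: 1 has dual norm 1, and 0
    is taken where F vanishes so that the support is kept.\<close>
  show ?case
    by (rule bexI[of _ "\<lambda>x. if F x = 0 then 0 else 1"]) auto
next
  case (Cons b L)
  obtain i r where b: "b = (i, r)" by force
  have r: "1 < r" using Cons.prems(6)[of i r] b by simp
  have i: "i \<notin> fst ` set L" using Cons.prems(7) b by simp
  have c: "0 \<le> c" using Cons.prems(3,4) order_trans by blast
  have F_m [measurable]: "F \<in> borel_measurable borel" by fact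
  have F_nn: "0 \<le> F x" for x by fact
  define S where "S = sec_norm i r (\<lambda>x. ennreal (F x))"
  have S_m [measurable]: "S \<in> borel_measurable borel"
    unfolding S_def by measurable
  define F' where "F' x = enn2real (S x)" for x
  have F'_m: "F' \<in> borel_measurable borel" unfolding F'_def[abs_def] by measurable
  have S_le: "S x \<le> ennreal (c * h powr (1 / r))" for x
    unfolding S_def using r c b Cons.prems(2,4) Cons.prems(5)[of i]
    by (intro sec_norm_box_le[where a = "a $ i"]) (auto simp: ennreal_leI)
  have S_eq: "S x = ennreal (F' x)" for x
    unfolding F'_def using le_less_trans[OF S_le[of x] ennreal_less_top] by simp
  have F'_nn: "0 \<le> F' x" for x by (simp add: F'_def)
  have F'_le: "F' x \<le> c * h powr (1 / r)" for x
    using S_le[of x] S_eq[of x] c by (simp add: F'_nn)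
  have F'_proj: "F' (P x) = F' x" if "coordwise_projection P" "\<And>x. F (P x) = F x" for P x
    unfolding F'_def S_def using that by (subst sec_norm_projection) auto
  have "\<exists>H \<in> borel_measurable borel. (\<forall>x. 0 \<le> H x) \<and> (\<forall>x. F' x = 0 \<longrightarrow> H x = 0) \<and>
    (\<forall>P. coordwise_projection P \<longrightarrow> (\<forall>x. F' (P x) = F' x) \<longrightarrow> (\<forall>x. H (P x) = H x)) \<and>
    (\<forall>x. mixed_iter (\<lambda>x. ennreal (H x)) (map (\<lambda>(i, r). (i, conj_exp r)) L) x \<le> 1) \<and>
    (\<forall>x. mixed_iter (\<lambda>x. ennreal (F' x * H x)) (map (\<lambda>(i, r). (i, 1)) L) x = mixed_iter (\<lambda>x. ennreal (F' x)) L x)"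
  proof (rule Cons.IH[OF F'_m Cons.prems(2) F'_nn F'_le])
    fix x j assume j: "j \<in> fst ` set L" "x $ j \<notin> {a $ j..a $ j + h}"
    then have "j \<noteq> i" using i by auto
    then have "S x = 0"
      unfolding S_def
      by (intro sec_norm_zero_off[where j = j and A = "{a $ j..a $ j + h}"]) (use j Cons.prems(5)[of j] in auto)
    then show "F' x = 0" by (simp add: F'_def)
  next
    show "1 < r'" if "(i', r') \<in> set L" for i' r' using Cons.prems(6)[of i' r'] that by simp
  qed (use Cons.prems(7) in simp)
  then obtain H' where H'_m [measurable]: "H' \<in> borel_measurable borel" and H'_nn: "\<forall>x. 0 \<le> H' x"
    and "\<forall>x. F' x = 0 \<longrightarrow> H' x = 0"
    and H'_proj: "\<forall>P. coordwise_projection P \<longrightarrow> (\<forall>x. F' (P x) = F' x) \<longrightarrow> (\<forall>x. H' (P x) = H' x)"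
    and H'_1: "\<forall>x. mixed_iter (\<lambda>x. ennreal (H' x)) (map (\<lambda>(i, r). (i, conj_exp r)) L) x \<le> 1"
    and H'_2: "\<forall>x. mixed_iter (\<lambda>x. ennreal (F' x * H' x)) (map (\<lambda>(i, r). (i, 1)) L) x = mixed_iter (\<lambda>x. ennreal (F' x)) L x"
    by (elim bexE conjE)
  note H'_nn = H'_nn[rule_format] and H'_1 = H'_1[rule_format] and H'_2 = H'_2[rule_format]
  have H'_proj: "H' (P x) = H' x" if "coordwise_projection P" "\<And>x. F' (P x) = F' x" for P x
    using H'_proj that by blast
  have F'_upd: "F' (coord_upd x i t) = F' x" for x t
  proof -
    have "coord_upd (coord_upd x i t) i s = coord_upd x i s" for s by (simp add: vec_eq_iff)
    then show ?thesis by (simp add: F'_def S_def sec_norm_def)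
  qed
  \<comment> \<open>The induction hypothesis, used for the projection that sets coordinate i to 0,
    transfers the independence of coordinate i from \<open>F'\<close> to \<open>H'\<close>. So
    \<open>H'\<close> can be pulled out of integrals in direction i.\<close>
  have H'_upd: "H' (coord_upd x i t) = H' x" for x t
  proof -
    have "H' (coord_upd (coord_upd x i t) i 0) = H' (coord_upd x i t)" "H' (coord_upd x i 0) = H' x"
      by (intro H'_proj coordwise_projection_coord_upd F'_upd)+
    moreover have "coord_upd (coord_upd x i t) i 0 = coord_upd x i 0" by (simp add: vec_eq_iff)
    ultimately show ?thesis by simp
  qed
  define H where "H x = H' x * (F x / F' x) powr (r - 1)" for x
  note [measurable] = F'_m
  have H_m: "H \<in> borel_measurable borel" unfolding H_def[abs_def] by measurable
  have int: "(\<integral>\<^sup>+ t. ennreal (F (coord_upd x i t) powr r) \<partial>lborel) = ennreal (F' x powr r)" for x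
  proof -
    have "(\<integral>\<^sup>+ t. ennreal (F (coord_upd x i t) powr r) \<partial>lborel) = epow (S x) r"
      using r F_nn by (simp add: S_def sec_norm_def)
    also have "\<dots> = ennreal (F' x powr r)" by (simp add: S_eq F'_nn)
    finally show ?thesis .
  qed
  \<comment> \<open>On a line with \<open>F'\<close> positive the new factor has norm exactly 1 in
    the conjugate exponent s, because \<open>(r - 1) * s = r\<close>. Where \<open>F'\<close> is 0
    the factor is 0, whence only an inequality.\<close>
  have sec1: "sec_norm i (conj_exp r) (\<lambda>x. ennreal (H x)) x \<le> ennreal (H' x)" for x
  proof (cases "F' x = 0")
    case True
    then have "H (coord_upd x i t) = 0" for t by (simp add: H_def F'_upd)
    then show ?thesis by (simp add: sec_norm_def)
  next
    case False
    then have F'_pos: "0 < F' x" using F'_nn[of x] by simp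
    define s where "s = conj_exp r"
    have s: "1 < s" "(r - 1) * s = r" using conj_exp_props[OF r] by (simp_all add: s_def mult.commute)
    have "epow (ennreal (H (coord_upd x i t))) s = ennreal (H' x powr s / F' x powr r) * ennreal (F (coord_upd x i t) powr r)" for t
      using F'_pos F_nn H'_nn s
      by (simp add: H_def F'_upd H'_upd powr_mult powr_powr powr_divide flip: ennreal_mult)
    then have "(\<integral>\<^sup>+ t. epow (ennreal (H (coord_upd x i t))) s \<partial>lborel) = ennreal (H' x powr s / F' x powr r) * ennreal (F' x powr r)"
      by (simp add: nn_integral_cmult int)
    also have "\<dots> = ennreal (H' x powr s)"
      using F'_pos by (simp flip: ennreal_mult)
    finally show ?thesis
      using s H'_nn by (simp add: sec_norm_def powr_powr flip: s_def)
  qed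
  have sec2: "sec_norm i 1 (\<lambda>x. ennreal (F x * H x)) x = ennreal (F' x * H' x)" for x
  proof (cases "F' x = 0")
    case True
    then have "H (coord_upd x i t) = 0" for t by (simp add: H_def F'_upd)
    then show ?thesis using True by (simp add: sec_norm_def)
  next
    case False
    then have F'_pos: "0 < F' x" using F'_nn[of x] by simp
    have eq: "F y * F y powr (r - 1) = F y powr r" for y
      using F_nn[of y] r by (cases "F y = 0") (auto simp: powr_diff)
    have "ennreal (F (coord_upd x i t) * H (coord_upd x i t)) = ennreal (H' x / F' x powr (r - 1)) * ennreal (F (coord_upd x i t) powr r)" for t
    proof -
      have "F (coord_upd x i t) * H (coord_upd x i t) = H' x / F' x powr (r - 1) * (F (coord_upd x i t) * F (coord_upd x i t) powr (r - 1))"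
        using F'_pos F_nn by (simp add: H_def F'_upd H'_upd powr_divide)
      then show ?thesis using H'_nn by (simp add: eq flip: ennreal_mult)
    qed
    then have "(\<integral>\<^sup>+ t. ennreal (F (coord_upd x i t) * H (coord_upd x i t)) \<partial>lborel) = ennreal (H' x / F' x powr (r - 1)) * ennreal (F' x powr r)"
      by (simp add: nn_integral_cmult int)
    also have "\<dots> = ennreal (F' x * H' x)"
      using F'_pos H'_nn by (simp add: powr_diff flip: ennreal_mult)
    finally show ?thesis by (simp add: sec_norm_one)
  qed
  show ?case
  proof (intro bexI[OF _ H_m] conjI allI impI)
    show "0 \<le> H x" for x using H'_nn by (simp add: H_def)
    show "H x = 0" if "F x = 0" for x using that by (simp add: H_def)
    show "H (P x) = H x" if "coordwise_projection P" "\<forall>x. F (P x) = F x" for P x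
    proof -
      have *: "F' (P y) = F' y" for y using that by (intro F'_proj) auto
      have "H' (P x) = H' x" using that(1) * by (rule H'_proj)
      then show ?thesis using * that(2) by (simp add: H_def)
    qed
  next
    fix x
    have "mixed_iter (sec_norm i (conj_exp r) (\<lambda>x. ennreal (H x))) (map (\<lambda>(i, r). (i, conj_exp r)) L) x
       \<le> mixed_iter (\<lambda>x. ennreal (H' x)) (map (\<lambda>(i, r). (i, conj_exp r)) L) x"
    proof (rule mixed_iter_mono[OF _ sec1])
      fix j s assume "(j, s) \<in> set (map (\<lambda>(i, r). (i, conj_exp r)) L)"
      then obtain s' where "(j, s') \<in> set L" "s = conj_exp s'" by auto
      then show "0 < s" using Cons.prems(6)[of j s'] conj_exp_props(1)[of s'] by simp
    qed
    also have "\<dots> \<le> 1" by (rule H'_1)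
    finally show "mixed_iter (\<lambda>x. ennreal (H x)) (map (\<lambda>(i, r). (i, conj_exp r)) (b # L)) x \<le> 1"
      by (simp only: b list.map prod.case mixed_iter_Cons)
    have "mixed_iter (sec_norm i 1 (\<lambda>x. ennreal (F x * H x))) (map (\<lambda>(i, r). (i, 1)) L) x = mixed_iter (sec_norm i r (\<lambda>x. ennreal (F x))) L x"
      by (simp only: sec2[abs_def] H'_2 S_def[symmetric] S_eq[abs_def])
    then show "mixed_iter (\<lambda>x. ennreal (F x * H x)) (map (\<lambda>(i, r). (i, 1)) (b # L)) x = mixed_iter (\<lambda>x. ennreal (F x)) (b # L) x"
      by (simp only: b list.map prod.case mixed_iter_Cons)
  qed
qed

lemma mixed_norm_extremizer:
  fixes g :: "real^('n::{finite,linorder}) \<Rightarrow> real"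
  assumes g [measurable]: "g \<in> borel_measurable borel" and "0 < h" "\<And>x. \<bar>g x\<bar> \<le> c"
    and "\<And>x. x \<notin> cube a h \<Longrightarrow> g x = 0" and r: "\<And>i. 1 < r $ i"
  obtains H where "H \<in> borel_measurable borel" "\<And>x. g x = 0 \<Longrightarrow> H x = 0" "\<And>x. 0 \<le> g x * H x"
    "\<And>P x. coordwise_projection P \<Longrightarrow> (\<And>x. g (P x) = g x) \<Longrightarrow> H (P x) = H x"
    "mixed_norm (conj_vec r) H \<le> 1"
    "(\<integral>\<^sup>+ x. ennreal (g x * H x) \<partial>lborel) = mixed_norm r g"
proof -
  let ?L = "map (\<lambda>i. (i, r $ i)) coords"
  let ?F = "\<lambda>x. \<bar>g x\<bar>"
  have "\<exists>H \<in> borel_measurable borel. (\<forall>x. 0 \<le> H x) \<and> (\<forall>x. ?F x = 0 \<longrightarrow> H x = 0) \<and>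
    (\<forall>P. coordwise_projection P \<longrightarrow> (\<forall>x. ?F (P x) = ?F x) \<longrightarrow> (\<forall>x. H (P x) = H x)) \<and>
    (\<forall>x. mixed_iter (\<lambda>x. ennreal (H x)) (map (\<lambda>(i, r). (i, conj_exp r)) ?L) x \<le> 1) \<and>
    (\<forall>x. mixed_iter (\<lambda>x. ennreal (?F x * H x)) (map (\<lambda>(i, r). (i, 1)) ?L) x = mixed_iter (\<lambda>x. ennreal (?F x)) ?L x)"
  proof (rule mixed_iter_extremizer[where a = a and h = h and c = c])
    fix x i assume "x $ i \<notin> {a $ i..a $ i + h}"
    then have "x \<notin> cube a h" by (auto simp: mem_cube)
    then show "?F x = 0" using assms(4) by simp
  qed (use assms in \<open>auto simp: comp_def\<close>)
  then obtain H where H: "H \<in> borel_measurable borel" "\<And>x. 0 \<le> H x" "\<And>x. g x = 0 \<Longrightarrow> H x = 0"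
    "\<And>P x. coordwise_projection P \<Longrightarrow> (\<And>x. \<bar>g (P x)\<bar> = \<bar>g x\<bar>) \<Longrightarrow> H (P x) = H x"
    "\<And>x. mixed_iter (\<lambda>x. ennreal (H x)) (map (\<lambda>(i, r). (i, conj_exp r)) ?L) x \<le> 1"
    "\<And>x. mixed_iter (\<lambda>x. ennreal (\<bar>g x\<bar> * H x)) (map (\<lambda>(i, r). (i, 1)) ?L) x = mixed_iter (\<lambda>x. ennreal \<bar>g x\<bar>) ?L x"
    by auto
  note [measurable] = H(1)
  \<comment> \<open>The extremizer of \<open>\<bar>g x\<bar>\<close> receives the sign of g, which
    does not increase its absolute value.\<close>
  show thesis
  proof (rule that[of "\<lambda>x. sgn (g x) * H x"])
    have eq: "g x * (sgn (g x) * H x) = \<bar>g x\<bar> * H x" for x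
      by (simp add: sgn_if)
    show "0 \<le> g x * (sgn (g x) * H x)" for x unfolding eq using H(2) by simp
    show "sgn (g (P x)) * H (P x) = sgn (g x) * H x" if "coordwise_projection P" "\<And>x. g (P x) = g x" for P x
      using H(4)[of P x] that by simp
    have "mixed_norm (conj_vec r) (\<lambda>x. sgn (g x) * H x) \<le> mixed_norm (conj_vec r) H"
      using r conj_exp_props(1) by (intro mixed_norm_mono) (auto simp: conj_vec_def abs_mult sgn_if H(2) intro: less_trans[OF zero_less_one])
    also have "\<dots> \<le> 1"
      using H(5)[of 0] H(2) by (simp add: mixed_norm_def comp_def conj_vec_def)
    finally show "mixed_norm (conj_vec r) (\<lambda>x. sgn (g x) * H x) \<le> 1" .
    show "(\<integral>\<^sup>+ x. ennreal (g x * (sgn (g x) * H x)) \<partial>lborel) = mixed_norm r g"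
      unfolding eq using H(6)[of 0]
      by (subst nn_integral_lborel_vec[of _ coords 0]) (auto simp: mixed_norm_def comp_def)
  qed (use H(3) in auto)
qed

section \<open>Morrey norms and block decompositions\<close>

lemma measure_cube:
  "0 < h \<Longrightarrow> measure lebesgue (cube (a :: real^'n) h) = h ^ CARD('n)"
  by (simp add: cube_def content_cbox_if_cart interval_eq_empty_cart not_less del: sum_component)

lemma sum_Basis_nth [simp]: "(\<Sum>x\<in>(Basis :: (real^'n) set). x $ i) = 1"
  using One_nth[where 'n = 'n, of i] unfolding sum_component .

lemma cube_measurable [measurable]: "cube a h \<in> sets borel"
  by (simp add: cube_def)

lemma mixed_iter_cmult:
  assumes "F \<in> borel_measurable borel" "\<And>i r. (i, r) \<in> set L \<Longrightarrow> 0 < r"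
  shows "mixed_iter (\<lambda>x. c * F x) L x = c * mixed_iter F L x"
  using assms
proof (induction L arbitrary: F)
  case (Cons b L)
  obtain i r where b: "b = (i, r)" by force
  have r: "0 < r" using Cons.prems(2)[of i r] b by simp
  note [measurable] = Cons.prems(1)
  have "sec_norm i r (\<lambda>x. c * F x) = (\<lambda>x. c * sec_norm i r F x)"
    using r by (simp add: sec_norm_def epow_mult nn_integral_cmult fun_eq_iff)
  then show ?case
    unfolding b mixed_iter_Cons using Cons.prems(2)
    by (simp only:) (intro Cons.IH borel_measurable_sec_norm Cons.prems(1), auto)
qed auto

lemma mixed_norm_cmult:
  fixes f :: "real^('n::{finite,linorder}) \<Rightarrow> real"
  assumes f: "f \<in> borel_measurable lebesgue" and r: "\<And>i. 0 < r $ i"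
  shows "mixed_norm r (\<lambda>x. c * f x) = ennreal \<bar>c\<bar> * mixed_norm r f"
proof -
  obtain f' where f'[measurable]: "f' \<in> borel_measurable borel" and fe: "AE x in lebesgue. f x = f' x"
    using f by (rule lebesgue_borel_AE_eq)
  have "AE x in lebesgue. c * f x = c * f' x" using fe by eventually_elim simp
  then have "mixed_norm r (\<lambda>x. c * f x) = mixed_norm r (\<lambda>x. c * f' x)" by (rule mixed_norm_cong_AE)
  also have "\<dots> = ennreal \<bar>c\<bar> * mixed_norm r f'"
  proof -
    have "(\<lambda>x. ennreal \<bar>c * f' x\<bar>) = (\<lambda>x. ennreal \<bar>c\<bar> * ennreal \<bar>f' x\<bar>)"
      by (simp add: abs_mult ennreal_mult)
    then show ?thesis
      unfolding mixed_norm_def using r by (simp only:) (intro mixed_iter_cmult, auto)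
  qed
  finally show ?thesis using mixed_norm_cong_AE[OF fe] by simp
qed

locale morrey_block =
  fixes r0 :: real and r :: "real^('n::{finite,linorder})"
  assumes r0: "0 < r0" and r: "\<And>i. 1 < r $ i"
    and gap: "real CARD('n) / r0 < (\<Sum>i\<in>UNIV. 1 / r $ i)"
begin

text \<open>The exponent in terms of the side length: the weight of a cube of side h in the Morrey
  norm, and the size allowed to a block on it, are both \<open>h powr - \<theta>\<close>. The gap
  condition says that this decreases in h.\<close>

definition \<theta> :: real where "\<theta> = (\<Sum>i\<in>UNIV. 1 / r $ i) - real CARD('n) / r0"

lemma \<theta>_pos: "0 < \<theta>" using gap by (simp add: \<theta>_def)

lemma conj_vec_gt: "1 < conj_vec r $ i"
  using r conj_exp_props(1) by (simp add: conj_vec_def)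

lemma measure_cube_powr:
  assumes "0 < h"
  shows "measure lebesgue (cube (a :: (real, 'n) vec) h) powr morrey_exp r0 r = h powr - \<theta>"
proof -
  have "real CARD('n) * morrey_exp r0 r = - \<theta>"
    by (simp add: morrey_exp_def \<theta>_def right_diff_distrib)
  then show ?thesis
    unfolding measure_cube[OF assms] using assms by (simp add: powr_powr flip: powr_realpow)
qed

lemma morrey_norm_ge:
  fixes f :: "(real, 'n) vec \<Rightarrow> real"
  assumes "0 < h"
  shows "ennreal (h powr - \<theta>) * mixed_norm r (\<lambda>x. indicator (cube a h) x * f x) \<le> morrey_norm r0 r f"
proof -
  have "ennreal (h powr - \<theta>) * mixed_norm r (\<lambda>x. indicator (cube a h) x * f x)
     = (case (a, h) of (a, h) \<Rightarrow> ennreal (measure lebesgue (cube a h) powr morrey_exp r0 r) * mixed_norm r (\<lambda>x. indicator (cube a h) x * f x))"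
    by (simp only: prod.case measure_cube_powr[OF assms])
  also have "\<dots> \<le> morrey_norm r0 r f"
    unfolding morrey_norm_def by (rule SUP_upper) (use assms in auto)
  finally show ?thesis .
qed

lemma morrey_norm_le:
  fixes f :: "(real, 'n) vec \<Rightarrow> real"
  assumes "\<And>a h. 0 < h \<Longrightarrow> ennreal (h powr - \<theta>) * mixed_norm r (\<lambda>x. indicator (cube a h) x * f x) \<le> C"
  shows "morrey_norm r0 r f \<le> C"
  unfolding morrey_norm_def
proof (intro SUP_least, clarify)
  fix a :: "(real, 'n) vec" and h :: real assume "h > 0"
  from assms[OF this] show "ennreal (measure lebesgue (cube a h) powr morrey_exp r0 r) * mixed_norm r (\<lambda>x. indicator (cube a h) x * f x) \<le> C"
    by (simp only: measure_cube_powr[OF \<open>h > 0\<close>])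
qed

lemma is_block_iff:
  fixes B :: "(real, 'n) vec \<Rightarrow> real"
  shows "is_block r0 r B \<longleftrightarrow> B \<in> borel_measurable lebesgue \<and>
     (\<exists>a h. h > 0 \<and> (\<forall>x. x \<notin> cube a h \<longrightarrow> B x = 0) \<and> mixed_norm (conj_vec r) B \<le> ennreal (h powr - \<theta>))"
  unfolding is_block_def
proof (intro conj_cong iff_exI refl)
  fix a h
  show "{x. B x \<noteq> 0} \<subseteq> cube a h \<longleftrightarrow> (\<forall>x. x \<notin> cube a h \<longrightarrow> B x = 0)" by blast
  assume "h > 0"
  then show "mixed_norm (conj_vec r) B \<le> ennreal (measure lebesgue (cube a h) powr morrey_exp r0 r)
      \<longleftrightarrow> mixed_norm (conj_vec r) B \<le> ennreal (h powr - \<theta>)"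
    by (simp only: measure_cube_powr)
qed

lemma borel_indicator_lebesgue: "S \<in> sets borel \<Longrightarrow> (indicator S :: 'a::euclidean_space \<Rightarrow> real) \<in> borel_measurable lebesgue"
  by (intro borel_measurable_indicator) auto

text \<open>Hoelder on the cube that carries B; the normalization of the block is exactly the weight
  of that cube in the Morrey norm.\<close>

lemma block_pairing:
  fixes B f :: "(real, 'n) vec \<Rightarrow> real"
  assumes B: "is_block r0 r B" and f: "f \<in> borel_measurable lebesgue"
  shows "(\<integral>\<^sup>+ x. ennreal \<bar>B x * f x\<bar> \<partial>lebesgue) \<le> morrey_norm r0 r f"
proof -
  obtain a h where h: "h > 0" and z: "\<And>x. x \<notin> cube a h \<Longrightarrow> B x = 0"
    and n: "mixed_norm (conj_vec r) B \<le> ennreal (h powr - \<theta>)" and Bm: "B \<in> borel_measurable lebesgue"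
    using B by (auto simp: is_block_iff)
  have "(\<integral>\<^sup>+ x. ennreal \<bar>B x * f x\<bar> \<partial>lebesgue) = (\<integral>\<^sup>+ x. ennreal \<bar>(indicator (cube a h) x * f x) * B x\<bar> \<partial>lebesgue)"
    using z by (intro nn_integral_cong) (auto simp: indicator_def mult.commute)
  also have "\<dots> \<le> mixed_norm r (\<lambda>x. indicator (cube a h) x * f x) * mixed_norm (conj_vec r) B"
    using f Bm r by (intro Holder_mixed_norm borel_measurable_times borel_indicator_lebesgue) auto
  also have "\<dots> \<le> mixed_norm r (\<lambda>x. indicator (cube a h) x * f x) * ennreal (h powr - \<theta>)"
    by (intro mult_left_mono n) simp
  also have "\<dots> \<le> morrey_norm r0 r f"
    using morrey_norm_ge[OF h] by (simp add: mult.commute)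
  finally show ?thesis .
qed

text \<open>For a cube of side h at most k the bound is c times h to the power n / r0, increasing in
  h. For larger cubes the mixed norm is bounded by its value for side k while the weight
  \<open>h powr - \<theta>\<close> decreases. The worst case is side k.\<close>

lemma morrey_norm_bounded_le:
  fixes f :: "(real, 'n) vec \<Rightarrow> real"
  assumes k: "0 < k" and c: "\<And>x. \<bar>f x\<bar> \<le> c" and z: "\<And>x. x \<notin> cube a k \<Longrightarrow> f x = 0"
  shows "morrey_norm r0 r f \<le> ennreal (c * k powr (real CARD('n) / r0))"
proof (rule morrey_norm_le)
  fix a' :: "(real, 'n) vec" and h :: real assume h: "0 < h"
  let ?f = "\<lambda>x. indicator (cube a' h) x * f x"
  let ?s = "\<Sum>i\<in>UNIV. 1 / r $ i"
  have c0: "0 \<le> c" using c[of 0] by linarith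
  have r': "0 < r $ i" for i using r[of i] by simp
  have fc: "\<bar>?f x\<bar> \<le> c" for x using c[of x] c0 by (auto simp: indicator_def)
  have 1: "mixed_norm r ?f \<le> ennreal (c * h powr ?s)"
    by (rule mixed_norm_box_le[where a = a']) (use h fc r' in \<open>auto simp: indicator_def\<close>)
  have 2: "mixed_norm r ?f \<le> ennreal (c * k powr ?s)"
    by (rule mixed_norm_box_le[where a = a]) (use k fc r' z in \<open>auto simp: indicator_def\<close>)
  have s: "?s = real CARD('n) / r0 + \<theta>" by (simp add: \<theta>_def)
  show "ennreal (h powr - \<theta>) * mixed_norm r ?f \<le> ennreal (c * k powr (real CARD('n) / r0))"
  proof (cases "h \<le> k")
    case True
    have "ennreal (h powr - \<theta>) * mixed_norm r ?f \<le> ennreal (h powr - \<theta>) * ennreal (c * h powr ?s)"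
      by (intro mult_left_mono 1) simp
    also have "\<dots> = ennreal (c * h powr (real CARD('n) / r0))"
      using h c0 by (simp add: s powr_add powr_minus field_simps flip: ennreal_mult)
    also have "\<dots> \<le> ennreal (c * k powr (real CARD('n) / r0))"
      using True h c0 r0 by (intro ennreal_leI mult_left_mono powr_mono2) auto
    finally show ?thesis .
  next
    case False
    have "ennreal (h powr - \<theta>) * mixed_norm r ?f \<le> ennreal (k powr - \<theta>) * ennreal (c * k powr ?s)"
      using False k \<theta>_pos by (intro mult_mono 2 ennreal_leI powr_mono2') auto
    also have "\<dots> = ennreal (c * k powr (real CARD('n) / r0))"
      using k c0 by (simp add: s powr_add powr_minus field_simps flip: ennreal_mult)
    finally show ?thesis .
  qed
qed

text \<open>Pairing with the indicator of the cube. The bound is uniform over all blocks wherever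
  they live, which gives block series their local convergence in L^1.\<close>

lemma block_nn_integral_cube_le:
  fixes B :: "(real, 'n) vec \<Rightarrow> real"
  assumes B: "is_block r0 r B" and k: "0 < k"
  shows "(\<integral>\<^sup>+ x\<in>cube a k. ennreal \<bar>B x\<bar> \<partial>lebesgue) \<le> ennreal (k powr (real CARD('n) / r0))"
proof -
  have "(\<integral>\<^sup>+ x\<in>cube a k. ennreal \<bar>B x\<bar> \<partial>lebesgue) = (\<integral>\<^sup>+ x. ennreal \<bar>B x * indicator (cube a k) x\<bar> \<partial>lebesgue)"
    by (intro nn_integral_cong) (auto simp: indicator_def)
  also have "\<dots> \<le> morrey_norm r0 r (indicator (cube a k) :: (real, 'n) vec \<Rightarrow> real)"
    by (intro block_pairing B borel_indicator_lebesgue) simp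
  also have "\<dots> \<le> ennreal (1 * k powr (real CARD('n) / r0))"
    by (rule morrey_norm_bounded_le[where a = a]) (auto simp: k indicator_def)
  finally show ?thesis by simp
qed

section \<open>Calculus of block decompositions\<close>

lemma compact_subset_cube:
  assumes "compact (K :: ((real, 'n) vec) set)"
  obtains k where "0 < k" "K \<subseteq> cube (- (k *\<^sub>R One)) (2 * k)"
proof -
  from assms have "bounded K" by (rule compact_imp_bounded)
  then obtain k where k: "0 < k" "\<And>x. x \<in> K \<Longrightarrow> norm x \<le> k" by (auto simp: bounded_pos)
  have "K \<subseteq> cube (- (k *\<^sub>R One)) (2 * k)"
  proof
    fix x assume "x \<in> K"
    then have "\<bar>x $ i\<bar> \<le> k" for i using k(2) component_le_norm_cart[of x i] order_trans by blast
    then have "x $ i \<le> k" "- k \<le> x $ i" for i using abs_le_D1 abs_le_D2 by (force, smt (verit))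
    then show "x \<in> cube (- (k *\<^sub>R One)) (2 * k)" by (auto simp: mem_cube)
  qed
  with k(1) show thesis by (rule that)
qed

text \<open>Bounds the block norm by an actual decomposition instead of an infimum, and asks for
  convergence almost everywhere only. Convergence in L^1_loc follows, see
  \<open>decomposable_imp_block_norm\<close>.\<close>

definition decomposable :: "real \<Rightarrow> ((real, 'n) vec \<Rightarrow> real) \<Rightarrow> bool" where
  "decomposable c F \<longleftrightarrow> (\<exists>lam B. (\<forall>i. is_block r0 r (B i)) \<and> summable (\<lambda>i. \<bar>lam i\<bar>) \<and>
     (\<Sum>i. \<bar>lam i\<bar>) \<le> c \<and> (AE x in lebesgue. (\<lambda>i. lam i * B i x) sums F x))"

lemma decomposable_nonneg: "decomposable c F \<Longrightarrow> 0 \<le> c"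
  unfolding decomposable_def by (meson abs_ge_zero order_trans suminf_nonneg)

lemma decomposable_mono: "decomposable c F \<Longrightarrow> c \<le> d \<Longrightarrow> decomposable d F"
  unfolding decomposable_def by (meson order_trans)

lemma decomposable_cong_AE:
  assumes "decomposable c F" "AE x in lebesgue. F x = G x"
  shows "decomposable c G"
proof -
  obtain lam B where d: "\<And>i. is_block r0 r (B i)" "summable (\<lambda>i. \<bar>lam i\<bar>)"
    "(\<Sum>i. \<bar>lam i\<bar>) \<le> c" "AE x in lebesgue. (\<lambda>i. lam i * B i x) sums F x"
    using assms(1) unfolding decomposable_def by blast
  have "AE x in lebesgue. (\<lambda>i. lam i * B i x) sums G x"
    using d(4) assms(2) by eventually_elim simp
  with d show ?thesis unfolding decomposable_def by blast
qed

lemma block_measurable: "is_block r0 r B \<Longrightarrow> B \<in> borel_measurable lebesgue"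
  by (simp add: is_block_def)

lemma ennreal_abs_tail_le:
  assumes "u sums (s::real)"
  shows "ennreal \<bar>s - (\<Sum>i<N. u i)\<bar> \<le> (\<Sum>i. ennreal \<bar>u (i + N)\<bar>)"
proof (cases "(\<Sum>i. ennreal \<bar>u (i + N)\<bar>) = top")
  case False
  then have s: "summable (\<lambda>i. \<bar>u (i + N)\<bar>)" by (intro summable_suminf_not_top) auto
  have "s - (\<Sum>i<N. u i) = (\<Sum>i. u (i + N))"
    using sums_split_initial_segment[OF assms, of N] by (simp add: sums_iff)
  also have "\<bar>\<dots>\<bar> \<le> (\<Sum>i. \<bar>u (i + N)\<bar>)" by (rule summable_rabs[OF s])
  finally show ?thesis using s by (simp add: suminf_ennreal2 ennreal_leI)
qed simp

text \<open>On a compact set the remainder of the series is at most the tail sum of the coefficients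
  times the uniform local L^1 bound for blocks.\<close>

lemma decomposable_imp_block_norm:
  assumes "decomposable c F"
  shows "block_norm r0 r F \<le> ennreal c"
proof -
  obtain lam B where d: "\<And>i. is_block r0 r (B i)" "summable (\<lambda>i. \<bar>lam i\<bar>)"
    "(\<Sum>i. \<bar>lam i\<bar>) \<le> c" "AE x in lebesgue. (\<lambda>i. lam i * B i x) sums F x"
    using assms unfolding decomposable_def by blast
  have [measurable]: "B i \<in> borel_measurable lebesgue" for i
    using d(1) by (rule block_measurable)
  have "block_decomp r0 r F lam B"
    unfolding block_decomp_def
  proof (intro conjI allI impI)
    show "AE x in lebesgue. (\<lambda>N. \<Sum>i<N. lam i * B i x) \<longlonglongrightarrow> F x"
      using d(4) by (simp add: sums_def)
    fix K :: "((real, 'n) vec) set" assume "compact K"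
    then obtain k where k: "0 < k" and K: "K \<subseteq> cube (- (k *\<^sub>R One)) (2 * k)"
      by (rule compact_subset_cube)
    let ?Q = "cube (- (k *\<^sub>R One) :: (real, 'n) vec) (2 * k)"
    define M where "M = (2 * k) powr (real CARD('n) / r0)"
    have [measurable]: "?Q \<in> sets lebesgue" using cube_measurable by auto
    have bound: "(\<integral>\<^sup>+ x\<in>K. ennreal \<bar>F x - (\<Sum>i<N. lam i * B i x)\<bar> \<partial>lebesgue) \<le> ennreal ((\<Sum>i. \<bar>lam (i + N)\<bar>) * M)" for N
    proof -
      have "(\<integral>\<^sup>+ x\<in>K. ennreal \<bar>F x - (\<Sum>i<N. lam i * B i x)\<bar> \<partial>lebesgue)
         \<le> (\<integral>\<^sup>+ x. (\<Sum>i. ennreal \<bar>lam (i + N)\<bar> * (ennreal \<bar>B (i + N) x\<bar> * indicator ?Q x)) \<partial>lebesgue)"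
      proof (intro nn_integral_mono_AE, use d(4) in eventually_elim)
        case (elim x)
        show ?case
        proof (cases "x \<in> K")
          case True
          then have "x \<in> ?Q" using K by auto
          then show ?thesis
            using ennreal_abs_tail_le[OF elim, of N] True by (simp add: abs_mult ennreal_mult)
        qed simp
      qed
      also have "\<dots> = (\<Sum>i. ennreal \<bar>lam (i + N)\<bar> * (\<integral>\<^sup>+ x\<in>?Q. ennreal \<bar>B (i + N) x\<bar> \<partial>lebesgue))"
        by (subst nn_integral_suminf) (auto simp: nn_integral_cmult)
      also have "\<dots> \<le> (\<Sum>i. ennreal \<bar>lam (i + N)\<bar> * ennreal M)"
        unfolding M_def using k by (intro suminf_le mult_left_mono block_nn_integral_cube_le d(1)) auto
      also have "\<dots> = (\<Sum>i. ennreal (\<bar>lam (i + N)\<bar> * M))"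
        by (simp add: ennreal_mult M_def)
      also have "\<dots> = ennreal ((\<Sum>i. \<bar>lam (i + N)\<bar>) * M)"
      proof -
        have "summable (\<lambda>i. \<bar>lam (i + N)\<bar>)" using d(2) by (rule summable_ignore_initial_segment)
        then show ?thesis
          by (subst suminf_ennreal2) (auto simp: M_def suminf_mult2 intro!: summable_mult2)
      qed
      finally show ?thesis .
    qed
    have "(\<lambda>N. ennreal ((\<Sum>i. \<bar>lam (i + N)\<bar>) * M)) \<longlonglongrightarrow> ennreal (0 * M)"
      using d(2) by (intro tendsto_ennrealI tendsto_mult tendsto_const suminf_exist_split2) auto
    then show "(\<lambda>N. \<integral>\<^sup>+ x\<in>K. ennreal \<bar>F x - (\<Sum>i<N. lam i * B i x)\<bar> \<partial>lebesgue) \<longlonglongrightarrow> 0"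
      by (rule_tac tendsto_sandwich[of "\<lambda>_. 0"]) (use bound in auto)
  qed (use d in auto)
  then have "block_norm r0 r F \<le> ennreal (\<Sum>i. \<bar>lam i\<bar>)"
    unfolding block_norm_def by (intro INF_lower2[of "(lam, B)"]) auto
  also have "\<dots> \<le> ennreal c" using d(3) by (rule ennreal_leI)
  finally show ?thesis .
qed

lemma block_norm_less_imp_decomposable:
  assumes "block_norm r0 r F < ennreal c"
  shows "decomposable c F"
proof -
  obtain lam B where d: "block_decomp r0 r F lam B" "ennreal (\<Sum>i. \<bar>lam i\<bar>) < ennreal c"
    using assms unfolding block_norm_def by (auto simp: INF_less_iff)
  then show ?thesis
    unfolding decomposable_def block_decomp_def
    by (intro exI[of _ lam] exI[of _ B]) (auto simp: sums_def ennreal_less_iff suminf_nonneg)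
qed

text \<open>A weighted L^1 bound common to all blocks passes to every block series by monotone
  summation. It serves with a Morrey function as weight and later with the kernel integral
  \<open>S\<close>.\<close>

lemma decomposable_nn_integral_le:
  assumes "decomposable c F" and h [measurable]: "h \<in> borel_measurable lebesgue"
    and le: "\<And>B. is_block r0 r B \<Longrightarrow> (\<integral>\<^sup>+ x. ennreal \<bar>B x\<bar> * h x \<partial>lebesgue) \<le> C"
  shows "(\<integral>\<^sup>+ x. ennreal \<bar>F x\<bar> * h x \<partial>lebesgue) \<le> ennreal c * C"
proof -
  obtain lam B where d: "\<And>i. is_block r0 r (B i)" "summable (\<lambda>i. \<bar>lam i\<bar>)"
    "(\<Sum>i. \<bar>lam i\<bar>) \<le> c" "AE x in lebesgue. (\<lambda>i. lam i * B i x) sums F x"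
    using assms unfolding decomposable_def by blast
  have [measurable]: "B i \<in> borel_measurable lebesgue" for i
    using d(1) by (rule block_measurable)
  have "(\<integral>\<^sup>+ x. ennreal \<bar>F x\<bar> * h x \<partial>lebesgue) \<le> (\<integral>\<^sup>+ x. (\<Sum>i. ennreal \<bar>lam i\<bar> * (ennreal \<bar>B i x\<bar> * h x)) \<partial>lebesgue)"
  proof (intro nn_integral_mono_AE, use d(4) in eventually_elim)
    case (elim x)
    have "ennreal \<bar>F x\<bar> * h x \<le> (\<Sum>i. ennreal \<bar>lam i * B i x\<bar>) * h x"
      using ennreal_abs_tail_le[OF elim, of 0] by (intro mult_right_mono) auto
    then show ?case
      by (simp add: abs_mult ennreal_mult mult.assoc flip: ennreal_suminf_multc)
  qed
  also have "\<dots> = (\<Sum>i. ennreal \<bar>lam i\<bar> * (\<integral>\<^sup>+ x. ennreal \<bar>B i x\<bar> * h x \<partial>lebesgue))"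
    by (subst nn_integral_suminf) (auto simp: nn_integral_cmult)
  also have "\<dots> \<le> (\<Sum>i. ennreal \<bar>lam i\<bar> * C)"
    by (intro suminf_le mult_left_mono le d(1)) auto
  also have "\<dots> = ennreal (\<Sum>i. \<bar>lam i\<bar>) * C"
    using d(2) by (simp add: suminf_ennreal2 ennreal_suminf_multc)
  also have "\<dots> \<le> ennreal c * C"
    using d(3) by (intro mult_right_mono ennreal_leI) auto
  finally show ?thesis .
qed

lemma decomposable_pairing:
  assumes "decomposable c F" and f: "f \<in> borel_measurable lebesgue"
  shows "(\<integral>\<^sup>+ x. ennreal \<bar>F x * f x\<bar> \<partial>lebesgue) \<le> ennreal c * morrey_norm r0 r f"
proof -
  have eq: "ennreal \<bar>F x * f x\<bar> = ennreal \<bar>F x\<bar> * ennreal \<bar>f x\<bar>" for F x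
    by (simp add: abs_mult ennreal_mult)
  show ?thesis
    unfolding eq using f block_pairing[OF _ f] by (intro decomposable_nn_integral_le assms(1)) (auto simp: eq)
qed

lemma decomposable_nn_integral_cube_le:
  assumes "decomposable c F" "0 < k"
  shows "(\<integral>\<^sup>+ x\<in>cube a k. ennreal \<bar>F x\<bar> \<partial>lebesgue) \<le> ennreal (c * k powr (real CARD('n) / r0))"
proof -
  have "(\<integral>\<^sup>+ x\<in>cube a k. ennreal \<bar>F x\<bar> \<partial>lebesgue) = (\<integral>\<^sup>+ x. ennreal \<bar>F x * indicator (cube a k) x\<bar> \<partial>lebesgue)"
    by (intro nn_integral_cong) (auto simp: indicator_def)
  also have "\<dots> \<le> ennreal c * morrey_norm r0 r (indicator (cube a k) :: (real, 'n) vec \<Rightarrow> real)"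
    by (intro decomposable_pairing assms(1) borel_indicator_lebesgue) simp
  also have "\<dots> \<le> ennreal c * ennreal (1 * k powr (real CARD('n) / r0))"
    by (intro mult_left_mono morrey_norm_bounded_le[where a = a]) (auto simp: assms(2) indicator_def)
  finally show ?thesis using decomposable_nonneg[OF assms(1)] by (simp add: ennreal_mult)
qed

lemma decomposable_cmult:
  assumes "decomposable c F" "\<bar>t\<bar> * c \<le> d"
  shows "decomposable d (\<lambda>x. t * F x)"
proof -
  obtain lam B where d: "\<And>i. is_block r0 r (B i)" "summable (\<lambda>i. \<bar>lam i\<bar>)"
    "(\<Sum>i. \<bar>lam i\<bar>) \<le> c" "AE x in lebesgue. (\<lambda>i. lam i * B i x) sums F x"
    using assms(1) unfolding decomposable_def by blast
  have "AE x in lebesgue. (\<lambda>i. (t * lam i) * B i x) sums (t * F x)"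
    using d(4) by eventually_elim (simp add: mult.assoc sums_mult)
  moreover have "summable (\<lambda>i. \<bar>t * lam i\<bar>)" using d(2) by (simp add: abs_mult)
  moreover have "(\<Sum>i. \<bar>t * lam i\<bar>) = \<bar>t\<bar> * (\<Sum>i. \<bar>lam i\<bar>)"
    using d(2) by (simp add: abs_mult suminf_mult)
  moreover have "\<bar>t\<bar> * (\<Sum>i. \<bar>lam i\<bar>) \<le> d"
    using mult_left_mono[OF d(3), of "\<bar>t\<bar>"] assms(2) by simp
  ultimately show ?thesis
    unfolding decomposable_def using d(1) by (intro exI[of _ "\<lambda>i. t * lam i"] exI[of _ B]) auto
qed

lemma zero_block: "is_block r0 r (\<lambda>_. 0)"
proof -
  have "mixed_norm (conj_vec r) (\<lambda>_::(real, 'n) vec. 0) \<le> ennreal (0 * 1 powr (\<Sum>i\<in>UNIV. 1 / conj_vec r $ i))"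
    by (rule mixed_norm_box_le[where a = 0]) (use conj_vec_gt less_trans[OF zero_less_one] in auto)
  then show ?thesis
    unfolding is_block_iff by (auto intro!: exI[of _ 0] exI[of _ 1])
qed

lemma decomposable_zero: "decomposable 0 (\<lambda>_. 0)"
  unfolding decomposable_def using zero_block by (intro exI[of _ "\<lambda>_. 0"] exI[of _ "\<lambda>_ _. 0"]) auto

lemma decomposable_block: "is_block r0 r B \<Longrightarrow> decomposable 1 B"
  unfolding decomposable_def
  using sums_single[of 0 "\<lambda>_. 1::real"] sums_single[of 0 "\<lambda>_. B _"]
  by (intro exI[of _ "\<lambda>i. if i = 0 then 1 else 0"] exI[of _ "\<lambda>_. B"])
    (auto simp: if_distrib[of abs] if_distrib[of "\<lambda>c. c * _"] sums_iff cong: if_cong)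

text \<open>This makes approximation cheap: an error carried by a fixed cube with small mixed norm
  is a small multiple of one block.\<close>

lemma decomposable_single:
  assumes F: "F \<in> borel_measurable lebesgue" and h: "0 < h" and c: "0 < c"
    and z: "\<And>x. x \<notin> cube a h \<Longrightarrow> F x = 0"
    and n: "mixed_norm (conj_vec r) F \<le> ennreal (c * h powr - \<theta>)"
  shows "decomposable c F"
proof -
  have "is_block r0 r (\<lambda>x. (1 / c) * F x)"
    unfolding is_block_iff
  proof (intro conjI exI)
    have "mixed_norm (conj_vec r) (\<lambda>x. (1 / c) * F x) = ennreal (1 / c) * mixed_norm (conj_vec r) F"
      using c conj_vec_gt less_trans[OF zero_less_one] by (subst mixed_norm_cmult[OF F]) auto
    also have "\<dots> \<le> ennreal (1 / c) * ennreal (c * h powr - \<theta>)"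
      by (intro mult_left_mono n) simp
    also have "\<dots> = ennreal (h powr - \<theta>)"
      using c by (simp flip: ennreal_mult)
    finally show "mixed_norm (conj_vec r) (\<lambda>x. (1 / c) * F x) \<le> ennreal (h powr - \<theta>)" .
    show "(\<lambda>x. (1 / c) * F x) \<in> borel_measurable lebesgue" using F by measurable
  qed (use h z in auto)
  from decomposable_cmult[OF decomposable_block[OF this], of c c] show ?thesis using c by simp
qed

lemma AE_lebesgue_cubes:
  assumes "\<And>k::nat. AE x in lebesgue. x \<in> cube (- (real (Suc k) *\<^sub>R One)) (2 * real (Suc k)) \<longrightarrow> P x"
  shows "AE x in lebesgue. P (x :: (real, 'n) vec)"
proof -
  have "AE x in lebesgue. \<forall>k::nat. x \<in> cube (- (real (Suc k) *\<^sub>R One)) (2 * real (Suc k)) \<longrightarrow> P x"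
    by (rule AE_all_countable[THEN iffD2], rule allI, rule assms)
  then show ?thesis
  proof eventually_elim
    case (elim x)
    obtain k :: nat where k: "norm x \<le> real k" using real_arch_simple by blast
    have "x $ i \<in> {- real (Suc k)..- real (Suc k) + 2 * real (Suc k)}" for i
      using component_le_norm_cart[of x i] k by (auto simp: abs_le_iff)
    then have "x \<in> cube (- (real (Suc k) *\<^sub>R One)) (2 * real (Suc k))"
      by (simp add: mem_cube)
    then show ?case using elim by blast
  qed
qed

text \<open>On each cube the L^1 norms of the terms have a finite sum. Absolute convergence is what
  allows a double series of blocks to be rearranged.\<close>

lemma AE_block_abs_summable:
  fixes lam :: "nat \<Rightarrow> real"
  assumes B: "\<And>i. is_block r0 r (B i)" and s: "summable (\<lambda>i. \<bar>lam i\<bar>)"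
  shows "AE x in lebesgue. summable (\<lambda>i. \<bar>lam i * B i x\<bar>)"
proof (rule AE_lebesgue_cubes)
  have *: "AE x in lebesgue. x \<in> cube (- (K *\<^sub>R One)) (2 * K) \<longrightarrow> summable (\<lambda>i. \<bar>lam i * B i x\<bar>)"
    if "0 < K" for K :: real
  proof -
    let ?Q = "cube (- (K *\<^sub>R One) :: (real, 'n) vec) (2 * K)"
    define M where "M = (2 * K) powr (real CARD('n) / r0)"
    have [measurable]: "B i \<in> borel_measurable lebesgue" for i
      using B by (rule block_measurable)
    have [measurable]: "?Q \<in> sets lebesgue" using cube_measurable by auto
    have "(\<integral>\<^sup>+ x. (\<Sum>i. ennreal \<bar>lam i\<bar> * (ennreal \<bar>B i x\<bar> * indicator ?Q x)) \<partial>lebesgue)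
       = (\<Sum>i. ennreal \<bar>lam i\<bar> * (\<integral>\<^sup>+ x\<in>?Q. ennreal \<bar>B i x\<bar> \<partial>lebesgue))"
      by (subst nn_integral_suminf) (auto simp: nn_integral_cmult)
    also have "\<dots> \<le> (\<Sum>i. ennreal \<bar>lam i\<bar> * ennreal M)"
      unfolding M_def using that by (intro suminf_le mult_left_mono block_nn_integral_cube_le B) auto
    also have "\<dots> = ennreal (\<Sum>i. \<bar>lam i\<bar>) * ennreal M"
      using s by (simp add: suminf_ennreal2 ennreal_suminf_multc)
    also have "\<dots> < top" by (simp add: ennreal_mult_less_top)
    finally have "AE x in lebesgue. (\<Sum>i. ennreal \<bar>lam i\<bar> * (ennreal \<bar>B i x\<bar> * indicator ?Q x)) \<noteq> \<infinity>"
      by (intro nn_integral_PInf_AE) auto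
    then show ?thesis
    proof eventually_elim
      case (elim x)
      show ?case
      proof
        assume "x \<in> ?Q"
        with elim have "(\<Sum>i. ennreal \<bar>lam i * B i x\<bar>) \<noteq> top" by (simp add: abs_mult ennreal_mult)
        then show "summable (\<lambda>i. \<bar>lam i * B i x\<bar>)" by (intro summable_suminf_not_top) auto
      qed
    qed
  qed
  show "AE x in lebesgue. x \<in> cube (- (real (Suc k) *\<^sub>R One)) (2 * real (Suc k)) \<longrightarrow> summable (\<lambda>i. \<bar>lam i * B i x\<bar>)" for k
    by (rule *) simp
qed

text \<open>The double series is enumerated along \<open>prod_decode\<close>. Absolute convergence
  almost everywhere makes its sum independent of the enumeration, so summation row by row returns
  G.\<close>

lemma decomposable_countable_sum:
  fixes c :: "nat \<Rightarrow> real"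
  assumes F: "\<And>j. decomposable (c j) (F j)" and c: "summable c"
    and G: "AE x in lebesgue. (\<lambda>j. F j x) sums G x"
  shows "decomposable (\<Sum>j. c j) G"
proof -
  have c0: "0 \<le> c j" for j using F by (rule decomposable_nonneg)
  have "\<forall>j. \<exists>lam B. (\<forall>i. is_block r0 r (B i)) \<and> summable (\<lambda>i. \<bar>lam i\<bar>) \<and>
     (\<Sum>i. \<bar>lam i\<bar>) \<le> c j \<and> (AE x in lebesgue. (\<lambda>i. lam i * B i x) sums F j x)"
    using F unfolding decomposable_def by blast
  then obtain lam B where "\<forall>j. (\<forall>i. is_block r0 r (B j i)) \<and> summable (\<lambda>i. \<bar>lam j i\<bar>) \<and>
     (\<Sum>i. \<bar>lam j i\<bar>) \<le> c j \<and> (AE x in lebesgue. (\<lambda>i. lam j i * B j i x) sums F j x)"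
    unfolding choice_iff by (elim exE)
  then have d: "\<And>j i. is_block r0 r (B j i)" "\<And>j. summable (\<lambda>i. \<bar>lam j i\<bar>)"
    "\<And>j. (\<Sum>i. \<bar>lam j i\<bar>) \<le> c j" "\<And>j. AE x in lebesgue. (\<lambda>i. lam j i * B j i x) sums F j x"
    by simp_all
  define lam' where "lam' m = (case prod_decode m of (j, i) \<Rightarrow> lam j i)" for m
  define B' where "B' m = (case prod_decode m of (j, i) \<Rightarrow> B j i)" for m
  have "(\<Sum>m. ennreal \<bar>lam' m\<bar>) = (\<Sum>m. (\<lambda>(j, i). ennreal \<bar>lam j i\<bar>) (prod_decode m))"
    by (simp add: lam'_def case_prod_beta)
  also have "\<dots> = (\<Sum>j. \<Sum>i. ennreal \<bar>lam j i\<bar>)"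
    by (rule suminf_ennreal_2dimen) simp
  also have "\<dots> \<le> (\<Sum>j. ennreal (c j))"
    using d(2,3) by (intro suminf_le) (auto simp: suminf_ennreal2 ennreal_leI)
  also have "\<dots> = ennreal (\<Sum>j. c j)"
    using c c0 by (simp add: suminf_ennreal2)
  finally have le: "(\<Sum>m. ennreal \<bar>lam' m\<bar>) \<le> ennreal (\<Sum>j. c j)" .
  then have s: "summable (\<lambda>m. \<bar>lam' m\<bar>)"
    by (intro summable_suminf_not_top) (auto simp: top_unique)
  then have le': "(\<Sum>m. \<bar>lam' m\<bar>) \<le> (\<Sum>j. c j)"
    using le c c0 by (simp add: suminf_ennreal2 suminf_nonneg)
  have B': "is_block r0 r (B' m)" for m
    using d(1) by (simp add: B'_def case_prod_beta)
  have "AE x in lebesgue. \<forall>j. (\<lambda>i. lam j i * B j i x) sums F j x"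
    using d(4) by (simp add: AE_all_countable)
  then have "AE x in lebesgue. (\<lambda>m. lam' m * B' m x) sums G x"
    using G AE_block_abs_summable[of B' lam', OF B' s]
  proof eventually_elim
    case (elim x)
    define u where "u = (\<lambda>(j, i). lam j i * B j i x)"
    have u: "u (prod_decode m) = lam' m * B' m x" for m
      by (simp add: u_def lam'_def B'_def case_prod_beta)
    have "summable (\<lambda>m. norm (u (prod_decode m)))" using elim(3) by (simp add: u)
    then have "((\<lambda>m. u (prod_decode m)) has_sum (\<Sum>m. u (prod_decode m))) UNIV"
      by (rule norm_summable_imp_has_sum) (rule summable_sums, rule summable_norm_cancel, fact)
    then have hs: "(u has_sum (\<Sum>m. u (prod_decode m))) UNIV"
      using has_sum_reindex_bij_betw[OF bij_prod_decode] by blast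
    have "(u has_sum (\<Sum>m. u (prod_decode m))) (Sigma UNIV (\<lambda>_. UNIV))"
      using hs by simp
    moreover have "((\<lambda>i. u (j, i)) has_sum F j x) UNIV" for j
    proof -
      have "u summable_on (Sigma UNIV (\<lambda>_. UNIV))" using hs by (auto simp: summable_on_def)
      then have "(\<lambda>i. u (j, i)) summable_on UNIV"
        using summable_on_SigmaD1[of "\<lambda>j i. u (j, i)" UNIV "\<lambda>_. UNIV" j] by simp
      then obtain v where v: "((\<lambda>i. u (j, i)) has_sum v) UNIV" by (auto simp: summable_on_def)
      then have "(\<lambda>i. u (j, i)) sums v" by (rule has_sum_imp_sums)
      then have "v = F j x" using elim(1) sums_unique2 by (auto simp: u_def)
      with v show ?thesis by simp
    qed
    ultimately have "((\<lambda>j. F j x) has_sum (\<Sum>m. u (prod_decode m))) UNIV"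
      by (rule has_sum_SigmaD)
    then have "(\<lambda>j. F j x) sums (\<Sum>m. u (prod_decode m))" by (rule has_sum_imp_sums)
    then have "(\<Sum>m. u (prod_decode m)) = G x" using elim(2) sums_unique2 by blast
    moreover have "summable (\<lambda>m. u (prod_decode m))"
      using \<open>summable (\<lambda>m. norm (u (prod_decode m)))\<close> by (rule summable_norm_cancel)
    ultimately show ?case by (simp add: sums_iff u)
  qed
  then show ?thesis
    unfolding decomposable_def using B' s le' by blast
qed

lemma decomposable_add:
  assumes "decomposable c F" "decomposable d G"
  shows "decomposable (c + d) (\<lambda>x. F x + G x)"
proof -
  define H where "H j = (if j = 0 then F else if j = Suc 0 then G else (\<lambda>_. 0))" for j
  define e where "e j = (if j = 0 then c else if j = Suc 0 then d else 0)" for j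
  have e: "e sums (c + d)"
    using sums_finite[of "{0, Suc 0}" e] by (auto simp: e_def)
  have H: "(\<lambda>j. H j x) sums (F x + G x)" for x
    using sums_finite[of "{0, Suc 0}" "\<lambda>j. H j x"] by (auto simp: H_def)
  have "decomposable (\<Sum>j. e j) (\<lambda>x. F x + G x)"
  proof (rule decomposable_countable_sum[where F = H])
    show "decomposable (e j) (H j)" for j
      using assms decomposable_zero by (auto simp: H_def e_def)
    show "summable e" using e by (simp add: sums_iff)
    show "AE x in lebesgue. (\<lambda>j. H j x) sums (F x + G x)" using H by (rule AE_I2)
  qed
  then show ?thesis using e by (simp add: sums_iff)
qed

end

section \<open>The Koethe dual of the Morrey space\<close>

text \<open>The lower corner of the cell of side 1 / m that contains x. Being constant on cells
  means being invariant under this map, so no family of cells has to be carried along.\<close>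

definition grid_proj :: "nat \<Rightarrow> real^'n \<Rightarrow> real^'n" where
  "grid_proj m x = (\<chi> i. real_of_int \<lfloor>real m * x $ i\<rfloor> / real m)"

text \<open>Half-open with integer endpoints, so that it is a union of half-open cells of every
  grid. In particular \<open>hbox 0\<close> is empty.\<close>

definition hbox :: "nat \<Rightarrow> (real^'n) set" where
  "hbox k = {x. \<forall>i. - real k \<le> x $ i \<and> x $ i < real k}"

lemma grid_proj_nth [simp]: "grid_proj m x $ i = real_of_int \<lfloor>real m * x $ i\<rfloor> / real m"
  by (simp add: grid_proj_def)

lemma grid_coord_iff:
  fixes j :: int and t :: real
  assumes "0 < m"
  shows "real_of_int j / real m \<le> real_of_int \<lfloor>real m * t\<rfloor> / real m \<longleftrightarrow> real_of_int j / real m \<le> t"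
    and "real_of_int \<lfloor>real m * t\<rfloor> / real m < real_of_int j / real m \<longleftrightarrow> t < real_of_int j / real m"
  using assms by (auto simp: field_simps le_floor_iff floor_less_iff)

lemma coordwise_projection_grid_proj: "0 < m \<Longrightarrow> coordwise_projection (grid_proj m)"
  unfolding coordwise_projection_def
  by (rule exI[of _ "\<lambda>_ t. real_of_int \<lfloor>real m * t\<rfloor> / real m"]) auto

lemma hbox_grid_proj: "0 < m \<Longrightarrow> grid_proj m x \<in> hbox k \<longleftrightarrow> x \<in> hbox k"
proof -
  assume m: "0 < m"
  have "- real k \<le> grid_proj m x $ i \<longleftrightarrow> - real k \<le> x $ i" for i
    using grid_coord_iff(1)[OF m, of "- (int k * int m)" "x $ i"] m by simp
  moreover have "grid_proj m x $ i < real k \<longleftrightarrow> x $ i < real k" for i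
    using grid_coord_iff(2)[OF m, of "x $ i" "int k * int m"] m by simp
  ultimately show ?thesis by (simp add: hbox_def del: grid_proj_nth)
qed

lemma hbox_measurable [measurable]: "hbox k \<in> sets borel"
  unfolding hbox_def by measurable

lemma hbox_mono: "k \<le> l \<Longrightarrow> hbox k \<subseteq> hbox l"
proof
  fix x :: "real^'n" assume "k \<le> l" "x \<in> hbox k"
  then have "- real k \<le> x $ i" "x $ i < real k" "real k \<le> real l" for i by (auto simp: hbox_def)
  then have "- real l \<le> x $ i \<and> x $ i < real l" for i by (meson le_minus_iff less_le_trans minus_le_iff order_trans)
  then show "x \<in> hbox l" by (simp add: hbox_def)
qed

lemma hbox_subset_cube: "hbox k \<subseteq> cube (- (real k *\<^sub>R One)) (2 * real k)"
  by (auto simp: hbox_def mem_cube less_imp_le)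

lemma grid_proj_measurable [measurable]: "grid_proj m \<in> borel_measurable borel"
proof (subst borel_measurable_euclidean_space, safe)
  fix b :: "real^'n" assume "b \<in> Basis"
  then obtain i where "b = axis i 1" by (auto simp: Basis_vec_def)
  then show "(\<lambda>x. grid_proj m x \<bullet> b) \<in> borel_measurable borel"
    by (simp add: inner_axis)
qed

lemma grid_proj_tendsto: "(\<lambda>m. grid_proj (Suc m) x) \<longlonglongrightarrow> x"
proof (rule vec_tendstoI)
  fix i
  have "(\<lambda>m. inverse (real (Suc m))) \<longlonglongrightarrow> 0" by (rule LIMSEQ_inverse_real_of_nat)
  then have 1: "(\<lambda>m. x $ i - inverse (real (Suc m))) \<longlonglongrightarrow> x $ i - 0" by (intro tendsto_intros)
  show "(\<lambda>m. grid_proj (Suc m) x $ i) \<longlonglongrightarrow> x $ i"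
  proof (rule tendsto_sandwich[of "\<lambda>m. x $ i - inverse (real (Suc m))" _ _ "\<lambda>_. x $ i"])
    have "x $ i - inverse (real (Suc m)) \<le> grid_proj (Suc m) x $ i" for m
    proof -
      have "real (Suc m) * x $ i - 1 \<le> real_of_int \<lfloor>real (Suc m) * x $ i\<rfloor>" by linarith
      then have "(real (Suc m) * x $ i - 1) / real (Suc m) \<le> real_of_int \<lfloor>real (Suc m) * x $ i\<rfloor> / real (Suc m)"
        by (intro divide_right_mono) auto
      moreover have "(real (Suc m) * x $ i - 1) / real (Suc m) = x $ i - inverse (real (Suc m))"
        by (simp add: diff_divide_distrib inverse_eq_divide)
      ultimately show ?thesis by simp
    qed
    then show "\<forall>\<^sub>F m in sequentially. x $ i - inverse (real (Suc m)) \<le> grid_proj (Suc m) x $ i" by simp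
    have "grid_proj (Suc m) x $ i \<le> x $ i" for m
      using of_int_floor_le[of "real (Suc m) * x $ i"] by (simp add: divide_le_eq mult.commute)
    then show "\<forall>\<^sub>F m in sequentially. grid_proj (Suc m) x $ i \<le> x $ i" by simp
  qed (use 1 in auto)
qed

text \<open>The cell of x contains an open box of volume m^(-n) on which w has the value w x. Thus
  an L^1 bound controls grid functions pointwise.\<close>

lemma grid_cell_bound:
  fixes w :: "real^'n \<Rightarrow> real"
  assumes m: "0 < m" and w: "\<And>x. w (grid_proj m x) = w x"
  shows "ennreal (\<bar>w x\<bar> * (1 / real m) ^ CARD('n)) \<le> (\<integral>\<^sup>+ y. ennreal \<bar>w y\<bar> \<partial>lborel)"
proof -
  let ?u = "grid_proj m x + (1 / real m) *\<^sub>R One"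
  have eq: "w y = w x" if "y \<in> box (grid_proj m x) ?u" for y
  proof -
    have "real_of_int \<lfloor>real m * x $ i\<rfloor> / real m \<le> y $ i" "y $ i < real_of_int (\<lfloor>real m * x $ i\<rfloor> + 1) / real m" for i
      using that by (auto simp: mem_box_cart add_divide_distrib less_imp_le)
    then have "real_of_int \<lfloor>real m * x $ i\<rfloor> \<le> real m * y $ i" "real m * y $ i < real_of_int \<lfloor>real m * x $ i\<rfloor> + 1" for i
      using m by (simp_all add: field_simps)
    then have "\<lfloor>real m * y $ i\<rfloor> = \<lfloor>real m * x $ i\<rfloor>" for i by (simp add: floor_eq_iff)
    then have "grid_proj m y = grid_proj m x" by (simp add: vec_eq_iff)
    then show ?thesis using w by metis
  qed
  have "emeasure lborel (box (grid_proj m x) ?u) = ennreal (\<Prod>b\<in>Basis. (?u - grid_proj m x) \<bullet> b)"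
    using m by (intro emeasure_lborel_box) (auto simp: inner_add_left)
  also have "(\<Prod>b\<in>Basis. (?u - grid_proj m x) \<bullet> b) = (\<Prod>b\<in>(Basis :: (real^'n) set). 1 / real m)"
    by (intro prod.cong) auto
  also have "\<dots> = (1 / real m) ^ CARD('n)" by simp
  finally have "emeasure lborel (box (grid_proj m x) ?u) = ennreal ((1 / real m) ^ CARD('n))" .
  then have "ennreal (\<bar>w x\<bar> * (1 / real m) ^ CARD('n)) = (\<integral>\<^sup>+ y. ennreal \<bar>w x\<bar> * indicator (box (grid_proj m x) ?u) y \<partial>lborel)"
    by (simp add: nn_integral_cmult_indicator ennreal_mult)
  also have "\<dots> \<le> (\<integral>\<^sup>+ y. ennreal \<bar>w y\<bar> \<partial>lborel)"
    by (intro nn_integral_mono) (auto simp: indicator_def eq)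
  finally show ?thesis .
qed

lemma integrable_bounded_hbox:
  fixes w :: "real^'n \<Rightarrow> real"
  assumes [measurable]: "w \<in> borel_measurable borel" and "\<And>x. \<bar>w x\<bar> \<le> c" "\<And>x. x \<notin> hbox k \<Longrightarrow> w x = 0"
  shows "integrable lborel w"
proof (rule integrableI_bounded_set[where A = "hbox k" and B = c])
  have "emeasure lborel (hbox k :: (real^'n) set) \<le> emeasure lborel (cube (- (real k *\<^sub>R One)) (2 * real k) :: (real^'n) set)"
    by (intro emeasure_mono hbox_subset_cube) (simp add: cube_measurable)
  also have "\<dots> < \<infinity>" unfolding cube_def by (rule emeasure_lborel_cbox_finite)
  finally show "emeasure lborel (hbox k :: (real^'n) set) < \<infinity>" .
qed (use assms in auto)

section \<open>Dual bounds and order continuity\<close>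

context morrey_block
begin

lemma morrey_norm_cmult_le:
  assumes f: "f \<in> borel_measurable lebesgue"
  shows "morrey_norm r0 r (\<lambda>x. c * f x) \<le> ennreal \<bar>c\<bar> * morrey_norm r0 r f"
proof (rule morrey_norm_le)
  fix a :: "(real, 'n) vec" and h :: real assume h: "0 < h"
  have [measurable]: "f \<in> borel_measurable lebesgue" "cube a h \<in> sets lebesgue"
    using f cube_measurable by auto
  have "mixed_norm r (\<lambda>x. indicator (cube a h) x * (c * f x)) = mixed_norm r (\<lambda>x. c * (indicator (cube a h) x * f x))"
    by (simp add: mult.left_commute)
  also have "\<dots> = ennreal \<bar>c\<bar> * mixed_norm r (\<lambda>x. indicator (cube a h) x * f x)"
    using r less_trans[OF zero_less_one] by (intro mixed_norm_cmult) auto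
  finally have "ennreal (h powr - \<theta>) * mixed_norm r (\<lambda>x. indicator (cube a h) x * (c * f x))
     = ennreal \<bar>c\<bar> * (ennreal (h powr - \<theta>) * mixed_norm r (\<lambda>x. indicator (cube a h) x * f x))"
    by (simp add: mult.left_commute)
  also have "\<dots> \<le> ennreal \<bar>c\<bar> * morrey_norm r0 r f"
    by (intro mult_left_mono morrey_norm_ge h) simp
  finally show "ennreal (h powr - \<theta>) * mixed_norm r (\<lambda>x. indicator (cube a h) x * (c * f x)) \<le> ennreal \<bar>c\<bar> * morrey_norm r0 r f" .
qed

lemma morrey_norm_mono:
  assumes "\<And>x. \<bar>f x\<bar> \<le> \<bar>g x\<bar>"
  shows "morrey_norm r0 r f \<le> morrey_norm r0 r g"
proof (rule morrey_norm_le)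
  fix a :: "(real, 'n) vec" and h :: real assume h: "0 < h"
  have "ennreal (h powr - \<theta>) * mixed_norm r (\<lambda>x. indicator (cube a h) x * f x)
     \<le> ennreal (h powr - \<theta>) * mixed_norm r (\<lambda>x. indicator (cube a h) x * g x)"
    using r less_trans[OF zero_less_one] assms
    by (intro mult_left_mono mixed_norm_mono) (auto simp: abs_mult indicator_def)
  also have "\<dots> \<le> morrey_norm r0 r g" using h by (rule morrey_norm_ge)
  finally show "ennreal (h powr - \<theta>) * mixed_norm r (\<lambda>x. indicator (cube a h) x * f x) \<le> morrey_norm r0 r g" .
qed

definition test_fun :: "((real, 'n) vec \<Rightarrow> real) \<Rightarrow> bool" where
  "test_fun g \<longleftrightarrow> g \<in> borel_measurable borel \<and> (\<exists>c. \<forall>x. \<bar>g x\<bar> \<le> c) \<and> (\<exists>k::nat. \<forall>x. x \<notin> hbox k \<longrightarrow> g x = 0)"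

text \<open>The Koethe dual norm, tested on bounded functions of bounded support. The absolute value
  inside the integral costs nothing, as g can be multiplied by a sign, and it makes the pairing
  meaningful before anything is known to be integrable.\<close>

definition dual_bound :: "real \<Rightarrow> ((real, 'n) vec \<Rightarrow> real) \<Rightarrow> bool" where
  "dual_bound A F \<longleftrightarrow> F \<in> borel_measurable borel \<and>
     (\<forall>g. test_fun g \<longrightarrow> morrey_norm r0 r g \<le> 1 \<longrightarrow> (\<integral>\<^sup>+ x. ennreal \<bar>F x * g x\<bar> \<partial>lborel) \<le> ennreal A)"

lemma borel_imp_lebesgue: "f \<in> borel_measurable borel \<Longrightarrow> (f :: (real, 'n) vec \<Rightarrow> real) \<in> borel_measurable lebesgue"
  by (simp add: measurable_completion)

lemma test_fun_cmult: "test_fun g \<Longrightarrow> test_fun (\<lambda>x. c * g x)"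
proof -
  assume g: "test_fun g"
  then obtain d k where d: "\<And>x. \<bar>g x\<bar> \<le> d" and k: "\<And>x. x \<notin> hbox k \<Longrightarrow> g x = 0" and [measurable]: "g \<in> borel_measurable borel"
    by (auto simp: test_fun_def)
  have "\<bar>c * g x\<bar> \<le> \<bar>c\<bar> * d" for x using d[of x] by (simp add: abs_mult mult_left_mono)
  then show ?thesis using k by (auto simp: test_fun_def intro!: exI)
qed

lemma dual_bound_scaled:
  assumes F: "dual_bound A F" and g: "test_fun g" and M: "0 < M" "morrey_norm r0 r g \<le> ennreal M"
  shows "(\<integral>\<^sup>+ x. ennreal \<bar>F x * g x\<bar> \<partial>lborel) \<le> ennreal (A * M)"
proof -
  have [measurable]: "F \<in> borel_measurable borel" "g \<in> borel_measurable borel"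
    using F g by (auto simp: dual_bound_def test_fun_def)
  have "morrey_norm r0 r (\<lambda>x. (1 / M) * g x) \<le> ennreal \<bar>1 / M\<bar> * morrey_norm r0 r g"
    by (intro morrey_norm_cmult_le borel_imp_lebesgue) simp
  also have "\<dots> \<le> ennreal \<bar>1 / M\<bar> * ennreal M" by (intro mult_left_mono M) simp
  also have "\<dots> = 1" using M by (simp flip: ennreal_mult)
  finally have "(\<integral>\<^sup>+ x. ennreal \<bar>F x * ((1 / M) * g x)\<bar> \<partial>lborel) \<le> ennreal A"
    using F test_fun_cmult[OF g, of "1 / M"] unfolding dual_bound_def by blast
  then have "ennreal M * (\<integral>\<^sup>+ x. ennreal \<bar>F x * ((1 / M) * g x)\<bar> \<partial>lborel) \<le> ennreal M * ennreal A"
    by (rule mult_left_mono) simp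
  also have "ennreal M * (\<integral>\<^sup>+ x. ennreal \<bar>F x * ((1 / M) * g x)\<bar> \<partial>lborel) = (\<integral>\<^sup>+ x. ennreal M * ennreal \<bar>F x * ((1 / M) * g x)\<bar> \<partial>lborel)"
    by (rule nn_integral_cmult[symmetric]) measurable
  also have "\<dots> = (\<integral>\<^sup>+ x. ennreal \<bar>F x * g x\<bar> \<partial>lborel)"
    using M by (intro nn_integral_cong) (simp add: abs_mult flip: ennreal_mult)
  finally show ?thesis using M by (simp add: ennreal_mult'' mult.commute)
qed

lemma dual_bound_mono:
  assumes F: "dual_bound A F" and [measurable]: "F' \<in> borel_measurable borel" and le: "\<And>x. \<bar>F' x\<bar> \<le> \<bar>F x\<bar>" and A: "A \<le> A'"
  shows "dual_bound A' F'"
  unfolding dual_bound_def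
proof (intro conjI allI impI)
  fix g assume g: "test_fun g" "morrey_norm r0 r g \<le> 1"
  have "(\<integral>\<^sup>+ x. ennreal \<bar>F' x * g x\<bar> \<partial>lborel) \<le> (\<integral>\<^sup>+ x. ennreal \<bar>F x * g x\<bar> \<partial>lborel)"
    using le by (intro nn_integral_mono ennreal_leI) (simp add: abs_mult mult_right_mono)
  also have "\<dots> \<le> ennreal A" using F g by (simp add: dual_bound_def)
  also have "\<dots> \<le> ennreal A'" using A by (rule ennreal_leI)
  finally show "(\<integral>\<^sup>+ x. ennreal \<bar>F' x * g x\<bar> \<partial>lborel) \<le> ennreal A'" .
qed fact

definition min_exp :: real where "min_exp = Min (range (\<lambda>i. r $ i))"

lemma min_exp_gt: "1 < min_exp" and min_exp_le: "min_exp \<le> r $ i"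
  using r by (auto simp: min_exp_def)

text \<open>At each point at most one summand is nonzero, so the sum coincides with the l^s sum of
  the pieces for \<open>s = min_exp\<close>. By s-convexity its norm on a cube of side h comes from
  J terms, each at most \<open>h powr \<theta>\<close>.\<close>

lemma morrey_norm_disjoint_sum_le:
  fixes g :: "nat \<Rightarrow> (real, 'n) vec \<Rightarrow> real"
  assumes g: "\<And>j. g j \<in> borel_measurable borel" "\<And>j. morrey_norm r0 r (g j) \<le> 1"
    and dis: "\<And>i j x. i \<noteq> j \<Longrightarrow> g i x = 0 \<or> g j x = 0"
  shows "morrey_norm r0 r (\<lambda>x. \<Sum>j<J. \<bar>g j x\<bar>) \<le> ennreal (real J powr (1 / min_exp))"
proof (rule morrey_norm_le)
  fix a :: "(real, 'n) vec" and h :: real assume h: "0 < h"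
  let ?Q = "cube a h"
  let ?L = "map (\<lambda>i. (i, r $ i)) coords"
  note [measurable] = g(1)
  have s0: "0 < min_exp" using min_exp_gt by simp
  have one: "mixed_norm r (\<lambda>x. indicator ?Q x * g j x) \<le> ennreal (h powr \<theta>)" for j
  proof -
    have "ennreal (h powr - \<theta>) * mixed_norm r (\<lambda>x. indicator ?Q x * g j x) \<le> 1"
      using morrey_norm_ge[OF h, of a "g j"] g(2)[of j] by (rule order_trans)
    then have "ennreal (h powr \<theta>) * (ennreal (h powr - \<theta>) * mixed_norm r (\<lambda>x. indicator ?Q x * g j x)) \<le> ennreal (h powr \<theta>) * 1"
      by (rule mult_left_mono) simp
    moreover have "ennreal (h powr \<theta>) * ennreal (h powr - \<theta>) = 1"
      using h by (simp add: powr_minus flip: ennreal_mult)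
    ultimately show ?thesis by (simp flip: mult.assoc)
  qed
  have pt: "ennreal \<bar>indicator ?Q x * (\<Sum>j<J. \<bar>g j x\<bar>)\<bar> \<le>
     epow (\<Sum>j<J. epow (ennreal \<bar>indicator ?Q x * g j x\<bar>) min_exp) (1 / min_exp)" for x
  proof (cases "\<exists>j0<J. g j0 x \<noteq> 0")
    case True
    then obtain j0 where j0: "j0 < J" "g j0 x \<noteq> 0" by blast
    then have z: "g j x = 0" if "j \<noteq> j0" for j using dis that by blast
    have "(\<Sum>j<J. \<bar>g j x\<bar>) = (\<Sum>j\<in>{j0}. \<bar>g j x\<bar>)"
      using j0 z by (intro sum.mono_neutral_right) auto
    moreover have "(\<Sum>j<J. epow (ennreal \<bar>indicator ?Q x * g j x\<bar>) min_exp) = (\<Sum>j\<in>{j0}. epow (ennreal \<bar>indicator ?Q x * g j x\<bar>) min_exp)"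
      using j0 z by (intro sum.mono_neutral_right) auto
    ultimately show ?thesis using s0 by (simp add: abs_mult powr_powr)
  qed (auto intro!: sum.neutral)
  have "mixed_norm r (\<lambda>x. indicator ?Q x * (\<Sum>j<J. \<bar>g j x\<bar>))
     \<le> mixed_iter (\<lambda>x. epow (\<Sum>j<J. epow (ennreal \<bar>indicator ?Q x * g j x\<bar>) min_exp) (1 / min_exp)) ?L 0"
    unfolding mixed_norm_def using r less_trans[OF zero_less_one] by (intro mixed_iter_mono pt) auto
  also have "\<dots> \<le> epow (\<Sum>j<J. epow (mixed_iter (\<lambda>x. ennreal \<bar>indicator ?Q x * g j x\<bar>) ?L 0) min_exp) (1 / min_exp)"
    using s0 min_exp_le by (intro mixed_iter_convexity) auto
  also have "\<dots> \<le> epow (\<Sum>j<J. epow (ennreal (h powr \<theta>)) min_exp) (1 / min_exp)"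
    using s0 one by (intro epow_mono sum_mono) (auto simp: mixed_norm_def)
  also have "\<dots> = ennreal (real J powr (1 / min_exp) * h powr \<theta>)"
  proof -
    have "(\<Sum>j<J. epow (ennreal (h powr \<theta>)) min_exp) = ennreal (real J * h powr (\<theta> * min_exp))"
      by (simp add: powr_powr ennreal_mult ennreal_of_nat_eq_real_of_nat)
    then show ?thesis using s0 by (simp add: powr_powr powr_mult)
  qed
  finally have "ennreal (h powr - \<theta>) * mixed_norm r (\<lambda>x. indicator ?Q x * (\<Sum>j<J. \<bar>g j x\<bar>))
     \<le> ennreal (h powr - \<theta>) * ennreal (real J powr (1 / min_exp) * h powr \<theta>)"
    by (rule mult_left_mono) simp
  also have "\<dots> = ennreal (real J powr (1 / min_exp))"
    using h by (simp add: powr_minus field_simps flip: ennreal_mult)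
  finally show "ennreal (h powr - \<theta>) * mixed_norm r (\<lambda>x. indicator ?Q x * (\<Sum>j<J. \<bar>g j x\<bar>)) \<le> ennreal (real J powr (1 / min_exp))" .
qed

lemma test_fun_sum_abs:
  fixes g :: "nat \<Rightarrow> (real, 'n) vec \<Rightarrow> real"
  assumes "\<And>j. test_fun (g j)"
  shows "test_fun (\<lambda>x. \<Sum>j<J. \<bar>g j x\<bar>)"
proof -
  have [measurable]: "g j \<in> borel_measurable borel" for j using assms by (auto simp: test_fun_def)
  have "\<forall>j. \<exists>c. \<forall>x. \<bar>g j x\<bar> \<le> c" "\<forall>j. \<exists>k::nat. \<forall>x. x \<notin> hbox k \<longrightarrow> g j x = 0"
    using assms by (auto simp: test_fun_def)
  then obtain c k where c: "\<forall>j. \<forall>x. \<bar>g j x\<bar> \<le> c j" and k: "\<forall>j. \<forall>x. x \<notin> hbox (k j :: nat) \<longrightarrow> g j x = 0"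
    unfolding choice_iff by (elim exE)
  define K where "K = (\<Sum>j<J. k j)"
  have "hbox (k j) \<subseteq> (hbox K :: (real, 'n) vec set)" if "j < J" for j
  proof -
    have "k j \<le> K" unfolding K_def using that by (intro member_le_sum) auto
    then show ?thesis by (rule hbox_mono)
  qed
  then have "(\<Sum>j<J. \<bar>g j x\<bar>) = 0" if "x \<notin> hbox K" for x
    using that k by (intro sum.neutral) (auto dest: subsetD)
  moreover have "\<bar>\<Sum>j<J. \<bar>g j x\<bar>\<bar> \<le> (\<Sum>j<J. c j)" for x
    using c by (simp add: sum_nonneg sum_mono)
  ultimately show ?thesis
    unfolding test_fun_def by (intro conjI exI[of _ "\<Sum>j<J. c j"] exI[of _ K]) auto
qed

text \<open>A gliding hump: if the restrictions of \<open>F\<close> to \<open>D k\<close> did not become small, \<open>J\<close> disjoint normalized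
  pieces would pair with \<open>F\<close> to a multiple of \<open>J\<close>, while the Morrey norm of their sum is only \<open>J powr (1 / min_exp)\<close>.\<close>

lemma dual_bound_order_continuous:
  fixes D :: "nat \<Rightarrow> (real, 'n) vec set"
  assumes F: "dual_bound A F" and A: "0 < A" and D: "\<And>k. D k \<in> sets borel" "\<And>k l. k \<le> l \<Longrightarrow> D l \<subseteq> D k" "(\<Inter>k. D k) = {}"
    and \<eta>: "0 < \<eta>"
  shows "\<exists>k. dual_bound \<eta> (\<lambda>x. indicator (D k) x * F x)"
proof (rule ccontr)
  assume neg: "\<nexists>k. dual_bound \<eta> (\<lambda>x. indicator (D k) x * F x)"
  have Fm [measurable]: "F \<in> borel_measurable borel" using F by (simp add: dual_bound_def)
  note [measurable] = D(1)
  have "\<forall>k. \<exists>g. test_fun g \<and> morrey_norm r0 r g \<le> 1 \<and> ennreal \<eta> < (\<integral>\<^sup>+ x. ennreal \<bar>indicator (D k) x * F x * g x\<bar> \<partial>lborel)"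
    using neg by (auto simp: dual_bound_def not_le)
  then obtain g where "\<forall>k. test_fun (g k) \<and> morrey_norm r0 r (g k) \<le> 1 \<and> ennreal \<eta> < (\<integral>\<^sup>+ x. ennreal \<bar>indicator (D k) x * F x * g k x\<bar> \<partial>lborel)"
    unfolding choice_iff by (elim exE)
  then have g: "test_fun (g k)" "morrey_norm r0 r (g k) \<le> 1" "ennreal \<eta> < (\<integral>\<^sup>+ x. ennreal \<bar>indicator (D k) x * F x * g k x\<bar> \<partial>lborel)" for k
    by simp_all
  have gm [measurable]: "g k \<in> borel_measurable borel" for k using g(1) by (simp add: test_fun_def)
  \<comment> \<open>The product of F and \<open>g k\<close> is integrable by the dual bound, and the
    sets D m decrease to the empty set, so the part of this pairing over D m becomes smaller than
    \<eta> / 2.\<close>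
  have "\<exists>m>k. (\<integral>\<^sup>+ x. ennreal \<bar>indicator (D m) x * F x * g k x\<bar> \<partial>lborel) < ennreal (\<eta> / 2)" for k
  proof -
    have "(\<lambda>m. \<integral>\<^sup>+ x. ennreal \<bar>indicator (D m) x * F x * g k x\<bar> \<partial>lborel) \<longlonglongrightarrow> (\<integral>\<^sup>+ (x :: (real, 'n) vec). 0 \<partial>lborel)"
    proof (rule nn_integral_dominated_convergence[where w = "\<lambda>x. ennreal \<bar>F x * g k x\<bar>"])
      show "(\<integral>\<^sup>+ x. ennreal \<bar>F x * g k x\<bar> \<partial>lborel) < \<infinity>"
        using F g(1,2)[of k] by (auto simp: dual_bound_def intro: le_less_trans)
      show "AE x in lborel. (\<lambda>m. ennreal \<bar>indicator (D m) x * F x * g k x\<bar>) \<longlonglongrightarrow> 0"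
      proof (rule AE_I2)
        fix x
        obtain m0 where "x \<notin> D m0" using D(3) by blast
        then have "x \<notin> D m" if "m0 \<le> m" for m using D(2)[OF that] by blast
        then have "\<forall>\<^sub>F m in sequentially. ennreal \<bar>indicator (D m) x * F x * g k x\<bar> = 0"
          by (auto simp: eventually_sequentially intro!: exI[of _ m0])
        then show "(\<lambda>m. ennreal \<bar>indicator (D m) x * F x * g k x\<bar>) \<longlonglongrightarrow> 0"
          by (rule tendsto_eventually)
      qed
    qed (auto simp: abs_mult indicator_def)
    then have "(\<lambda>m. \<integral>\<^sup>+ x. ennreal \<bar>indicator (D m) x * F x * g k x\<bar> \<partial>lborel) \<longlonglongrightarrow> 0" by simp
    then have "\<forall>\<^sub>F m in sequentially. (\<integral>\<^sup>+ x. ennreal \<bar>indicator (D m) x * F x * g k x\<bar> \<partial>lborel) < ennreal (\<eta> / 2)"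
      by (rule order_tendstoD) (use \<eta> in simp)
    then have "\<forall>\<^sub>F m in sequentially. (\<integral>\<^sup>+ x. ennreal \<bar>indicator (D m) x * F x * g k x\<bar> \<partial>lborel) < ennreal (\<eta> / 2) \<and> m > k"
      using eventually_gt_at_top[of k] by eventually_elim simp
    then show ?thesis using eventually_happens[of _ sequentially] by (auto simp: conj_commute)
  qed
  then have "\<forall>k. \<exists>m. m > k \<and> (\<integral>\<^sup>+ x. ennreal \<bar>indicator (D m) x * F x * g k x\<bar> \<partial>lborel) < ennreal (\<eta> / 2)" by blast
  then obtain \<phi> where "\<forall>k. \<phi> k > k \<and> (\<integral>\<^sup>+ x. ennreal \<bar>indicator (D (\<phi> k)) x * F x * g k x\<bar> \<partial>lborel) < ennreal (\<eta> / 2)"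
    unfolding choice_iff by (elim exE)
  then have \<phi>: "\<phi> k > k" "(\<integral>\<^sup>+ x. ennreal \<bar>indicator (D (\<phi> k)) x * F x * g k x\<bar> \<partial>lborel) < ennreal (\<eta> / 2)" for k
    by simp_all
  define n where "n j = (\<phi> ^^ j) 0" for j
  have n_Suc: "n (Suc j) = \<phi> (n j)" for j by (simp add: n_def)
  have n_mono: "i \<le> j \<Longrightarrow> n i \<le> n j" for i j
    by (rule lift_Suc_mono_le[of n]) (use \<phi>(1) n_Suc less_imp_le in auto)
  \<comment> \<open>The layers between successive chosen sets are disjoint, and each keeps at least
    \<eta> / 2 of the pairing of F with its own function g.\<close>
  define E where "E j = D (n j) - D (n (Suc j))" for j
  have E_m [measurable]: "E j \<in> sets borel" for j unfolding E_def by measurable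
  define g' where "g' j x = indicator (E j) x * g (n j) x" for j x
  have g'm [measurable]: "g' j \<in> borel_measurable borel" for j unfolding g'_def[abs_def] by measurable
  have E_dis: "x \<notin> E j" if "i < j" "x \<in> E i" for i j x
    using that D(2)[OF n_mono[of "Suc i" j]] by (auto simp: E_def)
  have dis: "g' i x = 0 \<or> g' j x = 0" if "i \<noteq> j" for i j x
  proof -
    have "x \<notin> E i \<or> x \<notin> E j" using that E_dis[of i j x] E_dis[of j i x] by (cases "i < j") auto
    then show ?thesis by (auto simp: g'_def)
  qed
  have g'_le: "\<bar>g' j x\<bar> \<le> \<bar>g (n j) x\<bar>" for j x by (simp add: g'_def indicator_def)
  have g'_test: "test_fun (g' j)" for j
  proof -
    obtain d k where "\<And>x. \<bar>g (n j) x\<bar> \<le> d" "\<And>x. x \<notin> hbox k \<Longrightarrow> g (n j) x = 0"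
      using g(1)[of "n j"] by (auto simp: test_fun_def)
    then show ?thesis
      unfolding test_fun_def using g'_le order_trans[OF g'_le]
      by (intro conjI exI[of _ d] exI[of _ k]) (auto simp: g'_def)
  qed
  have g'_norm: "morrey_norm r0 r (g' j) \<le> 1" for j
    using morrey_norm_mono[of "g' j" "g (n j)"] g'_le g(2)[of "n j"] order_trans by blast
  have big: "ennreal (\<eta> / 2) \<le> (\<integral>\<^sup>+ x. ennreal \<bar>F x * g' j x\<bar> \<partial>lborel)" for j
  proof -
    have "ennreal (\<eta> / 2) + ennreal (\<eta> / 2) = ennreal \<eta>"
      using \<eta> by (simp flip: ennreal_plus)
    also have "\<dots> \<le> (\<integral>\<^sup>+ x. ennreal \<bar>indicator (D (n j)) x * F x * g (n j) x\<bar> \<partial>lborel)"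
      using g(3) by (rule less_imp_le)
    also have "\<dots> = (\<integral>\<^sup>+ x. ennreal \<bar>F x * g' j x\<bar> + ennreal \<bar>indicator (D (\<phi> (n j))) x * F x * g (n j) x\<bar> \<partial>lborel)"
      using D(2)[OF less_imp_le[OF \<phi>(1)[of "n j"]]]
      by (intro nn_integral_cong) (auto simp: g'_def E_def n_Suc indicator_def)
    also have "\<dots> = (\<integral>\<^sup>+ x. ennreal \<bar>F x * g' j x\<bar> \<partial>lborel) + (\<integral>\<^sup>+ x. ennreal \<bar>indicator (D (\<phi> (n j))) x * F x * g (n j) x\<bar> \<partial>lborel)"
      by (rule nn_integral_add) measurable
    also have "\<dots> \<le> (\<integral>\<^sup>+ x. ennreal \<bar>F x * g' j x\<bar> \<partial>lborel) + ennreal (\<eta> / 2)"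
      using \<phi>(2)[of "n j"] by (intro add_left_mono) (rule less_imp_le)
    also have "\<dots> = ennreal (\<eta> / 2) + (\<integral>\<^sup>+ x. ennreal \<bar>F x * g' j x\<bar> \<partial>lborel)" by (rule add.commute)
    finally show ?thesis unfolding ennreal_add_left_cancel_le by simp
  qed
  have main: "real J * (\<eta> / 2) \<le> A * real J powr (1 / min_exp)" if J: "0 < J" for J
  proof -
    have "ennreal (real J * (\<eta> / 2)) = (\<Sum>j<J. ennreal (\<eta> / 2))"
    proof -
      have "ennreal (real J * (\<eta> / 2)) = ennreal (real J) * ennreal (\<eta> / 2)"
        using \<eta> by (intro ennreal_mult) auto
      then show ?thesis by (simp add: ennreal_of_nat_eq_real_of_nat)
    qed
    also have "\<dots> \<le> (\<Sum>j<J. \<integral>\<^sup>+ x. ennreal \<bar>F x * g' j x\<bar> \<partial>lborel)" by (intro sum_mono big)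
    also have "\<dots> = (\<integral>\<^sup>+ x. (\<Sum>j<J. ennreal \<bar>F x * g' j x\<bar>) \<partial>lborel)"
      by (rule nn_integral_sum[symmetric]) measurable
    also have "\<dots> = (\<integral>\<^sup>+ x. ennreal \<bar>F x * (\<Sum>j<J. \<bar>g' j x\<bar>)\<bar> \<partial>lborel)"
    proof (intro nn_integral_cong)
      fix x
      have "\<bar>F x * (\<Sum>j<J. \<bar>g' j x\<bar>)\<bar> = (\<Sum>j<J. \<bar>F x * g' j x\<bar>)"
        unfolding abs_mult sum_distrib_left[symmetric] by (simp add: sum_nonneg)
      then show "(\<Sum>j<J. ennreal \<bar>F x * g' j x\<bar>) = ennreal \<bar>F x * (\<Sum>j<J. \<bar>g' j x\<bar>)\<bar>"
        by (simp add: sum_ennreal)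
    qed
    also have "\<dots> \<le> ennreal (A * real J powr (1 / min_exp))"
      using J by (intro dual_bound_scaled[OF F] test_fun_sum_abs g'_test morrey_norm_disjoint_sum_le g'_norm dis g'm) auto
    finally show ?thesis using A by (simp add: ennreal_le_iff)
  qed
  \<comment> \<open>Since e is positive, a lower bound linear in J is incompatible with an upper
    bound of order J to the power 1 - e.\<close>
  define e where "e = 1 - 1 / min_exp"
  have e: "0 < e" using min_exp_gt by (simp add: e_def)
  have le: "real J powr e \<le> 2 * A / \<eta>" if "0 < J" for J
  proof -
    have "real J powr e * real J powr (1 / min_exp) = real J" using that by (simp add: e_def flip: powr_add)
    then have "real J powr (1 / min_exp) * (real J powr e * (\<eta> / 2)) \<le> real J powr (1 / min_exp) * A"
      using main[OF that] by (simp add: mult_ac)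
    then have "real J powr e * (\<eta> / 2) \<le> A" using that by simp
    then show ?thesis using \<eta> by (simp add: field_simps)
  qed
  obtain J :: nat where J: "(2 * A / \<eta>) powr (1 / e) < real J" using reals_Archimedean2 by blast
  then have "((2 * A / \<eta>) powr (1 / e)) powr e < real J powr e"
    using e by (intro powr_less_mono2) auto
  then have "2 * A / \<eta> < real J powr e" using e A \<eta> by (simp add: powr_powr)
  moreover have "0 < J" using le_less_trans[OF powr_ge_zero J] by simp
  ultimately show False using le[of J] by simp
qed


section \<open>Grid functions in the polar of the block ball\<close>

lemma sum_conj_vec: "(\<Sum>i\<in>UNIV. 1 / conj_vec r $ i) = real CARD('n) - (\<Sum>i\<in>UNIV. 1 / r $ i)"
proof -
  have "1 / conj_vec r $ i = 1 - 1 / r $ i" for i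
    using conj_exp_props(2)[OF r[of i]] by (simp add: conj_vec_def)
  then show ?thesis by (simp add: sum_subtractf)
qed

definition grid_fun :: "nat \<Rightarrow> nat \<Rightarrow> ((real, 'n) vec \<Rightarrow> real) \<Rightarrow> bool" where
  "grid_fun m k g \<longleftrightarrow> g \<in> borel_measurable borel \<and> (\<forall>x. g (grid_proj m x) = g x) \<and> (\<forall>x. x \<notin> hbox k \<longrightarrow> g x = 0)"

text \<open>Only the sum has to be a grid function; the blocks of its decomposition are
  arbitrary.\<close>

definition grid_ball :: "nat \<Rightarrow> nat \<Rightarrow> ((real, 'n) vec \<Rightarrow> real) set" where
  "grid_ball m k = {u. grid_fun m k u \<and> decomposable 1 u}"

lemma nn_integral_hbox_le:
  assumes "u \<in> borel_measurable borel" "decomposable 1 u" "\<And>x. x \<notin> hbox k \<Longrightarrow> u x = 0" "0 < k"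
  shows "(\<integral>\<^sup>+ x. ennreal \<bar>u x\<bar> \<partial>lborel) \<le> ennreal ((2 * real k) powr (real CARD('n) / r0))"
proof -
  note [measurable] = assms(1)
  have "(\<integral>\<^sup>+ x. ennreal \<bar>u x\<bar> \<partial>lborel) = (\<integral>\<^sup>+ x. ennreal \<bar>u x\<bar> \<partial>lebesgue)"
    by (rule nn_integral_completion[symmetric])
  also have "\<dots> = (\<integral>\<^sup>+ x\<in>cube (- (real k *\<^sub>R One)) (2 * real k). ennreal \<bar>u x\<bar> \<partial>lebesgue)"
    using hbox_subset_cube[of k] assms(3) by (intro nn_integral_cong) (auto simp: indicator_def)
  also have "\<dots> \<le> ennreal (1 * (2 * real k) powr (real CARD('n) / r0))"
    using assms(4) by (intro decomposable_nn_integral_cube_le assms(2)) auto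
  finally show ?thesis by simp
qed

text \<open>The local L^1 bound divided by the volume of a cell. Together with the common support
  this keeps the L^2 quantities of the separation argument under uniform control.\<close>

lemma grid_ball_bounded:
  assumes "u \<in> grid_ball m k" "0 < m" "0 < k"
  shows "\<bar>u x\<bar> \<le> (2 * real k) powr (real CARD('n) / r0) * real m ^ CARD('n)"
proof -
  have u: "u \<in> borel_measurable borel" "\<And>x. u (grid_proj m x) = u x" "\<And>x. x \<notin> hbox k \<Longrightarrow> u x = 0" "decomposable 1 u"
    using assms(1) by (auto simp: grid_ball_def grid_fun_def)
  have "ennreal (\<bar>u x\<bar> * (1 / real m) ^ CARD('n)) \<le> ennreal ((2 * real k) powr (real CARD('n) / r0))"
    using grid_cell_bound[of m u x, OF assms(2) u(2)] nn_integral_hbox_le[OF u(1,4,3) assms(3)] by (rule order_trans)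
  then show ?thesis using assms(2) by (simp add: field_simps)
qed

lemma test_fun_grid:
  assumes "grid_fun m k g" "\<And>x. \<bar>g x\<bar> \<le> c"
  shows "test_fun g"
  using assms by (auto simp: test_fun_def grid_fun_def)

lemma grid_ball_blockI:
  assumes "grid_fun m k h" "0 < l" "\<And>x. x \<notin> cube a l \<Longrightarrow> h x = 0" "mixed_norm (conj_vec r) h \<le> ennreal (l powr - \<theta>)"
  shows "h \<in> grid_ball m k"
proof -
  have "is_block r0 r h"
    unfolding is_block_iff using assms by (auto simp: grid_fun_def measurable_completion)
  then show ?thesis using assms(1) decomposable_block by (simp add: grid_ball_def)
qed

lemma grid_ball_convex:
  assumes "u \<in> grid_ball m k" "v \<in> grid_ball m k" "0 \<le> t" "t \<le> 1"
  shows "(\<lambda>x. u x + t * (v x - u x)) \<in> grid_ball m k"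
proof -
  have [measurable]: "u \<in> borel_measurable borel" "v \<in> borel_measurable borel"
    using assms by (auto simp: grid_ball_def grid_fun_def)
  have "decomposable ((1 - t) + t) (\<lambda>x. (1 - t) * u x + t * v x)"
    using assms by (intro decomposable_add decomposable_cmult[of 1]) (auto simp: grid_ball_def)
  moreover have "(\<lambda>x. (1 - t) * u x + t * v x) = (\<lambda>x. u x + t * (v x - u x))"
    by (auto simp: algebra_simps)
  ultimately have "decomposable 1 (\<lambda>x. u x + t * (v x - u x))" by simp
  then show ?thesis using assms by (auto simp: grid_ball_def grid_fun_def)
qed

lemma zero_grid_ball: "(\<lambda>_. 0) \<in> grid_ball m k"
  using decomposable_mono[OF decomposable_zero, of 1] by (auto simp: grid_ball_def grid_fun_def)

text \<open>g is tested against a multiple of the indicator of the cell of x, taken with the sign of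
  g x; on that cell both factors are constant.\<close>

lemma grid_fun_small:
  assumes g: "grid_fun m k g" "\<And>x. \<bar>g x\<bar> \<le> c" and mk: "0 < m" "0 < k"
    and polar: "\<And>h. h \<in> grid_ball m k \<Longrightarrow> (\<integral>x. g x * h x \<partial>lborel) \<le> 1"
  shows "\<bar>g x\<bar> \<le> (1 / real m) powr (- (real CARD('n) / r0))"
proof (cases "x \<in> hbox k")
  case False
  then show ?thesis using g by (simp add: grid_fun_def)
next
  case x: True
  have gm [measurable]: "g \<in> borel_measurable borel" and gP: "\<And>x. g (grid_proj m x) = g x" and g0: "\<And>x. x \<notin> hbox k \<Longrightarrow> g x = 0"
    using g by (auto simp: grid_fun_def)
  define d where "d = 1 / real m"
  have d: "0 < d" using mk by (simp add: d_def)
  \<comment> \<open>Turns the indicator of a cell into a block: the mixed norm of that indicator is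
    at most d to the power of the sum of \<open>1 / conj_vec r $ i\<close>, and the product of the
    two is \<open>d powr - \<theta>\<close>.\<close>
  define \<sigma> where "\<sigma> = d powr (- \<theta> - (\<Sum>i\<in>UNIV. 1 / conj_vec r $ i))"
  define cell where "cell = {y. grid_proj m y = grid_proj m x}"
  have [measurable]: "cell \<in> sets borel" unfolding cell_def by measurable
  define h where "h y = \<sigma> * sgn (g x) * indicator cell y" for y
  have hm [measurable]: "h \<in> borel_measurable borel" unfolding h_def[abs_def] by measurable
  have idem: "grid_proj m (grid_proj m y) = grid_proj m y" for y :: "(real, 'n) vec"
    using mk by (simp add: vec_eq_iff)
  have h: "h \<in> grid_ball m k"
  proof (rule grid_ball_blockI[where a = "grid_proj m x" and l = d])
    have "y \<in> hbox k" if "y \<in> cell" for y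
      using that x hbox_grid_proj[of m y k] hbox_grid_proj[of m x k] mk by (simp add: cell_def)
    then show "grid_fun m k h"
      using hm by (auto simp: grid_fun_def h_def cell_def idem indicator_def)
    have sub: "y \<in> cube (grid_proj m x) d" if "y \<in> cell" for y
    proof -
      have "grid_proj m y $ i = grid_proj m x $ i" for i using that by (simp add: cell_def)
      then have "real_of_int \<lfloor>real m * x $ i\<rfloor> = real_of_int \<lfloor>real m * y $ i\<rfloor>" for i using mk by simp
      then have "real_of_int \<lfloor>real m * x $ i\<rfloor> \<le> real m * y $ i" "real m * y $ i \<le> real_of_int \<lfloor>real m * x $ i\<rfloor> + 1" for i
        by (metis of_int_floor_le, metis less_imp_le real_of_int_floor_add_one_gt)
      then show ?thesis using mk by (auto simp: mem_cube d_def field_simps)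
    qed
    then show h0: "h y = 0" if "y \<notin> cube (grid_proj m x) d" for y
      using that sub[of y] by (auto simp: h_def indicator_def)
    have "mixed_norm (conj_vec r) h \<le> ennreal (\<sigma> * d powr (\<Sum>i\<in>UNIV. 1 / conj_vec r $ i))"
      using d h0 conj_vec_gt less_trans[OF zero_less_one]
      by (intro mixed_norm_box_le[where a = "grid_proj m x"]) (auto simp: h_def \<sigma>_def abs_mult indicator_def sgn_if)
    also have "\<sigma> * d powr (\<Sum>i\<in>UNIV. 1 / conj_vec r $ i) = d powr - \<theta>"
      using d by (simp add: \<sigma>_def flip: powr_add)
    finally show "mixed_norm (conj_vec r) h \<le> ennreal (d powr - \<theta>)" .
  qed (fact d)
  have gx: "g y = g x" if "y \<in> cell" for y using that gP by (metis cell_def mem_Collect_eq)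
  have gh: "g y * h y = \<sigma> * \<bar>g x\<bar> * indicator cell y" for y
    using gx[of y] by (auto simp: h_def indicator_def abs_sgn mult_ac)
  have gh_nn: "0 \<le> g y * h y" for y unfolding gh by (simp add: \<sigma>_def)
  have "integrable lborel (\<lambda>y. g y * h y)"
    by (rule integrable_bounded_hbox[where k = k and c = "\<sigma> * \<bar>g x\<bar>"])
      (auto simp: g0, auto simp: gh \<sigma>_def abs_mult indicator_def)
  then have "(\<integral>\<^sup>+ y. ennreal \<bar>g y * h y\<bar> \<partial>lborel) = ennreal (\<integral>y. g y * h y \<partial>lborel)"
    using gh_nn by (simp only: abs_of_nonneg) (intro nn_integral_eq_integral, auto)
  also have "\<dots> \<le> ennreal 1" by (intro ennreal_leI polar h)
  finally have "(\<integral>\<^sup>+ y. ennreal \<bar>g y * h y\<bar> \<partial>lborel) \<le> ennreal 1" .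
  moreover have "ennreal (\<bar>g x * h x\<bar> * (1 / real m) ^ CARD('n)) \<le> (\<integral>\<^sup>+ y. ennreal \<bar>g y * h y\<bar> \<partial>lborel)"
    using mk gP h by (intro grid_cell_bound[of m "\<lambda>y. g y * h y" x]) (auto simp: grid_ball_def grid_fun_def)
  ultimately have "ennreal (\<bar>g x * h x\<bar> * (1 / real m) ^ CARD('n)) \<le> ennreal 1"
    by (rule order_trans[rotated])
  then have "\<sigma> * \<bar>g x\<bar> * d powr real CARD('n) \<le> 1"
    using d by (simp add: gh cell_def \<sigma>_def abs_mult powr_realpow d_def)
  \<comment> \<open>In this form the product of \<sigma> and the cell volume d^n is d to the power n
    / r0.\<close>
  moreover have "\<sigma> = d powr (real CARD('n) / r0 - real CARD('n))"
    by (simp add: \<sigma>_def sum_conj_vec \<theta>_def)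
  ultimately have "\<bar>g x\<bar> * d powr (real CARD('n) / r0) \<le> 1"
    using d by (simp add: powr_diff mult.commute)
  then show ?thesis
    using d by (simp add: powr_minus field_simps flip: d_def)
qed

text \<open>Cubes no larger than a cell are handled by the pointwise bound. A larger cube is
  enlarged to a union Q of cells; the extremizer of g restricted to Q is then invariant under the
  grid projection, and a multiple of it is an admissible test in \<open>polar\<close>. The factor
  \<open>3 powr \<theta>\<close> is the loss in the enlargement.\<close>

lemma grid_fun_morrey_norm_le:
  assumes g: "grid_fun m k g" "\<And>x. \<bar>g x\<bar> \<le> c" and mk: "0 < m" "0 < k"
    and polar: "\<And>h. h \<in> grid_ball m k \<Longrightarrow> (\<integral>x. g x * h x \<partial>lborel) \<le> 1"
  shows "morrey_norm r0 r g \<le> ennreal (3 powr \<theta>)"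
proof (rule morrey_norm_le)
  fix a :: "(real, 'n) vec" and l :: real assume l: "0 < l"
  have gm [measurable]: "g \<in> borel_measurable borel" and gP: "\<And>x. g (grid_proj m x) = g x" and g0: "\<And>x. x \<notin> hbox k \<Longrightarrow> g x = 0"
    using g by (auto simp: grid_fun_def)
  have r': "0 < r $ i" for i using r[of i] by simp
  define d where "d = 1 / real m"
  have d: "0 < d" using mk by (simp add: d_def)
  have one: "1 \<le> (3::real) powr \<theta>" using \<theta>_pos by (intro ge_one_powr_ge_zero) auto
  show "ennreal (l powr - \<theta>) * mixed_norm r (\<lambda>x. indicator (cube a l) x * g x) \<le> ennreal (3 powr \<theta>)"
  proof (cases "l \<le> d")
    case True
    have "mixed_norm r (\<lambda>x. indicator (cube a l) x * g x) \<le> ennreal (d powr (- (real CARD('n) / r0)) * l powr (\<Sum>i\<in>UNIV. 1 / r $ i))"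
      using grid_fun_small[OF g mk polar] l r'
      by (intro mixed_norm_box_le[where a = a]) (auto simp: indicator_def d_def)
    then have "ennreal (l powr - \<theta>) * mixed_norm r (\<lambda>x. indicator (cube a l) x * g x)
       \<le> ennreal (l powr - \<theta>) * ennreal (d powr (- (real CARD('n) / r0)) * l powr (\<Sum>i\<in>UNIV. 1 / r $ i))"
      by (rule mult_left_mono) simp
    also have "\<dots> = ennreal (d powr (- (real CARD('n) / r0)) * (l powr - \<theta> * l powr (\<Sum>i\<in>UNIV. 1 / r $ i)))"
      by (simp add: mult_ac flip: ennreal_mult)
    also have "l powr - \<theta> * l powr (\<Sum>i\<in>UNIV. 1 / r $ i) = l powr (real CARD('n) / r0)"
      by (simp add: \<theta>_def flip: powr_add)
    also have "d powr (- (real CARD('n) / r0)) * l powr (real CARD('n) / r0) \<le> d powr (- (real CARD('n) / r0)) * d powr (real CARD('n) / r0)"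
      using True l r0 by (intro mult_left_mono powr_mono2) auto
    also have "d powr (- (real CARD('n) / r0)) * d powr (real CARD('n) / r0) = 1"
      using d by (simp flip: powr_add)
    also note one
    finally show ?thesis by (simp add: ennreal_leI)
  next
    case False
    then have dl: "d < l" by simp
    \<comment> \<open>The extra cell pays for the position of a inside its own cell, the ceiling for
      the last partial cell. The side l' of Q is at least l + d and at most l + 2 d, hence at most 3
      l since d < l.\<close>
    define N where "N = \<lceil>real m * l\<rceil> + 1"
    define l' where "l' = real_of_int N * d"
    have N: "real m * l + 1 \<le> real_of_int N" "real_of_int N \<le> real m * l + 2"
      unfolding N_def by linarith+
    have l'1: "l + d \<le> l'" using mult_right_mono[OF N(1), of d] d mk by (simp add: l'_def d_def add_divide_distrib)
    have "l' \<le> l + 2 * d" using mult_right_mono[OF N(2), of d] d mk by (simp add: l'_def d_def add_divide_distrib)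
    with dl have l'3: "l' \<le> 3 * l" by simp
    have l': "0 < l'" using l'1 l d by simp
    define j where "j i = \<lfloor>real m * a $ i\<rfloor>" for i
    define Q where "Q = {y :: (real, 'n) vec. \<forall>i. real_of_int (j i) / real m \<le> y $ i \<and> y $ i < real_of_int (j i + N) / real m}"
    have [measurable]: "Q \<in> sets borel" unfolding Q_def by measurable
    have QP: "grid_proj m y \<in> Q \<longleftrightarrow> y \<in> Q" for y
      unfolding Q_def mem_Collect_eq grid_proj_nth grid_coord_iff[OF mk(1)] ..
    have Qc: "y \<in> cube (grid_proj m a) l'" if "y \<in> Q" for y
      using that by (auto simp: Q_def mem_cube j_def l'_def d_def add_divide_distrib less_imp_le)
    have cQ: "y \<in> Q" if "y \<in> cube a l" for y
    proof -
      have y: "a $ i \<le> y $ i" "y $ i \<le> a $ i + l" for i using that by (auto simp: mem_cube)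
      have j1: "real_of_int (j i) / real m \<le> a $ i" "a $ i < real_of_int (j i) / real m + d" for i
      proof -
        have "real_of_int (j i) \<le> real m * a $ i" "real m * a $ i < real_of_int (j i) + 1" unfolding j_def by linarith+
        then show "real_of_int (j i) / real m \<le> a $ i" "a $ i < real_of_int (j i) / real m + d"
          using mk by (simp_all add: d_def field_simps)
      qed
      have j2: "real_of_int (j i + N) / real m = real_of_int (j i) / real m + l'" for i
        by (simp add: l'_def d_def add_divide_distrib)
      have "real_of_int (j i) / real m \<le> y $ i \<and> y $ i < real_of_int (j i + N) / real m" for i
        unfolding j2 using y[of i] j1[of i] l'1 by linarith
      then show ?thesis by (simp add: Q_def)
    qed
    define w where "w y = indicator Q y * g y" for y
    have wm [measurable]: "w \<in> borel_measurable borel" unfolding w_def[abs_def] by measurable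
    have wP: "w (grid_proj m y) = w y" for y using QP[of y] gP by (simp add: w_def indicator_def)
    have w0: "w y = 0" if "y \<notin> hbox k" for y using g0[OF that] by (simp add: w_def)
    have wc: "\<bar>w y\<bar> \<le> c" for y using g(2)[of y] order_trans[OF abs_ge_zero g(2)[of y]] by (simp add: w_def indicator_def)
    have wQ: "w x = 0" if "x \<notin> cube (grid_proj m a) l'" for x
      using that Qc[of x] by (auto simp: w_def indicator_def)
    obtain H where H: "H \<in> borel_measurable borel" "\<And>x. w x = 0 \<Longrightarrow> H x = 0" "\<And>x. 0 \<le> w x * H x"
      "\<And>P x. coordwise_projection P \<Longrightarrow> (\<And>x. w (P x) = w x) \<Longrightarrow> H (P x) = H x"
      "mixed_norm (conj_vec r) H \<le> 1"
      "(\<integral>\<^sup>+ x. ennreal (w x * H x) \<partial>lborel) = mixed_norm r w"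
      using mixed_norm_extremizer[where a = "grid_proj m a", OF wm l' wc wQ r] by blast
    note [measurable] = H(1)
    \<comment> \<open>The invariance clause of the extremizer puts its multiple h into
      \<open>grid_ball m k\<close>.\<close>
    have HP: "H (grid_proj m y) = H y" for y
      using coordwise_projection_grid_proj[OF mk(1)] wP by (rule H(4))
    define h where "h y = l' powr - \<theta> * H y" for y
    have h: "h \<in> grid_ball m k"
    proof (rule grid_ball_blockI[where a = "grid_proj m a" and l = l'])
      show "grid_fun m k h"
        unfolding grid_fun_def h_def[abs_def] using HP H(2) w0 by auto
      show "h x = 0" if "x \<notin> cube (grid_proj m a) l'" for x
        using that Qc[of x] H(2)[of x] by (auto simp: h_def w_def indicator_def)
      have "mixed_norm (conj_vec r) h = ennreal (l' powr - \<theta>) * mixed_norm (conj_vec r) H"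
        unfolding h_def[abs_def] using conj_vec_gt less_trans[OF zero_less_one]
        by (subst mixed_norm_cmult) (auto simp: measurable_completion)
      also have "\<dots> \<le> ennreal (l' powr - \<theta>) * 1" by (intro mult_left_mono H) simp
      finally show "mixed_norm (conj_vec r) h \<le> ennreal (l' powr - \<theta>)" by simp
    qed (fact l')
    have gh: "g y * h y = l' powr - \<theta> * (w y * H y)" for y
      using H(2)[of y] by (auto simp: h_def w_def indicator_def)
    have "\<bar>g y * h y\<bar> \<le> c * ((2 * real k) powr (real CARD('n) / r0) * real m ^ CARD('n))" for y
      unfolding abs_mult using g(2)[of y] grid_ball_bounded[OF h mk, of y] order_trans[OF abs_ge_zero g(2)[of y]]
      by (intro mult_mono) auto
    then have int: "integrable lborel (\<lambda>y. g y * h y)"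
      using h by (intro integrable_bounded_hbox[where k = k]) (auto simp: g0 grid_ball_def grid_fun_def)
    have "ennreal (l' powr - \<theta>) * mixed_norm r w = (\<integral>\<^sup>+ y. ennreal (l' powr - \<theta>) * ennreal (w y * H y) \<partial>lborel)"
      unfolding H(6)[symmetric] by (rule nn_integral_cmult[symmetric]) measurable
    also have "\<dots> = (\<integral>\<^sup>+ y. ennreal (g y * h y) \<partial>lborel)"
      using H(3) by (simp add: gh ennreal_mult)
    also have "\<dots> = ennreal (\<integral>y. g y * h y \<partial>lborel)"
      using int H(3) by (intro nn_integral_eq_integral) (auto simp: gh)
    also have "\<dots> \<le> ennreal 1" by (intro ennreal_leI polar h)
    finally have 1: "ennreal (l' powr - \<theta>) * mixed_norm r w \<le> 1" by simp
    have "mixed_norm r (\<lambda>x. indicator (cube a l) x * g x) \<le> mixed_norm r w"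
      using r' cQ by (intro mixed_norm_mono) (auto simp: w_def indicator_def)
    then have "ennreal (l powr - \<theta>) * mixed_norm r (\<lambda>x. indicator (cube a l) x * g x) \<le> ennreal (l powr - \<theta>) * mixed_norm r w"
      by (rule mult_left_mono) simp
    also have "\<dots> = ennreal ((l' / l) powr \<theta>) * (ennreal (l' powr - \<theta>) * mixed_norm r w)"
      using l l' by (simp add: powr_divide powr_minus field_simps flip: ennreal_mult mult.assoc)
    also have "\<dots> \<le> ennreal ((l' / l) powr \<theta>) * 1" by (intro mult_left_mono 1) simp
    also have "\<dots> \<le> ennreal (3 powr \<theta>)"
      using l l' l'3 \<theta>_pos by (simp add: divide_le_eq) (intro ennreal_leI powr_mono2, auto simp: divide_le_eq)
    finally show ?thesis .
  qed
qed

end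

section \<open>Separating a grid function from the block ball\<close>

lemma integrable_hbox_times:
  fixes u v :: "real^'n \<Rightarrow> real"
  assumes [measurable]: "u \<in> borel_measurable borel" "v \<in> borel_measurable borel"
    and b: "\<And>x. \<bar>u x\<bar> \<le> c" "\<And>x. \<bar>v x\<bar> \<le> d" and z: "\<And>x. x \<notin> hbox k \<Longrightarrow> u x = 0"
  shows "integrable lborel (\<lambda>x. u x * v x)"
proof (rule integrable_bounded_hbox[where k = k and c = "c * d"])
  show "\<bar>u x * v x\<bar> \<le> c * d" for x
    unfolding abs_mult using b[of x] by (intro mult_mono) auto
qed (use z in auto)

context morrey_block
begin

text \<open>If \<open>G\<close> is at positive \<open>L\<^sup>2\<close>-distance from the convex set \<open>grid_ball m k\<close>, then \<open>G - u\<close> with an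
  almost nearest \<open>u\<close> separates \<open>G\<close> from that set.\<close>

lemma grid_decomposable:
  assumes G: "grid_fun m k G" "\<And>x. \<bar>G x\<bar> \<le> M" and mk: "0 < m" "0 < k" and a: "0 < a" "dual_bound a G"
  shows "decomposable (4 * 3 powr \<theta> * a) G"
proof -
  \<comment> \<open>Separation would yield \<open>c \<le> a * 3 powr \<theta>\<close>; the factor 2
    here contradicts that. The other factor 2 of the conclusion comes from
    \<open>decomposable 2 F\<close>.\<close>
  define c where "c = 2 * 3 powr \<theta> * a"
  have c: "0 < c" using a by (simp add: c_def)
  define F where "F x = (1 / c) * G x" for x
  have Gm [measurable]: "G \<in> borel_measurable borel" and GP: "\<And>x. G (grid_proj m x) = G x" and G0: "\<And>x. x \<notin> hbox k \<Longrightarrow> G x = 0"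
    using G by (auto simp: grid_fun_def)
  have Fm [measurable]: "F \<in> borel_measurable borel" unfolding F_def[abs_def] by measurable
  have FP: "F (grid_proj m x) = F x" for x by (simp add: F_def GP)
  have F0: "F x = 0" if "x \<notin> hbox k" for x using that by (simp add: F_def G0)
  have Fb: "\<bar>F x\<bar> \<le> M / c" for x using G(2)[of x] c by (simp add: F_def abs_mult divide_right_mono)
  define W where "W = (2 * real k) powr (real CARD('n) / r0) * real m ^ CARD('n)"
  define U where "U = grid_ball m k"
  have U: "u \<in> borel_measurable borel" "\<And>x. u (grid_proj m x) = u x" "\<And>x. x \<notin> hbox k \<Longrightarrow> u x = 0" "decomposable 1 u" "\<And>x. \<bar>u x\<bar> \<le> W"
    if "u \<in> U" for u
    using that grid_ball_bounded[OF _ mk] by (auto simp: U_def grid_ball_def grid_fun_def W_def)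
  \<comment> \<open>A function on \<open>hbox k\<close> bounded by \<epsilon> has at most the mixed
    norm of a block on the cube of side 2 k.\<close>
  define \<epsilon> where "\<epsilon> = (2 * real k) powr (- \<theta> - (\<Sum>i\<in>UNIV. 1 / conj_vec r $ i))"
  have \<epsilon>: "0 < \<epsilon>" using mk by (simp add: \<epsilon>_def)
  have "decomposable 2 F"
  proof (cases "\<exists>u\<in>U. \<forall>x. \<bar>F x - u x\<bar> \<le> \<epsilon>")
    case True
    then obtain u where u: "u \<in> U" "\<And>x. \<bar>F x - u x\<bar> \<le> \<epsilon>" by blast
    note [measurable] = U(1)[OF u(1)]
    have z: "F x - u x = 0" if "x \<notin> cube (- (real k *\<^sub>R One)) (2 * real k)" for x
    proof -
      have "x \<notin> hbox k" using that hbox_subset_cube[of k] by blast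
      then show ?thesis using F0 U(3)[OF u(1)] by simp
    qed
    have "mixed_norm (conj_vec r) (\<lambda>x. F x - u x) \<le> ennreal (\<epsilon> * (2 * real k) powr (\<Sum>i\<in>UNIV. 1 / conj_vec r $ i))"
      using mk u(2) z conj_vec_gt less_trans[OF zero_less_one]
      by (intro mixed_norm_box_le[where a = "- (real k *\<^sub>R One)"]) auto
    also have "\<epsilon> * (2 * real k) powr (\<Sum>i\<in>UNIV. 1 / conj_vec r $ i) = 1 * (2 * real k) powr - \<theta>"
      using mk by (simp add: \<epsilon>_def flip: powr_add)
    finally have "decomposable 1 (\<lambda>x. F x - u x)"
      using mk z by (intro decomposable_single) (auto simp: borel_imp_lebesgue)
    from decomposable_add[OF U(4)[OF u(1)] this] show ?thesis by simp
  next
    case far: False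
    define dist2 where "dist2 u = (\<integral>x. (F x - u x) * (F x - u x) \<partial>lborel)" for u
    \<comment> \<open>Two grid functions differing by more than \<epsilon> somewhere do so on a
      whole cell, of volume m^(-n); this bounds the squared L^2 distance from below.\<close>
    define d0 where "d0 = \<epsilon> * \<epsilon> * (1 / real m) ^ CARD('n)"
    have d0: "0 < d0" using \<epsilon> mk by (simp add: d0_def)
    have FU: "\<bar>F x - u x\<bar> \<le> M / c + W" if "u \<in> U" for u x
      using Fb[of x] U(5)[OF that, of x] by linarith
    have FU0: "F x - u x = 0" if "u \<in> U" "x \<notin> hbox k" for u x
      using F0[OF that(2)] U(3)[OF that] by simp
    have dist2_ge: "d0 \<le> dist2 u" if u: "u \<in> U" for u
    proof -
      note [measurable] = U(1)[OF u]
      let ?w = "\<lambda>x. (F x - u x) * (F x - u x)"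
      obtain x where x: "\<epsilon> < \<bar>F x - u x\<bar>" using far u by (auto simp: not_le)
      have "ennreal (\<bar>?w x\<bar> * (1 / real m) ^ CARD('n)) \<le> (\<integral>\<^sup>+ y. ennreal \<bar>?w y\<bar> \<partial>lborel)"
        using mk FP U(2)[OF u] by (intro grid_cell_bound) auto
      also have "\<dots> = ennreal (dist2 u)"
        unfolding dist2_def using FU[OF u] FU0[OF u]
        by (subst nn_integral_eq_integral[symmetric]) (auto intro!: integrable_hbox_times[where k = k])
      finally have "\<bar>?w x\<bar> * (1 / real m) ^ CARD('n) \<le> dist2 u"
        unfolding dist2_def by (subst (asm) ennreal_le_iff) (auto intro!: integral_nonneg_AE)
      moreover have "\<epsilon> * \<epsilon> \<le> \<bar>?w x\<bar>"
        using x \<epsilon> unfolding abs_mult by (intro mult_mono) auto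
      ultimately show ?thesis
        unfolding d0_def by (meson order_trans mult_right_mono zero_le_power divide_nonneg_nonneg zero_le_one of_nat_0_le_iff)
    qed
    define Dm where "Dm = (\<integral>x. (2 * W) * (2 * W) * indicator (hbox k :: (real, 'n) vec set) x \<partial>lborel)"
    have ih: "integrable lborel (\<lambda>x. (2 * W) * (2 * W) * indicator (hbox k :: (real, 'n) vec set) x)"
      by (rule integrable_bounded_hbox[where k = k and c = "(2 * W) * (2 * W)"]) (auto simp: indicator_def)
    have Dm0: "0 \<le> Dm" unfolding Dm_def by (intro integral_nonneg_AE) (auto simp: indicator_def)
    have UU: "\<bar>h x - u x\<bar> \<le> 2 * W" if "u \<in> U" "h \<in> U" for u h x
      using U(5)[OF that(1), of x] U(5)[OF that(2), of x] by linarith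
    have UU0: "h x - u x = 0" if "u \<in> U" "h \<in> U" "x \<notin> hbox k" for u h x
      using U(3)[OF that(1,3)] U(3)[OF that(2,3)] by simp
    have W0: "0 \<le> W" by (simp add: W_def)
    have Dm_ge: "(\<integral>x. (h x - u x) * (h x - u x) \<partial>lborel) \<le> Dm" if "u \<in> U" "h \<in> U" for u h
      unfolding Dm_def
    proof (rule integral_mono[OF _ ih])
      note [measurable] = U(1)[OF that(1)] U(1)[OF that(2)]
      show "integrable lborel (\<lambda>x. (h x - u x) * (h x - u x))"
        using UU[OF that] UU0[OF that] by (intro integrable_hbox_times[where k = k]) auto
      show "(h x - u x) * (h x - u x) \<le> (2 * W) * (2 * W) * indicator (hbox k) x" for x
      proof (cases "x \<in> hbox k")
        case True
        have "\<bar>h x - u x\<bar> * \<bar>h x - u x\<bar> \<le> (2 * W) * (2 * W)"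
          using UU[OF that, of x] W0 by (intro mult_mono) auto
        then show ?thesis using True by simp
      qed (use UU0[OF that] in auto)
    qed
    \<comment> \<open>Step length for moving u towards h, short enough that the quadratic term
      satisfies \<open>t * Dm \<le> d0 / 2\<close>.\<close>
    define t where "t = min 1 (d0 / (2 * (Dm + 1)))"
    have t: "0 < t" "t \<le> 1" using d0 Dm0 by (auto simp: t_def)
    have "t * Dm \<le> d0 / (2 * (Dm + 1)) * Dm" using Dm0 by (intro mult_right_mono) (auto simp: t_def)
    also have "\<dots> = d0 / 2 * (Dm / (Dm + 1))" using Dm0 by (simp add: field_simps)
    also have "\<dots> \<le> d0 / 2 * 1" using Dm0 d0 by (intro mult_left_mono) auto
    finally have tD: "t * Dm \<le> d0 / 2" by simp
    define \<delta> where "\<delta> = Inf (dist2 ` U)"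
    have bdd: "bdd_below (dist2 ` U)" using dist2_ge by (intro bdd_belowI[of _ d0]) auto
    have zU: "(\<lambda>_. 0) \<in> U" by (simp add: U_def zero_grid_ball)
    \<comment> \<open>An almost minimal u takes the place of a nearest point, whose existence would
      call for a closed U. The slack is linear in t, hence comparable with the first
      variation.\<close>
    have "Inf (dist2 ` U) < \<delta> + t * d0 / 2" using t d0 by (simp add: \<delta>_def)
    then obtain u where u: "u \<in> U" "dist2 u < \<delta> + t * d0 / 2"
      using cInf_lessD[of "dist2 ` U"] zU by blast
    define g where "g x = F x - u x" for x
    note [measurable] = U(1)[OF u(1)]
    have gm [measurable]: "g \<in> borel_measurable borel" unfolding g_def[abs_def] by measurable
    have gb: "\<bar>g x\<bar> \<le> M / c + W" for x using FU[OF u(1)] by (simp add: g_def)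
    have g0: "g x = 0" if "x \<notin> hbox k" for x using FU0[OF u(1) that] by (simp add: g_def)
    have gP: "g (grid_proj m x) = g x" for x by (simp add: g_def FP U(2)[OF u(1)])
    have gg: "(\<integral>x. g x * g x \<partial>lborel) = dist2 u" by (simp add: dist2_def g_def)
    have ig: "integrable lborel (\<lambda>x. g x * v x)" if "v \<in> borel_measurable borel" "\<And>x. \<bar>v x\<bar> \<le> C" for v C
      using that gb g0 by (intro integrable_hbox_times[where k = k]) auto
    have ub: "\<bar>u x\<bar> \<le> W" for x using U(5)[OF u(1)] .
    \<comment> \<open>Moving from u towards h lowers the squared distance by no more than the slack,
      so g pairs with h - u to less than d0 / 2. With F - u, which is g itself, it pairs to at least
      d0.\<close>
    have upper: "(\<integral>x. g x * h x \<partial>lborel) \<le> (\<integral>x. g x * F x \<partial>lborel) - d0 / 2" if h: "h \<in> U" for h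
    proof -
      note [measurable] = U(1)[OF h]
      let ?e = "\<lambda>x. h x - u x"
      have i1: "integrable lborel (\<lambda>x. g x * g x)" using gb by (intro ig) auto
      have i2: "integrable lborel (\<lambda>x. g x * ?e x)" using UU[OF u(1) h] by (intro ig) auto
      have i3: "integrable lborel (\<lambda>x. ?e x * ?e x)"
        using UU[OF u(1) h] UU0[OF u(1) h] by (intro integrable_hbox_times[where k = k]) auto
      have i4: "integrable lborel (\<lambda>x. g x * u x)" using ub by (intro ig) auto
      have i5: "integrable lborel (\<lambda>x. g x * F x)" using Fb by (intro ig) auto
      have "(\<lambda>x. u x + t * (h x - u x)) \<in> U"
        using grid_ball_convex u(1) h t by (simp add: U_def)
      then have "\<delta> \<le> dist2 (\<lambda>x. u x + t * (h x - u x))"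
        unfolding \<delta>_def using bdd by (intro cInf_lower) auto
      also have "\<dots> = (\<integral>x. g x * g x - 2 * t * (g x * ?e x) + t * t * (?e x * ?e x) \<partial>lborel)"
        unfolding dist2_def by (intro Bochner_Integration.integral_cong) (auto simp: g_def algebra_simps)
      also have "\<dots> = (\<integral>x. g x * g x \<partial>lborel) - 2 * t * (\<integral>x. g x * ?e x \<partial>lborel) + t * t * (\<integral>x. ?e x * ?e x \<partial>lborel)"
        using i1 i2 i3 by (simp only: Bochner_Integration.integral_add Bochner_Integration.integral_diff integral_mult_right_zero
           integrable_mult_right Bochner_Integration.integrable_diff)
      also have "\<dots> \<le> dist2 u - 2 * t * (\<integral>x. g x * ?e x \<partial>lborel) + t * t * Dm"
        unfolding gg using Dm_ge[OF u(1) h] t by (intro add_left_mono mult_left_mono) auto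
      finally have "2 * t * (\<integral>x. g x * ?e x \<partial>lborel) < t * d0 / 2 + t * t * Dm" using u(2) by linarith
      also have "t * d0 / 2 + t * t * Dm = t * (d0 / 2 + t * Dm)" by (simp add: algebra_simps)
      also have "\<dots> \<le> t * d0" using tD t by (intro mult_left_mono) auto
      finally have "t * (2 * (\<integral>x. g x * ?e x \<partial>lborel)) < t * d0" by simp
      then have "(\<integral>x. g x * ?e x \<partial>lborel) < d0 / 2" using t by simp
      moreover have "(\<integral>x. g x * h x \<partial>lborel) = (\<integral>x. g x * ?e x \<partial>lborel) + (\<integral>x. g x * u x \<partial>lborel)"
        by (subst Bochner_Integration.integral_add[OF i2 i4, symmetric]) (simp add: algebra_simps)
      moreover have "(\<integral>x. g x * F x \<partial>lborel) = (\<integral>x. g x * g x \<partial>lborel) + (\<integral>x. g x * u x \<partial>lborel)"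
        by (subst Bochner_Integration.integral_add[OF i1 i4, symmetric]) (simp add: algebra_simps g_def)
      moreover have "d0 \<le> (\<integral>x. g x * g x \<partial>lborel)" using dist2_ge[OF u(1)] gg by simp
      ultimately show ?thesis by linarith
    qed
    \<comment> \<open>The value of the functional at F is positive because 0 lies in U. Dividing by
      it puts g into the polar of U.\<close>
    define \<tau> where "\<tau> = (\<integral>x. g x * F x \<partial>lborel)"
    have \<tau>: "0 < \<tau>" using upper[OF zU] d0 by (simp add: \<tau>_def)
    define g' where "g' x = (1 / \<tau>) * g x" for x
    have g'm [measurable]: "g' \<in> borel_measurable borel" unfolding g'_def[abs_def] by measurable
    have g'_grid: "grid_fun m k g'" using g0 gP by (auto simp: grid_fun_def g'_def)
    have g'b: "\<bar>g' x\<bar> \<le> (M / c + W) / \<tau>" for x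
      using gb[of x] \<tau> by (simp add: g'_def abs_mult divide_right_mono)
    have polar: "(\<integral>x. g' x * h x \<partial>lborel) \<le> 1" if "h \<in> grid_ball m k" for h
    proof -
      have "(\<integral>x. g x * h x \<partial>lborel) \<le> \<tau>" using upper[of h] that d0 by (simp add: U_def \<tau>_def)
      moreover have "(\<integral>x. g' x * h x \<partial>lborel) = (1 / \<tau>) * (\<integral>x. g x * h x \<partial>lborel)"
        by (simp add: g'_def)
      ultimately show ?thesis using \<tau> by simp
    qed
    have g'_norm: "morrey_norm r0 r g' \<le> ennreal (3 powr \<theta>)"
      by (rule grid_fun_morrey_norm_le[OF g'_grid g'b mk polar])
    have GFg: "G x * g' x = (c / \<tau>) * (g x * F x)" for x using c by (simp add: F_def g'_def)
    have i5: "integrable lborel (\<lambda>x. g x * F x)" using Fb by (intro ig) auto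
    have i6: "integrable lborel (\<lambda>x. G x * g' x)" unfolding GFg using i5 by simp
    have "c = (\<integral>x. G x * g' x \<partial>lborel)"
      unfolding GFg using \<tau> by (simp add: \<tau>_def)
    also have "ennreal \<dots> \<le> (\<integral>\<^sup>+ x. ennreal \<bar>G x * g' x\<bar> \<partial>lborel)"
      using integral_norm_bound_ennreal[OF i6] by (auto intro: order_trans[rotated] ennreal_leI)
    also have "\<dots> \<le> ennreal (a * 3 powr \<theta>)"
      by (rule dual_bound_scaled[OF a(2) test_fun_grid[OF g'_grid g'b] _ g'_norm]) simp
    finally have "c \<le> a * 3 powr \<theta>" using a by simp
    then have False using a by (simp add: c_def)
    then show ?thesis ..
  qed
  then have "decomposable (4 * 3 powr \<theta> * a) (\<lambda>x. c * F x)"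
    by (rule decomposable_cmult) (use c in \<open>simp add: c_def\<close>)
  moreover have "(\<lambda>x. c * F x) = G" using c by (auto simp: F_def)
  ultimately show ?thesis by simp
qed

section \<open>From grid functions to arbitrary functions\<close>

lemma decomposable_dual_bound:
  assumes "decomposable c F" "F \<in> borel_measurable borel"
  shows "dual_bound c F"
  unfolding dual_bound_def
proof (intro conjI allI impI)
  fix g assume g: "test_fun g" "morrey_norm r0 r g \<le> 1"
  then have [measurable]: "g \<in> borel_measurable borel" by (simp add: test_fun_def)
  note [measurable] = assms(2)
  have "(\<integral>\<^sup>+ x. ennreal \<bar>F x * g x\<bar> \<partial>lborel) = (\<integral>\<^sup>+ x. ennreal \<bar>F x * g x\<bar> \<partial>lebesgue)"
    by (rule nn_integral_completion[symmetric])
  also have "\<dots> \<le> ennreal c * morrey_norm r0 r g"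
    by (intro decomposable_pairing assms(1) borel_imp_lebesgue) measurable
  also have "\<dots> \<le> ennreal c * 1" by (intro mult_left_mono g) simp
  finally show "(\<integral>\<^sup>+ x. ennreal \<bar>F x * g x\<bar> \<partial>lborel) \<le> ennreal c" by simp
qed fact

lemma dual_bound_diff:
  assumes F: "dual_bound a F" and G: "dual_bound b G" and ab: "0 \<le> a" "0 \<le> b"
  shows "dual_bound (a + b) (\<lambda>x. F x - G x)"
proof -
  have [measurable]: "F \<in> borel_measurable borel" "G \<in> borel_measurable borel"
    using F G by (auto simp: dual_bound_def)
  show ?thesis
    unfolding dual_bound_def
  proof (intro conjI allI impI)
    fix g assume g: "test_fun g" "morrey_norm r0 r g \<le> 1"
    then have [measurable]: "g \<in> borel_measurable borel" by (simp add: test_fun_def)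
    have "(\<integral>\<^sup>+ x. ennreal \<bar>(F x - G x) * g x\<bar> \<partial>lborel) \<le> (\<integral>\<^sup>+ x. ennreal \<bar>F x * g x\<bar> + ennreal \<bar>G x * g x\<bar> \<partial>lborel)"
      by (intro nn_integral_mono) (auto simp: left_diff_distrib abs_triangle_ineq4 simp flip: ennreal_plus intro!: ennreal_leI)
    also have "\<dots> = (\<integral>\<^sup>+ x. ennreal \<bar>F x * g x\<bar> \<partial>lborel) + (\<integral>\<^sup>+ x. ennreal \<bar>G x * g x\<bar> \<partial>lborel)"
      by (rule nn_integral_add) measurable
    also have "\<dots> \<le> ennreal a + ennreal b"
      using F G g by (intro add_mono) (auto simp: dual_bound_def)
    finally show "(\<integral>\<^sup>+ x. ennreal \<bar>(F x - G x) * g x\<bar> \<partial>lborel) \<le> ennreal (a + b)"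
      using ab by (simp add: ennreal_plus)
  qed measurable
qed

text \<open>Two errors, each a times one block: F against a continuous function cut off to
  \<open>hbox k\<close>, and that function against its values at grid corners. What remains is a
  grid function with dual bound 3 a, whence \<open>2 + 4 * 3 * 3 powr \<theta>\<close>.\<close>

lemma bounded_decomposable:
  assumes F: "\<And>x. \<bar>F x\<bar> \<le> M" "\<And>x. x \<notin> hbox k \<Longrightarrow> F x = 0" and k: "0 < k" and a: "0 < a" "dual_bound a F"
  shows "decomposable ((2 + 12 * 3 powr \<theta>) * a) F"
proof -
  have Fm [measurable]: "F \<in> borel_measurable borel" using a by (simp add: dual_bound_def)
  have M0: "0 \<le> M" using order_trans[OF abs_ge_zero F(1)] .
  have "F measurable_on UNIV"
    by (rule lebesgue_measurable_imp_measurable_on) (auto simp: lebesgue_on_UNIV_eq borel_imp_lebesgue)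
  then obtain N g where N: "negligible N" and g: "\<And>n::nat. continuous_on UNIV (g n)"
    and lim: "\<And>x. x \<notin> N \<Longrightarrow> (\<lambda>n. g n x) \<longlonglongrightarrow> F x"
    unfolding measurable_on_def by auto
  have gm [measurable]: "g n \<in> borel_measurable borel" for n
    using g by (rule borel_measurable_continuous_onI)
  \<comment> \<open>Truncation at M leaves the limit F unchanged and supplies the bound for
    dominated convergence.\<close>
  define \<phi> where "\<phi> n x = max (- M) (min M (g n x))" for n x
  have \<phi>m [measurable]: "\<phi> n \<in> borel_measurable borel" for n unfolding \<phi>_def[abs_def] by measurable
  have \<phi>b: "\<bar>\<phi> n x\<bar> \<le> M" for n x using M0 by (auto simp: \<phi>_def)
  have \<phi>c: "continuous_on UNIV (\<phi> n)" for n
    unfolding \<phi>_def[abs_def] using g by (intro continuous_intros) auto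
  let ?a = "- (real k *\<^sub>R One) :: (real, 'n) vec" and ?h = "2 * real k"
  have cz: "x \<notin> hbox k" if "x \<notin> cube ?a ?h" for x using that hbox_subset_cube[of k] by blast
  have r': "0 < conj_vec r $ i" for i using conj_vec_gt[of i] by simp
  \<comment> \<open>Below this threshold an error on \<open>hbox k\<close> is a times a block on the
    cube of side 2 k.\<close>
  define \<epsilon> where "\<epsilon> = a * ?h powr - \<theta>"
  have \<epsilon>: "0 < \<epsilon>" using a k by (simp add: \<epsilon>_def)
  have small: "decomposable a R" if "R \<in> borel_measurable borel" "\<And>x. x \<notin> hbox k \<Longrightarrow> R x = 0"
    "mixed_norm (conj_vec r) R < ennreal \<epsilon>" for R
    using that k a cz by (intro decomposable_single[where a = ?a and h = ?h]) (auto simp: borel_imp_lebesgue \<epsilon>_def less_imp_le)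
  define R1 where "R1 n x = F x - indicator (hbox k) x * \<phi> n x" for n x
  have R1m [measurable]: "R1 n \<in> borel_measurable borel" for n unfolding R1_def[abs_def] by measurable
  have R1z: "R1 n x = 0" if "x \<notin> hbox k" for n x using that F(2) by (simp add: R1_def)
  have "(\<lambda>n. mixed_norm (conj_vec r) (R1 n)) \<longlonglongrightarrow> 0"
  proof (rule mixed_norm_dominated_convergence[where a = ?a and h = ?h and c = "2 * M"])
    show "\<bar>R1 n x\<bar> \<le> 2 * M" for n x
      using F(1)[of x] \<phi>b[of n x] M0 by (auto simp: R1_def indicator_def)
    have "AE x in lebesgue. x \<notin> N"
      using N by (intro AE_not_in) (simp add: negligible_iff_null_sets)
    then have "AE x in lebesgue. (\<lambda>n. R1 n x) \<longlonglongrightarrow> 0"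
    proof eventually_elim
      case (elim x)
      have "(\<lambda>n. \<phi> n x) \<longlonglongrightarrow> max (- M) (min M (F x))"
        unfolding \<phi>_def by (intro tendsto_intros lim elim)
      also have "max (- M) (min M (F x)) = F x" using F(1)[of x] by auto
      finally have "(\<lambda>n. F x - indicator (hbox k) x * \<phi> n x) \<longlonglongrightarrow> F x - indicator (hbox k) x * F x"
        by (intro tendsto_intros)
      also have "F x - indicator (hbox k) x * F x = 0" using F(2)[of x] by (auto simp: indicator_def)
      finally show ?case by (simp add: R1_def)
    qed
    then show "AE x in lborel. (\<lambda>n. R1 n x) \<longlonglongrightarrow> 0" by (simp add: AE_completion_iff)
  qed (use k r' R1z cz in auto)
  then have "\<forall>\<^sub>F n in sequentially. mixed_norm (conj_vec r) (R1 n) < ennreal \<epsilon>"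
    by (rule order_tendstoD) (use \<epsilon> in simp)
  then obtain n where n: "mixed_norm (conj_vec r) (R1 n) < ennreal \<epsilon>"
    using eventually_happens[of _ sequentially] by auto
  define G where "G m x = indicator (hbox k) x * \<phi> n (grid_proj (Suc m) x)" for m x
  have Gm [measurable]: "G m \<in> borel_measurable borel" for m unfolding G_def[abs_def] by measurable
  define R2 where "R2 m x = indicator (hbox k) x * \<phi> n x - G m x" for m x
  have R2m [measurable]: "R2 m \<in> borel_measurable borel" for m unfolding R2_def[abs_def] by measurable
  have R2z: "R2 m x = 0" if "x \<notin> hbox k" for m x using that by (simp add: R2_def G_def)
  have "(\<lambda>m. mixed_norm (conj_vec r) (R2 m)) \<longlonglongrightarrow> 0"
  proof (rule mixed_norm_dominated_convergence[where a = ?a and h = ?h and c = "2 * M"])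
    show "\<bar>R2 m x\<bar> \<le> 2 * M" for m x
      using \<phi>b[of n x] \<phi>b[of n "grid_proj (Suc m) x"] M0 by (auto simp: R2_def G_def indicator_def)
    show "AE x in lborel. (\<lambda>m. R2 m x) \<longlonglongrightarrow> 0"
    proof (rule AE_I2)
      fix x
      have "(\<lambda>m. \<phi> n (grid_proj (Suc m) x)) \<longlonglongrightarrow> \<phi> n x"
        using \<phi>c[of n] grid_proj_tendsto[of x] by (auto simp: continuous_on_eq_continuous_at intro: isCont_tendsto_compose)
      then have "(\<lambda>m. indicator (hbox k) x * \<phi> n x - indicator (hbox k) x * \<phi> n (grid_proj (Suc m) x))
          \<longlonglongrightarrow> indicator (hbox k) x * \<phi> n x - indicator (hbox k) x * \<phi> n x"
        by (intro tendsto_intros)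
      then show "(\<lambda>m. R2 m x) \<longlonglongrightarrow> 0" by (simp add: R2_def G_def)
    qed
  qed (use k r' R2z cz in auto)
  then have "\<forall>\<^sub>F m in sequentially. mixed_norm (conj_vec r) (R2 m) < ennreal \<epsilon>"
    by (rule order_tendstoD) (use \<epsilon> in simp)
  then obtain m where m: "mixed_norm (conj_vec r) (R2 m) < ennreal \<epsilon>"
    using eventually_happens[of _ sequentially] by auto
  have d1: "decomposable a (R1 n)" by (rule small[OF R1m R1z n])
  have d2: "decomposable a (R2 m)" by (rule small[OF R2m R2z m])
  have "dual_bound (a + a + a) (\<lambda>x. F x - R1 n x - R2 m x)"
    using a(1) dual_bound_diff[OF dual_bound_diff[OF a(2) decomposable_dual_bound[OF d1 R1m]] decomposable_dual_bound[OF d2 R2m]]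
    by simp
  moreover have "(\<lambda>x. F x - R1 n x - R2 m x) = G m" by (auto simp: R1_def R2_def)
  ultimately have "dual_bound (3 * a) (G m)" by simp
  moreover have "grid_fun (Suc m) k (G m)"
  proof -
    have "grid_proj (Suc m) (grid_proj (Suc m) x) = grid_proj (Suc m) x" for x :: "(real, 'n) vec"
      by (simp add: vec_eq_iff del: of_nat_Suc)
    then show ?thesis
      using hbox_grid_proj[of "Suc m" _ k] Gm by (auto simp: grid_fun_def G_def indicator_def)
  qed
  moreover have "\<bar>G m x\<bar> \<le> M" for x using \<phi>b[of n] M0 by (auto simp: G_def indicator_def)
  ultimately have "decomposable (4 * 3 powr \<theta> * (3 * a)) (G m)"
    using k a(1) by (intro grid_decomposable[where m = "Suc m" and k = k and M = M]) simp_all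
  from decomposable_add[OF decomposable_add[OF d1 d2] this]
  have "decomposable (a + a + 4 * 3 powr \<theta> * (3 * a)) (\<lambda>x. R1 n x + R2 m x + G m x)" .
  moreover have "(\<lambda>x. R1 n x + R2 m x + G m x) = F" by (auto simp: R1_def R2_def)
  ultimately show ?thesis by (simp add: algebra_simps)
qed

text \<open>F is cut into bounded layers of bounded support with dual bounds A 2^(-j). They are
  decomposed separately, and the geometric series gives the outer factor 2.\<close>

theorem dual_bound_decomposable:
  assumes F: "dual_bound A F" and A: "0 < A"
  shows "decomposable (2 * (2 + 12 * 3 powr \<theta>) * A) F"
proof -
  have Fm [measurable]: "F \<in> borel_measurable borel" using F by (simp add: dual_bound_def)
  define D where "D n = {x. real n < \<bar>F x\<bar> \<or> x \<notin> hbox n}" for n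
  have Dm [measurable]: "D n \<in> sets borel" for n unfolding D_def by measurable
  have D_mono: "D l \<subseteq> D k" if "k \<le> l" for k l
    using hbox_mono[OF that] that unfolding D_def by (auto intro: order.strict_trans1[of "real k" "real l"])
  have D_ev: "\<exists>n. \<forall>l\<ge>n. x \<notin> D l" for x
  proof -
    obtain k :: nat where k: "\<bar>F x\<bar> + norm x < real k" using reals_Archimedean2 by blast
    have "\<bar>x $ i\<bar> < real k" for i using component_le_norm_cart[of x i] k by simp
    then have "- real k \<le> x $ i" "x $ i < real k" for i by (meson abs_less_iff less_imp_le minus_less_iff)+
    then have "x \<in> hbox k" by (simp add: hbox_def)
    moreover have "\<bar>F x\<bar> \<le> real k" using k norm_ge_zero[of x] by linarith
    ultimately have "x \<notin> D k" by (simp add: D_def)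
    then show ?thesis using D_mono by blast
  qed
  have "\<forall>j. \<exists>k. dual_bound (A * (1 / 2) ^ j) (\<lambda>x. indicator (D k) x * F x)"
  proof
    fix j
    have "(\<Inter>k. D k) = {}" using D_ev by blast
    then show "\<exists>k. dual_bound (A * (1 / 2) ^ j) (\<lambda>x. indicator (D k) x * F x)"
      using F A D_mono by (intro dual_bound_order_continuous) auto
  qed
  then obtain \<kappa> where \<kappa>: "\<forall>j. dual_bound (A * (1 / 2) ^ j) (\<lambda>x. indicator (D (\<kappa> j)) x * F x)"
    unfolding choice_iff by (elim exE)
  \<comment> \<open>Strictly increasing, so that the layers exhaust F, and dominating \<kappa>, so
    that the remainders are small. It starts at 0 because \<open>D 0\<close> is the whole space,
    \<open>hbox 0\<close> being empty; thus no part of F is lost.\<close>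
  define n where "n = rec_nat 0 (\<lambda>j l. max (Suc l) (\<kappa> (Suc j)))"
  have n_Suc: "n (Suc j) = max (Suc (n j)) (\<kappa> (Suc j))" and n0: "n 0 = 0" for j by (simp_all add: n_def)
  have n_ge: "j \<le> n j" for j by (induction j) (auto simp: n0 n_Suc)
  have nb: "dual_bound (A * (1 / 2) ^ j) (\<lambda>x. indicator (D (n j)) x * F x)" for j
  proof (cases j)
    case 0
    show ?thesis by (rule dual_bound_mono[OF F]) (auto simp: 0 indicator_def)
  next
    case (Suc i)
    then have "D (n j) \<subseteq> D (\<kappa> j)" by (intro D_mono) (simp add: n_Suc)
    then show ?thesis by (intro dual_bound_mono[OF \<kappa>[rule_format, of j]]) (auto simp: indicator_def)
  qed
  define C where "C = 2 + 12 * 3 powr \<theta>"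
  define P where "P j x = F x * (indicator (D (n j)) x - indicator (D (n (Suc j))) x)" for j x
  have Pm [measurable]: "P j \<in> borel_measurable borel" for j unfolding P_def[abs_def] by measurable
  have sub: "D (n (Suc j)) \<subseteq> D (n j)" for j by (intro D_mono) (simp add: n_Suc)
  have P: "decomposable (C * (A * (1 / 2) ^ j)) (P j)" for j
    unfolding C_def
  proof (rule bounded_decomposable[where M = "real (n (Suc j))" and k = "n (Suc j)"])
    show "\<bar>P j x\<bar> \<le> real (n (Suc j))" for x
      using sub[of j] by (auto simp: P_def indicator_def D_def not_less)
    show "P j x = 0" if "x \<notin> hbox (n (Suc j))" for x
      using that sub[of j] by (auto simp: P_def indicator_def D_def)
    show "dual_bound (A * (1 / 2) ^ j) (P j)"
      by (rule dual_bound_mono[OF nb[of j]]) (use sub[of j] in \<open>auto simp: P_def indicator_def\<close>)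
  qed (use A in \<open>auto simp: n_Suc\<close>)
  have s: "(\<lambda>j. C * (A * (1 / 2) ^ j)) sums (C * (A * 2))"
    using geometric_sums[of "1 / 2 :: real"] by (intro sums_mult) auto
  have "(\<lambda>j. P j x) sums F x" for x
  proof -
    obtain m where m: "\<And>l. m \<le> l \<Longrightarrow> x \<notin> D l" using D_ev by blast
    have "indicator (D (n j)) x = (0 :: real)" if "m \<le> j" for j
      using m[of "n j"] n_ge[of j] that by simp
    then have "(\<lambda>j. indicator (D (n j)) x) \<longlonglongrightarrow> (0 :: real)"
      by (intro tendsto_eventually) (auto simp: eventually_sequentially)
    then have "(\<lambda>j. indicator (D (n j)) x - indicator (D (n (Suc j))) x) sums (indicator (D (n 0)) x - (0 :: real))"
      by (rule telescope_sums')
    then have "(\<lambda>j. P j x) sums (F x * (indicator (D (n 0)) x - 0))"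
      unfolding P_def by (rule sums_mult)
    moreover have "x \<in> D (n 0)"
      by (simp add: n0 D_def hbox_def)
    ultimately show ?thesis by simp
  qed
  then have "decomposable (\<Sum>j. C * (A * (1 / 2) ^ j)) F"
    using s by (intro decomposable_countable_sum[OF P]) (auto simp: sums_iff)
  then show ?thesis using s by (simp add: sums_iff C_def algebra_simps)
qed

end

section \<open>The Riesz kernel\<close>

lemma nn_integral_lborel_shift:
  fixes f :: "'a::euclidean_space \<Rightarrow> ennreal"
  assumes [measurable]: "f \<in> borel_measurable borel"
  shows "(\<integral>\<^sup>+ x. f (c + x) \<partial>lborel) = (\<integral>\<^sup>+ x. f x \<partial>lborel)"
proof -
  have "(\<integral>\<^sup>+ x. f x \<partial>lborel) = (\<integral>\<^sup>+ x. f x \<partial>distr lborel borel ((+) c))"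
    by (simp add: lborel_distr_plus)
  then show ?thesis by (simp add: nn_integral_distr)
qed

lemma cball_subset_cube: "cball 0 \<rho> \<subseteq> cube (- (\<rho> *\<^sub>R One) :: real^'n) (2 * \<rho>)"
proof
  fix x :: "real^'n" assume "x \<in> cball 0 \<rho>"
  then have "\<bar>x $ i\<bar> \<le> \<rho>" for i using component_le_norm_cart[of x i] by simp
  then have "- \<rho> \<le> x $ i \<and> x $ i \<le> \<rho>" for i by (meson abs_le_iff minus_le_iff)
  then show "x \<in> cube (- (\<rho> *\<^sub>R One)) (2 * \<rho>)" by (simp add: mem_cube)
qed

lemma emeasure_cball_le:
  assumes "0 < \<rho>"
  shows "emeasure lborel (cball (0 :: real^'n) \<rho>) \<le> ennreal ((2 * \<rho>) ^ CARD('n))"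
proof -
  have "emeasure lborel (cball (0 :: real^'n) \<rho>) \<le> emeasure lborel (cube (- (\<rho> *\<^sub>R One) :: real^'n) (2 * \<rho>))"
    by (intro emeasure_mono cball_subset_cube) (simp add: cube_measurable)
  also have "\<dots> = ennreal (measure lebesgue (cube (- (\<rho> *\<^sub>R One) :: real^'n) (2 * \<rho>)))"
  proof -
    have "emeasure lborel (cube (- (\<rho> *\<^sub>R One) :: real^'n) (2 * \<rho>)) \<noteq> top"
      unfolding cube_def using emeasure_lborel_cbox_finite by (simp add: less_top)
    then show ?thesis
      by (subst emeasure_eq_ennreal_measure) (simp_all add: measure_completion cube_measurable)
  qed
  also have "\<dots> = ennreal ((2 * \<rho>) ^ CARD('n))"
    using assms by (subst measure_cube) auto
  finally show ?thesis .
qed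

text \<open>As in \<open>comm_riesz\<close>, division by 0 gives the kernel the value 0 at the
  origin.\<close>

definition riesz :: "real \<Rightarrow> real^'n \<Rightarrow> real" where
  "riesz \<alpha> z = 1 / norm z powr (real CARD('n) - \<alpha>)"

lemma riesz_nonneg [simp]: "0 \<le> riesz \<alpha> z"
  by (simp add: riesz_def)

lemma riesz_measurable [measurable]: "riesz \<alpha> \<in> borel_measurable borel"
  unfolding riesz_def[abs_def] by measurable

lemma riesz_minus: "riesz \<alpha> (x - y) = riesz \<alpha> (y - x)"
  by (simp add: riesz_def norm_minus_commute)

lemma riesz_le:
  assumes "\<alpha> < real CARD('n)" "0 < d" "d \<le> norm (z :: real^'n)"
  shows "riesz \<alpha> z \<le> 1 / d powr (real CARD('n) - \<alpha>)"
  unfolding riesz_def using assms by (intro frac_le powr_mono2) auto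

lemma riesz_ge:
  assumes "\<alpha> < real CARD('n)" "0 < norm z" "norm (z :: real^'n) \<le> d"
  shows "1 / d powr (real CARD('n) - \<alpha>) \<le> riesz \<alpha> z"
  unfolding riesz_def using assms by (intro frac_le powr_mono2) auto

text \<open>On the dyadic shell between \<open>\<rho> (Suc j)\<close> and \<open>\<rho> j\<close>
  the kernel is at most c j, and c j times the volume bound for the ball is
  \<open>C * q ^ j\<close>. Positivity of \<alpha> makes \<open>q = (1 / 2) powr \<alpha>\<close>
  smaller than 1.\<close>

lemma riesz_locally_integrable:
  assumes \<alpha>: "0 < \<alpha>" "\<alpha> < real CARD('n)"
  shows "(\<integral>\<^sup>+ z. ennreal (riesz \<alpha> (z :: real^'n)) * indicator (cball 0 R) z \<partial>lborel) < \<infinity>"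
proof (cases "0 < R")
  case False
  have "(\<integral>\<^sup>+ z. ennreal (riesz \<alpha> (z :: real^'n)) * indicator (cball 0 R) z \<partial>lborel) = (\<integral>\<^sup>+ (z :: real^'n). 0 \<partial>lborel)"
    using False \<alpha> by (intro nn_integral_cong) (auto simp: indicator_def riesz_def dest: less_le_trans[OF zero_less_norm_iff[THEN iffD2]])
  then show ?thesis by simp
next
  case R: True
  define s where "s = real CARD('n) - \<alpha>"
  have s: "0 < s" using \<alpha> by (simp add: s_def)
  define \<rho> where "\<rho> j = R * (1 / 2) ^ j" for j :: nat
  have \<rho>: "0 < \<rho> j" for j using R by (simp add: \<rho>_def)
  define c where "c j = 1 / \<rho> (Suc j) powr s" for j
  have c: "0 \<le> c j" for j by (simp add: c_def)
  have pt: "ennreal (riesz \<alpha> z) * indicator (cball 0 R) z \<le> (\<Sum>j. ennreal (c j) * indicator (cball 0 (\<rho> j)) z)" for z :: "real^'n"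
  proof (cases "z \<noteq> 0 \<and> norm z \<le> R")
    case True
    have "\<rho> \<longlonglongrightarrow> R * 0" unfolding \<rho>_def by (intro tendsto_mult tendsto_const LIMSEQ_power_zero) auto
    then have "\<forall>\<^sub>F j in sequentially. \<rho> j < norm z"
      by (rule order_tendstoD) (use True in simp)
    then obtain m where "\<rho> m < norm z" using eventually_happens[of _ sequentially] by auto
    moreover have "\<not> \<rho> 0 < norm z" using True by (simp add: \<rho>_def)
    ultimately obtain j where j: "\<not> \<rho> j < norm z" "\<rho> (Suc j) < norm z"
      using ex_least_nat_less[of "\<lambda>m. \<rho> m < norm z" m] by blast
    have "riesz \<alpha> z \<le> c j" unfolding c_def s_def using \<alpha> \<rho>[of "Suc j"] j by (intro riesz_le) auto
    then have "ennreal (riesz \<alpha> z) * indicator (cball 0 R) z \<le> ennreal (c j) * indicator (cball 0 (\<rho> j)) z"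
      using True j by (simp add: ennreal_leI)
    also have "\<dots> \<le> (\<Sum>j. ennreal (c j) * indicator (cball 0 (\<rho> j)) z)"
    proof -
      define f where "f i = ennreal (c i) * indicator (cball 0 (\<rho> i)) z" for i
      have "sum f {j} \<le> suminf f" by (rule sum_le_suminf) auto
      then have "f j \<le> suminf f" by simp
      then show ?thesis unfolding f_def[abs_def] .
    qed
    finally show ?thesis .
  next
    case False
    then show ?thesis using \<alpha> by (auto simp: riesz_def)
  qed
  define C where "C = 1 / (R / 2) powr s * (2 * R) powr real CARD('n)"
  define q where "q = (1 / 2 :: real) powr \<alpha>"
  have q: "0 \<le> q" "q < 1" using \<alpha> powr_less_mono2[of \<alpha> "1/2" 1] by (auto simp: q_def)
  have cq: "c j * (2 * \<rho> j) ^ CARD('n) = C * q ^ j" for j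
  proof -
    have "q ^ j = ((1 / 2 :: real) ^ j) powr \<alpha>" by (simp add: q_def powr_power powr_powr mult.commute flip: powr_realpow)
    moreover have "\<rho> (Suc j) powr s = (R / 2) powr s * ((1 / 2) ^ j) powr s"
      using R by (simp add: \<rho>_def flip: powr_mult)
    moreover have "(2 * \<rho> j) ^ CARD('n) = (2 * R) powr real CARD('n) * ((1 / 2 :: real) ^ j) powr real CARD('n)"
      using R by (simp add: \<rho>_def mult.assoc flip: powr_mult powr_realpow)
    moreover have "((1 / 2 :: real) ^ j) powr real CARD('n) = ((1 / 2) ^ j) powr s * ((1 / 2) ^ j) powr \<alpha>"
      by (simp add: s_def flip: powr_add)
    ultimately show ?thesis by (simp add: c_def C_def)
  qed
  have "(\<integral>\<^sup>+ z. ennreal (riesz \<alpha> (z :: real^'n)) * indicator (cball 0 R) z \<partial>lborel)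
     \<le> (\<integral>\<^sup>+ (z :: real^'n). (\<Sum>j. ennreal (c j) * indicator (cball 0 (\<rho> j)) z) \<partial>lborel)"
    by (intro nn_integral_mono pt)
  also have "\<dots> = (\<Sum>j. ennreal (c j) * emeasure lborel (cball (0 :: real^'n) (\<rho> j)))"
    by (subst nn_integral_suminf) (auto simp: nn_integral_cmult_indicator intro!: borel_measurable_times_ennreal borel_measurable_indicator)
  also have "\<dots> \<le> (\<Sum>j. ennreal (c j) * ennreal ((2 * \<rho> j) ^ CARD('n)))"
    by (intro suminf_le mult_left_mono emeasure_cball_le \<rho>) auto
  also have "\<dots> = (\<Sum>j. ennreal (C * q ^ j))"
    using c \<rho> by (simp add: less_imp_le flip: ennreal_mult cq)
  also have "\<dots> = ennreal (\<Sum>j. C * q ^ j)"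
    using q by (intro suminf_ennreal2) (auto simp: C_def intro!: summable_mult summable_geometric)
  also have "\<dots> < \<infinity>" by simp
  finally show ?thesis .
qed

text \<open>By homogeneity the quotient of the two kernel values is a power of
  \<open>norm (y - x) / norm y\<close>, which tends to 1 uniformly for x in a ball as y goes to
  infinity.\<close>

lemma riesz_asymptotic:
  assumes "0 < \<epsilon>"
  shows "\<exists>R. \<rho> < R \<and> 0 < R \<and> (\<forall>x y :: real^'n. norm x \<le> \<rho> \<longrightarrow> R \<le> norm y \<longrightarrow>
    \<bar>riesz \<alpha> (y - x) - riesz \<alpha> y\<bar> \<le> \<epsilon> * riesz \<alpha> y)"
proof -
  define s where "s = real CARD('n) - \<alpha>"
  have "((\<lambda>t::real. t powr - s) \<longlongrightarrow> 1 powr - s) (nhds 1)"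
    by (intro tendsto_powr filterlim_ident tendsto_const) auto
  then have "\<forall>\<^sub>F t in nhds (1::real). dist (t powr - s) (1 powr - s) < \<epsilon>"
    using assms by (rule tendstoD)
  then obtain \<eta> where \<eta>: "0 < \<eta>" "\<And>t::real. dist t 1 < \<eta> \<Longrightarrow> \<bar>t powr - s - 1\<bar> < \<epsilon>"
    by (auto simp: eventually_nhds_metric dist_real_def)
  \<comment> \<open>The last entry forces norm x / norm y below \<eta>.\<close>
  define R where "R = max (\<rho> + 1) (max 1 (\<rho> / \<eta> + 1))"
  have "\<bar>riesz \<alpha> (y - x) - riesz \<alpha> y\<bar> \<le> \<epsilon> * riesz \<alpha> y" if x: "norm x \<le> \<rho>" and y: "R \<le> norm y" for x y :: "real^'n"
  proof -
    have ny: "0 < norm y" "\<rho> / \<eta> < norm y" using y by (auto simp: R_def)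
    define t where "t = norm (y - x) / norm y"
    have "\<bar>norm (y - x) - norm y\<bar> \<le> norm x"
      using norm_triangle_ineq3[of "y - x" y] by simp
    moreover have "t - 1 = (norm (y - x) - norm y) / norm y"
      using ny by (simp add: t_def diff_divide_distrib)
    ultimately have "dist t 1 \<le> norm x / norm y"
      using ny by (simp add: dist_real_def divide_right_mono)
    also have "\<dots> < \<eta>" using ny \<eta> x by (simp add: field_simps)
    finally have "\<bar>t powr - s - 1\<bar> < \<epsilon>" by (rule \<eta>)
    moreover have "riesz \<alpha> (y - x) = riesz \<alpha> y * t powr - s"
      using ny by (simp add: riesz_def t_def powr_divide powr_minus field_simps flip: s_def)
    moreover have "riesz \<alpha> y * t powr - s - riesz \<alpha> y = riesz \<alpha> y * (t powr - s - 1)"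
      by (simp add: algebra_simps)
    ultimately have "\<bar>riesz \<alpha> (y - x) - riesz \<alpha> y\<bar> = riesz \<alpha> y * \<bar>t powr - s - 1\<bar>" "\<bar>t powr - s - 1\<bar> < \<epsilon>"
      by (simp_all only: abs_mult abs_of_nonneg[OF riesz_nonneg])
    then show ?thesis by (simp add: mult.commute[of \<epsilon>] mult_left_mono)
  qed
  then show ?thesis by (intro exI[of _ R]) (auto simp: R_def)
qed

section \<open>Translation invariance, and Borel representatives of blocks\<close>

lemma sec_norm_shift:
  fixes F :: "real^'n \<Rightarrow> ennreal"
  assumes [measurable]: "F \<in> borel_measurable borel"
  shows "sec_norm i r (\<lambda>x. F (x + z)) x = sec_norm i r F (x + z)"
proof -
  have "coord_upd x i t + z = coord_upd (x + z) i (z $ i + t)" for t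
    by (auto simp: vec_eq_iff)
  then have "(\<integral>\<^sup>+ t. epow (F (coord_upd x i t + z)) r \<partial>lborel) = (\<integral>\<^sup>+ t. epow (F (coord_upd (x + z) i (z $ i + t))) r \<partial>lborel)"
    by simp
  also have "\<dots> = (\<integral>\<^sup>+ t. epow (F (coord_upd (x + z) i t)) r \<partial>lborel)"
    by (rule nn_integral_lborel_shift) measurable
  finally show ?thesis by (simp add: sec_norm_def)
qed

lemma mixed_iter_shift:
  fixes F :: "real^'n \<Rightarrow> ennreal"
  assumes "F \<in> borel_measurable borel"
  shows "mixed_iter (\<lambda>x. F (x + z)) L x = mixed_iter F L (x + z)"
  using assms
proof (induction L arbitrary: F)
  case (Cons b L)
  obtain i r where b: "b = (i, r)" by force
  have "sec_norm i r (\<lambda>x. F (x + z)) = (\<lambda>x. sec_norm i r F (x + z))"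
    using sec_norm_shift[OF Cons.prems] by blast
  then show ?case
    unfolding b mixed_iter_Cons by (simp only:) (intro Cons.IH borel_measurable_sec_norm Cons.prems)
qed simp

lemma mixed_norm_shift:
  fixes f :: "real^('n::{finite,linorder}) \<Rightarrow> real"
  assumes [measurable]: "f \<in> borel_measurable borel"
  shows "mixed_norm r (\<lambda>x. f (x + z)) = mixed_norm r f"
proof -
  have "mixed_norm r (\<lambda>x. f (x + z)) = mixed_iter (\<lambda>x. ennreal \<bar>f x\<bar>) (map (\<lambda>i. (i, r $ i)) coords) (0 + z)"
    unfolding mixed_norm_def by (rule mixed_iter_shift) measurable
  also have "\<dots> = mixed_norm r f"
    unfolding mixed_norm_def by (rule mixed_iter_full) (simp add: image_image)
  finally show ?thesis .
qed

context morrey_block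
begin

text \<open>Translates keep the normalization. This lets an integral against the Riesz kernel be
  estimated one translate at a time.\<close>

lemma is_block_shift:
  assumes "is_block r0 r B" "B \<in> borel_measurable borel"
  shows "is_block r0 r (\<lambda>x. B (x + z))"
proof -
  note [measurable] = assms(2)
  obtain a h where h: "h > 0" and B: "\<And>x. x \<notin> cube a h \<Longrightarrow> B x = 0" "mixed_norm (conj_vec r) B \<le> ennreal (h powr - \<theta>)"
    using assms(1) by (auto simp: is_block_iff)
  have "B (x + z) = 0" if "x \<notin> cube (a - z) h" for x
    using that by (intro B) (auto simp: mem_cube algebra_simps)
  moreover have "(\<lambda>x. B (x + z)) \<in> borel_measurable lebesgue"
    by (intro borel_imp_lebesgue) measurable
  ultimately show ?thesis
    unfolding is_block_iff using h B mixed_norm_shift[OF assms(2)] by auto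
qed

lemma block_borel_AE_eq:
  assumes "is_block r0 r B"
  obtains B' where "is_block r0 r B'" "B' \<in> borel_measurable borel" "AE x in lebesgue. B x = B' x"
proof -
  obtain a h where h: "h > 0" and B: "\<And>x. x \<notin> cube a h \<Longrightarrow> B x = 0" "mixed_norm (conj_vec r) B \<le> ennreal (h powr - \<theta>)"
    using assms by (auto simp: is_block_iff)
  obtain B0 where B0 [measurable]: "B0 \<in> borel_measurable borel" and e: "AE x in lebesgue. B x = B0 x"
    using block_measurable[OF assms] by (rule lebesgue_borel_AE_eq)
  \<comment> \<open>\<open>B0\<close> agrees with B only almost everywhere and may be nonzero off
    the cube; the indicator restores the support.\<close>
  define B' where "B' x = indicator (cube a h) x * B0 x" for x
  have B'm [measurable]: "B' \<in> borel_measurable borel"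
    unfolding B'_def[abs_def] using cube_measurable by measurable
  have e': "AE x in lebesgue. B x = B' x"
    using e by eventually_elim (use B(1) in \<open>auto simp: B'_def indicator_def\<close>)
  have "mixed_norm (conj_vec r) B' \<le> ennreal (h powr - \<theta>)"
    using B(2) mixed_norm_cong_AE[OF e'] by simp
  moreover have "\<forall>x. x \<notin> cube a h \<longrightarrow> B' x = 0" by (simp add: B'_def)
  ultimately have "is_block r0 r B'"
    unfolding is_block_iff using h borel_imp_lebesgue[OF B'm] by blast
  then show thesis using B'm e' by (rule that)
qed

lemma decomposable_nn_integral_borel_le:
  assumes "decomposable c F" and h [measurable]: "h \<in> borel_measurable borel"
    and le: "\<And>B. is_block r0 r B \<Longrightarrow> B \<in> borel_measurable borel \<Longrightarrow> (\<integral>\<^sup>+ x. ennreal \<bar>B x\<bar> * h x \<partial>lborel) \<le> C"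
  shows "(\<integral>\<^sup>+ x. ennreal \<bar>F x\<bar> * h x \<partial>lebesgue) \<le> ennreal c * C"
proof (rule decomposable_nn_integral_le[OF assms(1)])
  show "h \<in> borel_measurable lebesgue" using h by (simp add: measurable_completion)
  fix B assume "is_block r0 r B"
  then obtain B' where B': "is_block r0 r B'" and [measurable]: "B' \<in> borel_measurable borel" and e: "AE x in lebesgue. B x = B' x"
    by (rule block_borel_AE_eq)
  have "(\<integral>\<^sup>+ x. ennreal \<bar>B x\<bar> * h x \<partial>lebesgue) = (\<integral>\<^sup>+ x. ennreal \<bar>B' x\<bar> * h x \<partial>lebesgue)"
    using e by (intro nn_integral_cong_AE) (auto elim: eventually_mono)
  also have "\<dots> = (\<integral>\<^sup>+ x. ennreal \<bar>B' x\<bar> * h x \<partial>lborel)" by (rule nn_integral_completion)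
  also have "\<dots> \<le> C" by (intro le B') measurable
  finally show "(\<integral>\<^sup>+ x. ennreal \<bar>B x\<bar> * h x \<partial>lebesgue) \<le> C" .
qed

lemma morrey_norm_cong_AE:
  assumes "AE x in lebesgue. f x = g x"
  shows "morrey_norm r0 r f = morrey_norm r0 r g"
proof -
  have "mixed_norm r (\<lambda>x. indicator Q x * f x) = mixed_norm r (\<lambda>x. indicator Q x * g x)" for Q
    using assms by (intro mixed_norm_cong_AE) (auto elim: eventually_mono)
  then show ?thesis by (simp add: morrey_norm_def)
qed

lemma morrey_norm_cball_finite:
  assumes "\<And>x. \<bar>f x\<bar> \<le> c" "\<And>x. x \<notin> cball 0 \<rho> \<Longrightarrow> f x = 0"
  shows "morrey_norm r0 r f < \<infinity>"
proof -
  have "morrey_norm r0 r f \<le> ennreal (c * (2 * (\<bar>\<rho>\<bar> + 1)) powr (real CARD('n) / r0))"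
  proof (rule morrey_norm_bounded_le[where a = "- ((\<bar>\<rho>\<bar> + 1) *\<^sub>R One)"])
    fix x :: "(real, 'n) vec" assume "x \<notin> cube (- ((\<bar>\<rho>\<bar> + 1) *\<^sub>R One)) (2 * (\<bar>\<rho>\<bar> + 1))"
    then have "x \<notin> cball 0 (\<bar>\<rho>\<bar> + 1)" using cball_subset_cube by blast
    then show "f x = 0" using assms(2)[of x] by auto
  qed (use assms(1) in auto)
  also have "\<dots> < \<infinity>" by simp
  finally show ?thesis .
qed

end

section \<open>The commutator\<close>

lemma cball_measurable [measurable]: "cball c R \<in> sets borel"
  by simp

text \<open>\<beta> is a Borel representative of b, and \<open>bounded\<close> is the hypothesis on
  the commutator rewritten for it over \<open>lborel\<close>, where Tonelli and translations apply
  directly.\<close>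

locale commutator =
  P: morrey_block p0 p + Q: morrey_block q0 q
  for p0 q0 :: real and p q :: "real^('n::{finite,linorder})" +
  fixes \<alpha> :: real and \<beta> :: "(real, 'n) vec \<Rightarrow> real" and C0 :: real
  assumes \<alpha>: "0 < \<alpha>" "\<alpha> < real CARD('n)"
    and \<beta>_borel [measurable]: "\<beta> \<in> borel_measurable borel"
    and \<beta>_loc: "\<And>\<rho>. (\<integral>\<^sup>+ x. ennreal \<bar>\<beta> x\<bar> * indicator (cball 0 \<rho>) x \<partial>lborel) < \<infinity>"
    and C0: "0 \<le> C0"
    and bounded: "\<And>f. f \<in> borel_measurable borel \<Longrightarrow> morrey_norm p0 p f < \<infinity> \<Longrightarrow>
      morrey_norm q0 q (\<lambda>x. \<integral>y. (\<beta> x - \<beta> y) * f y * riesz \<alpha> (x - y) \<partial>lborel) \<le> ennreal C0 * morrey_norm p0 p f"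
begin

definition T :: "((real, 'n) vec \<Rightarrow> real) \<Rightarrow> (real, 'n) vec \<Rightarrow> real" where
  "T f x = (\<integral>y. (\<beta> x - \<beta> y) * f y * riesz \<alpha> (x - y) \<partial>lborel)"

text \<open>The integral of \<open>\<bar>f y\<bar> * S \<rho> y\<close> is the absolute double
  integral behind the pairing of \<open>T f\<close> with the indicator of a ball. Its finiteness
  justifies the exchange of integrals in \<open>T_dual\<close>.\<close>

definition S :: "real \<Rightarrow> (real, 'n) vec \<Rightarrow> ennreal" where
  "S \<rho> y = (\<integral>\<^sup>+ x. ennreal \<bar>(\<beta> y - \<beta> x) * riesz \<alpha> (y - x)\<bar> * indicator (cball 0 \<rho>) x \<partial>lborel)"

lemma T_measurable [measurable]:
  assumes [measurable]: "f \<in> borel_measurable borel"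
  shows "T f \<in> borel_measurable borel"
proof -
  have "(\<lambda>z. (\<beta> (fst z) - \<beta> (snd z)) * f (snd z) * riesz \<alpha> (fst z - snd z)) \<in> borel_measurable (borel \<Otimes>\<^sub>M lborel)"
    by measurable
  then have "(\<lambda>x. \<integral>y. (\<beta> x - \<beta> y) * f y * riesz \<alpha> (x - y) \<partial>lborel) \<in> borel_measurable borel"
    by (intro lborel.borel_measurable_lebesgue_integral) (simp add: case_prod_beta')
  then show ?thesis unfolding T_def[abs_def] .
qed

lemma S_measurable [measurable]: "S \<rho> \<in> borel_measurable borel"
proof -
  have "(\<lambda>z. ennreal \<bar>(\<beta> (fst z) - \<beta> (snd z)) * riesz \<alpha> (fst z - snd z)\<bar> * indicator (cball 0 \<rho>) (snd z)) \<in> borel_measurable (borel \<Otimes>\<^sub>M lborel)"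
    by measurable
  then have "(\<lambda>y. \<integral>\<^sup>+ x. ennreal \<bar>(\<beta> y - \<beta> x) * riesz \<alpha> (y - x)\<bar> * indicator (cball 0 \<rho>) x \<partial>lborel) \<in> borel_measurable borel"
    by (intro lborel.borel_measurable_nn_integral) (simp add: case_prod_beta')
  then show ?thesis unfolding S_def[abs_def] .
qed

text \<open>This is how the boundedness hypothesis enters the a priori bounds: the image of a Morrey
  function pairs with all blocks uniformly.\<close>

lemma T_pairing:
  assumes B: "is_block q0 q B" "B \<in> borel_measurable borel" and f: "f \<in> borel_measurable borel" "morrey_norm p0 p f < \<infinity>"
  shows "(\<integral>\<^sup>+ y. ennreal \<bar>B y\<bar> * ennreal \<bar>T f y\<bar> \<partial>lborel) \<le> ennreal C0 * morrey_norm p0 p f"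
proof -
  note [measurable] = B(2) f(1)
  have "(\<integral>\<^sup>+ y. ennreal \<bar>B y\<bar> * ennreal \<bar>T f y\<bar> \<partial>lborel) = (\<integral>\<^sup>+ y. ennreal \<bar>B y * T f y\<bar> \<partial>lebesgue)"
    by (subst nn_integral_completion) (simp add: abs_mult ennreal_mult)
  also have "\<dots> \<le> morrey_norm q0 q (T f)"
    by (intro Q.block_pairing B Q.borel_imp_lebesgue) measurable
  also have "\<dots> \<le> ennreal C0 * morrey_norm p0 p f"
    using bounded[OF f] by (simp add: T_def[abs_def])
  finally show ?thesis .
qed

section \<open>Integrability of beta against all blocks\<close>

lemma block_cball_bound:
  obtains C where "0 \<le> C" "\<And>B. is_block q0 q B \<Longrightarrow> B \<in> borel_measurable borel \<Longrightarrow>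
    (\<integral>\<^sup>+ y. ennreal \<bar>B y\<bar> * indicator (cball 0 R) y \<partial>lborel) \<le> ennreal C"
proof -
  have fin: "morrey_norm q0 q (indicator (cball 0 R) :: (real, 'n) vec \<Rightarrow> real) < \<infinity>"
    by (rule Q.morrey_norm_cball_finite[where c = 1 and \<rho> = R]) (auto simp: indicator_def)
  then obtain C where C: "0 \<le> C" "morrey_norm q0 q (indicator (cball 0 R) :: (real, 'n) vec \<Rightarrow> real) = ennreal C"
    by (cases "morrey_norm q0 q (indicator (cball 0 R) :: (real, 'n) vec \<Rightarrow> real)") auto
  have "(\<integral>\<^sup>+ y. ennreal \<bar>B y\<bar> * indicator (cball 0 R) y \<partial>lborel) \<le> ennreal C"
    if B: "is_block q0 q B" "B \<in> borel_measurable borel" for B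
  proof -
    note [measurable] = B(2)
    have "(\<integral>\<^sup>+ y. ennreal \<bar>B y\<bar> * indicator (cball 0 R) y \<partial>lborel) = (\<integral>\<^sup>+ y. ennreal \<bar>B y * indicator (cball 0 R) y\<bar> \<partial>lebesgue)"
      by (subst nn_integral_completion) (auto intro!: nn_integral_cong simp: indicator_def)
    also have "\<dots> \<le> ennreal C"
      unfolding C(2)[symmetric] by (intro Q.block_pairing B Q.borel_imp_lebesgue) measurable
    finally show ?thesis .
  qed
  with C(1) show thesis by (rule that)
qed

lemma integrable_\<beta>_cball:
  assumes [measurable]: "f \<in> borel_measurable borel" and "\<And>x. \<bar>f x\<bar> \<le> c" "\<And>x. x \<notin> cball 0 \<rho> \<Longrightarrow> f x = 0"
  shows "integrable lborel f" "integrable lborel (\<lambda>x. \<beta> x * f x)"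
proof -
  have c: "0 \<le> c" using order_trans[OF abs_ge_zero assms(2)[of 0]] .
  show "integrable lborel f"
    by (rule integrableI_bounded_set[where A = "cball 0 \<rho>" and B = c])
      (use assms emeasure_lborel_cball_finite[of 0 \<rho>] in auto)
  show "integrable lborel (\<lambda>x. \<beta> x * f x)"
    unfolding integrable_iff_bounded
  proof
    have "(\<integral>\<^sup>+ x. ennreal (norm (\<beta> x * f x)) \<partial>lborel) \<le> (\<integral>\<^sup>+ x. ennreal c * (ennreal \<bar>\<beta> x\<bar> * indicator (cball 0 \<rho>) x) \<partial>lborel)"
    proof (intro nn_integral_mono)
      fix x
      show "ennreal (norm (\<beta> x * f x)) \<le> ennreal c * (ennreal \<bar>\<beta> x\<bar> * indicator (cball 0 \<rho>) x)"
      proof (cases "x \<in> cball 0 \<rho>")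
        case True
        have "\<bar>\<beta> x\<bar> * \<bar>f x\<bar> \<le> c * \<bar>\<beta> x\<bar>"
          using mult_right_mono[OF assms(2)[of x] abs_ge_zero[of "\<beta> x"]] by (simp add: mult.commute)
        then show ?thesis using True c by (simp add: abs_mult ennreal_leI flip: ennreal_mult)
      qed (use assms(3) in auto)
    qed
    also have "\<dots> = ennreal c * (\<integral>\<^sup>+ x. ennreal \<bar>\<beta> x\<bar> * indicator (cball 0 \<rho>) x \<partial>lborel)"
      by (intro nn_integral_cmult) measurable
    also have "\<dots> < \<infinity>" using \<beta>_loc[of \<rho>] by (simp add: ennreal_mult_less_top)
    finally show "(\<integral>\<^sup>+ x. ennreal (norm (\<beta> x * f x)) \<partial>lborel) < \<infinity>" .
  qed measurable
qed

lemma integrable_mult_riesz: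
  fixes f :: "(real, 'n) vec \<Rightarrow> real"
  assumes f: "integrable lborel f" and d: "0 < d" and z: "\<And>x. f x \<noteq> 0 \<Longrightarrow> d \<le> norm (y - x)"
  shows "integrable lborel (\<lambda>x. f x * riesz \<alpha> (y - x))"
proof (rule Bochner_Integration.integrable_bound)
  show "integrable lborel (\<lambda>x. f x * (1 / d powr (real CARD('n) - \<alpha>)))" using f by simp
  have [measurable]: "f \<in> borel_measurable borel" using f by auto
  show "(\<lambda>x. f x * riesz \<alpha> (y - x)) \<in> borel_measurable lborel" by measurable
  show "AE x in lborel. norm (f x * riesz \<alpha> (y - x)) \<le> norm (f x * (1 / d powr (real CARD('n) - \<alpha>)))"
  proof (rule AE_I2)
    fix x
    show "norm (f x * riesz \<alpha> (y - x)) \<le> norm (f x * (1 / d powr (real CARD('n) - \<alpha>)))"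
    proof (cases "f x = 0")
      case False
      then have "riesz \<alpha> (y - x) \<le> 1 / d powr (real CARD('n) - \<alpha>)"
        using \<alpha> d z by (intro riesz_le) auto
      then show ?thesis
        using mult_left_mono[OF _ abs_ge_zero[of "f x"]] by (fastforce simp: abs_mult)
    qed simp
  qed
qed

text \<open>Away from the support of f the kernel is bounded, so the two parts of the commutator
  converge separately.\<close>

lemma T_split:
  assumes f: "f \<in> borel_measurable borel" "\<And>x. \<bar>f x\<bar> \<le> c" "\<And>x. x \<notin> cball 0 \<rho> \<Longrightarrow> f x = 0"
    and d: "0 < d" "\<And>x. f x \<noteq> 0 \<Longrightarrow> d \<le> norm (y - x)"
  shows "T f y = \<beta> y * (\<integral>x. f x * riesz \<alpha> (y - x) \<partial>lborel) - (\<integral>x. \<beta> x * f x * riesz \<alpha> (y - x) \<partial>lborel)"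
proof -
  have 1: "integrable lborel (\<lambda>x. f x * riesz \<alpha> (y - x))"
    using integrable_\<beta>_cball(1)[OF f] d by (rule integrable_mult_riesz)
  have 2: "integrable lborel (\<lambda>x. \<beta> x * f x * riesz \<alpha> (y - x))"
    using integrable_\<beta>_cball(2)[OF f] d(1) by (rule integrable_mult_riesz) (use d(2) in auto)
  have "T f y = (\<integral>x. \<beta> y * (f x * riesz \<alpha> (y - x)) - \<beta> x * f x * riesz \<alpha> (y - x) \<partial>lborel)"
    unfolding T_def by (simp add: algebra_simps)
  also have "\<dots> = \<beta> y * (\<integral>x. f x * riesz \<alpha> (y - x) \<partial>lborel) - (\<integral>x. \<beta> x * f x * riesz \<alpha> (y - x) \<partial>lborel)"
    using 1 2 by (subst Bochner_Integration.integral_diff) auto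
  finally show ?thesis .
qed

text \<open>f is the indicator of a unit ball away from \<open>cball 0 R\<close>. For y in the
  latter, \<open>T f y\<close> is \<beta> y times a number at least \<open>c1 * m\<close>, minus a
  number of absolute value at most c2. So |\<beta>| is dominated there by |T f| plus a constant, and
  \<open>T_pairing\<close> upgrades local integrability to a bound against all blocks.\<close>

lemma \<beta>_block_bound:
  obtains C where "0 \<le> C" "\<And>B. is_block q0 q B \<Longrightarrow> B \<in> borel_measurable borel \<Longrightarrow>
    (\<integral>\<^sup>+ y. ennreal \<bar>B y\<bar> * (ennreal \<bar>\<beta> y\<bar> * indicator (cball 0 R) y) \<partial>lborel) \<le> ennreal C"
proof -
  define R' where "R' = max R 1"
  obtain i :: 'n where True by simp
  \<comment> \<open>With this norm of v every point of the unit ball around v has distance between 1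
    and 2 R' + 3 from every point of the ball of radius R' around 0.\<close>
  define v where "v = (R' + 2) *\<^sub>R axis i (1::real)"
  have v: "norm v = R' + 2" by (simp add: v_def R'_def norm_axis_1)
  define K where "K = cball v 1"
  define f :: "(real, 'n) vec \<Rightarrow> real" where "f = indicator K"
  have fm [measurable]: "f \<in> borel_measurable borel" unfolding f_def K_def by measurable
  have fb: "\<bar>f x\<bar> \<le> 1" for x by (simp add: f_def indicator_def)
  have f0: "f x = 0" if "x \<notin> cball 0 (R' + 3)" for x
  proof -
    have "norm x \<le> norm v + dist v x" using norm_triangle_sub[of x v] by (simp add: dist_norm norm_minus_commute)
    then have "x \<notin> K" using that v by (auto simp: K_def)
    then show ?thesis by (simp add: f_def)
  qed
  define c1 where "c1 = 1 / (2 * R' + 3) powr (real CARD('n) - \<alpha>)"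
  have c1: "0 < c1" by (simp add: c1_def R'_def)
  define m where "m = (\<integral>x. f x \<partial>lborel)"
  define c2 where "c2 = (\<integral>x. \<bar>\<beta> x * f x\<bar> \<partial>lborel)"
  have m: "0 < m"
    unfolding m_def f_def K_def using content_cball_pos[of 1 v] by simp
  have pt: "\<bar>\<beta> y\<bar> * (c1 * m) \<le> \<bar>T f y\<bar> + c2" if y: "norm y \<le> R'" for y
  proof -
    have dd: "1 \<le> norm (y - x) \<and> norm (y - x) \<le> 2 * R' + 3" if "f x \<noteq> 0" for x
    proof -
      have "norm (v - x) \<le> 1" using that by (auto simp: f_def K_def indicator_def dist_norm split: if_splits)
      then have "norm v \<le> norm x + 1" "norm x \<le> norm v + 1"
        using norm_triangle_sub[of v x] norm_triangle_sub[of x v] by (auto simp: norm_minus_commute)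
      then show ?thesis
        using y v norm_triangle_sub[of x y] norm_triangle_ineq4[of y x] by (auto simp: norm_minus_commute)
    qed
    have i1: "integrable lborel (\<lambda>x. f x * riesz \<alpha> (y - x))"
      by (rule integrable_mult_riesz[OF integrable_\<beta>_cball(1)[OF fm fb f0] zero_less_one]) (use dd in auto)
    have i2: "integrable lborel (\<lambda>x. \<beta> x * f x * riesz \<alpha> (y - x))"
      by (rule integrable_mult_riesz[OF integrable_\<beta>_cball(2)[OF fm fb f0] zero_less_one]) (use dd in auto)
    have "c1 * m = (\<integral>x. f x * c1 \<partial>lborel)" by (simp add: m_def)
    also have "\<dots> \<le> (\<integral>x. f x * riesz \<alpha> (y - x) \<partial>lborel)"
    proof (rule integral_mono[OF _ i1])
      show "integrable lborel (\<lambda>x. f x * c1)" using integrable_\<beta>_cball(1)[OF fm fb f0] by simp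
      show "f x * c1 \<le> f x * riesz \<alpha> (y - x)" for x
      proof (cases "f x = 0")
        case False
        then have "0 < norm (y - x)" using dd[of x] by linarith
        then have "c1 \<le> riesz \<alpha> (y - x)" unfolding c1_def using \<alpha> dd[OF False] by (intro riesz_ge) auto
        then show ?thesis by (intro mult_left_mono) (auto simp: f_def)
      qed simp
    qed
    finally have I1: "c1 * m \<le> (\<integral>x. f x * riesz \<alpha> (y - x) \<partial>lborel)" .
    have "\<bar>\<integral>x. \<beta> x * f x * riesz \<alpha> (y - x) \<partial>lborel\<bar> \<le> (\<integral>x. \<bar>\<beta> x * f x * riesz \<alpha> (y - x)\<bar> \<partial>lborel)"
      by (rule integral_abs_bound)
    also have "\<dots> \<le> c2"
      unfolding c2_def
    proof (rule integral_mono)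
      show "\<bar>\<beta> x * f x * riesz \<alpha> (y - x)\<bar> \<le> \<bar>\<beta> x * f x\<bar>" for x
      proof (cases "f x = 0")
        case False
        then have "riesz \<alpha> (y - x) \<le> 1 / 1 powr (real CARD('n) - \<alpha>)" using \<alpha> dd by (intro riesz_le) auto
        then show ?thesis unfolding abs_mult[of "\<beta> x * f x"] by (simp add: mult_left_le)
      qed simp
    qed (use i2 integrable_\<beta>_cball(2)[OF fm fb f0] in auto)
    finally have I2: "\<bar>\<integral>x. \<beta> x * f x * riesz \<alpha> (y - x) \<partial>lborel\<bar> \<le> c2" .
    have T: "T f y = \<beta> y * (\<integral>x. f x * riesz \<alpha> (y - x) \<partial>lborel) - (\<integral>x. \<beta> x * f x * riesz \<alpha> (y - x) \<partial>lborel)"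
      by (rule T_split[OF fm fb f0 zero_less_one]) (use dd in auto)
    have "\<bar>\<beta> y\<bar> * (c1 * m) \<le> \<bar>\<beta> y\<bar> * (\<integral>x. f x * riesz \<alpha> (y - x) \<partial>lborel)"
      using I1 by (intro mult_left_mono) auto
    also have "\<dots> = \<bar>\<beta> y * (\<integral>x. f x * riesz \<alpha> (y - x) \<partial>lborel)\<bar>"
      using order_trans[OF less_imp_le[OF mult_pos_pos[OF c1 m]] I1] by (simp add: abs_mult)
    also have "\<dots> \<le> \<bar>T f y\<bar> + c2" using T I2 by linarith
    finally show ?thesis .
  qed
  have c2: "0 \<le> c2" unfolding c2_def by (intro integral_nonneg_AE) auto
  obtain C1 where C1: "0 \<le> C1" "\<And>B. is_block q0 q B \<Longrightarrow> B \<in> borel_measurable borel \<Longrightarrow>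
    (\<integral>\<^sup>+ y. ennreal \<bar>B y\<bar> * indicator (cball 0 R) y \<partial>lborel) \<le> ennreal C1"
    using block_cball_bound[of R] by blast
  have fin: "morrey_norm p0 p f < \<infinity>" using fb f0 by (rule P.morrey_norm_cball_finite)
  then obtain C2 where C2: "0 \<le> C2" "morrey_norm p0 p f = ennreal C2"
    by (cases "morrey_norm p0 p f") auto
  define a where "a = 1 / (c1 * m)"
  have a: "0 < a" using c1 m by (simp add: a_def)
  show thesis
  proof (rule that[of "a * (C0 * C2 + c2 * C1)"])
    show "0 \<le> a * (C0 * C2 + c2 * C1)" using a C0 C2 C1 c2 by simp
    fix B assume B: "is_block q0 q B" "B \<in> borel_measurable borel"
    note [measurable] = B(2)
    have "(\<integral>\<^sup>+ y. ennreal \<bar>B y\<bar> * (ennreal \<bar>\<beta> y\<bar> * indicator (cball 0 R) y) \<partial>lborel)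
       \<le> (\<integral>\<^sup>+ y. ennreal a * (ennreal \<bar>B y\<bar> * ennreal \<bar>T f y\<bar> + ennreal c2 * (ennreal \<bar>B y\<bar> * indicator (cball 0 R) y)) \<partial>lborel)"
    proof (intro nn_integral_mono)
      fix y
      show "ennreal \<bar>B y\<bar> * (ennreal \<bar>\<beta> y\<bar> * indicator (cball 0 R) y)
        \<le> ennreal a * (ennreal \<bar>B y\<bar> * ennreal \<bar>T f y\<bar> + ennreal c2 * (ennreal \<bar>B y\<bar> * indicator (cball 0 R) y))"
      proof (cases "y \<in> cball 0 R")
        case True
        then have "\<bar>\<beta> y\<bar> * (c1 * m) \<le> \<bar>T f y\<bar> + c2" by (intro pt) (simp add: R'_def)
        then have "\<bar>\<beta> y\<bar> \<le> a * (\<bar>T f y\<bar> + c2)"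
          using mult_pos_pos[OF c1 m] by (simp add: a_def pos_le_divide_eq)
        then have "\<bar>B y\<bar> * \<bar>\<beta> y\<bar> \<le> \<bar>B y\<bar> * (a * (\<bar>T f y\<bar> + c2))" by (intro mult_left_mono) auto
        also have "\<dots> = a * (\<bar>B y\<bar> * \<bar>T f y\<bar> + c2 * \<bar>B y\<bar>)" by (simp add: algebra_simps)
        finally show ?thesis
          using True a c2 by (simp add: ennreal_leI flip: ennreal_mult ennreal_plus)
      qed simp
    qed
    also have "\<dots> = ennreal a * ((\<integral>\<^sup>+ y. ennreal \<bar>B y\<bar> * ennreal \<bar>T f y\<bar> \<partial>lborel) + ennreal c2 * (\<integral>\<^sup>+ y. ennreal \<bar>B y\<bar> * indicator (cball 0 R) y \<partial>lborel))"
      by (simp add: nn_integral_cmult nn_integral_add)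
    also have "\<dots> \<le> ennreal a * (ennreal C0 * ennreal C2 + ennreal c2 * ennreal C1)"
      using T_pairing[OF B fm fin] C1(2)[OF B] unfolding C2(2) by (intro mult_left_mono add_mono) auto
    also have "\<dots> = ennreal (a * (C0 * C2 + c2 * C1))"
      using a C0 C2(1) C1(1) c2 by (simp flip: ennreal_mult ennreal_plus)
    finally show "(\<integral>\<^sup>+ y. ennreal \<bar>B y\<bar> * (ennreal \<bar>\<beta> y\<bar> * indicator (cball 0 R) y) \<partial>lborel) \<le> ennreal (a * (C0 * C2 + c2 * C1))" .
  qed
qed


section \<open>The commutator near and far from the support of its argument\<close>

lemma integral_riesz_asymptotic:
  fixes f :: "(real, 'n) vec \<Rightarrow> real"
  assumes f: "integrable lborel f" "integrable lborel (\<lambda>x. f x * riesz \<alpha> (y - x))"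
    and z: "\<And>x. x \<notin> cball 0 \<rho> \<Longrightarrow> f x = 0"
    and as: "\<And>x. norm x \<le> \<rho> \<Longrightarrow> \<bar>riesz \<alpha> (y - x) - riesz \<alpha> y\<bar> \<le> \<epsilon> * riesz \<alpha> y"
  shows "\<bar>(\<integral>x. f x * riesz \<alpha> (y - x) \<partial>lborel) - riesz \<alpha> y * (\<integral>x. f x \<partial>lborel)\<bar> \<le> \<epsilon> * riesz \<alpha> y * (\<integral>x. \<bar>f x\<bar> \<partial>lborel)"
proof -
  have 1: "integrable lborel (\<lambda>x. f x * riesz \<alpha> y)" using f(1) by simp
  have "(\<integral>x. f x * riesz \<alpha> (y - x) \<partial>lborel) - riesz \<alpha> y * (\<integral>x. f x \<partial>lborel)
     = (\<integral>x. f x * riesz \<alpha> (y - x) \<partial>lborel) - (\<integral>x. f x * riesz \<alpha> y \<partial>lborel)"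
    by simp
  also have "\<dots> = (\<integral>x. f x * riesz \<alpha> (y - x) - f x * riesz \<alpha> y \<partial>lborel)"
    using f(2) 1 by (rule Bochner_Integration.integral_diff[symmetric])
  also have "\<bar>\<dots>\<bar> \<le> (\<integral>x. \<bar>f x * riesz \<alpha> (y - x) - f x * riesz \<alpha> y\<bar> \<partial>lborel)"
    by (rule integral_abs_bound)
  also have "\<dots> \<le> (\<integral>x. \<epsilon> * riesz \<alpha> y * \<bar>f x\<bar> \<partial>lborel)"
  proof (rule integral_mono)
    show "\<bar>f x * riesz \<alpha> (y - x) - f x * riesz \<alpha> y\<bar> \<le> \<epsilon> * riesz \<alpha> y * \<bar>f x\<bar>" for x
    proof (cases "f x = 0")
      case False
      then have "x \<in> cball 0 \<rho>" using z by blast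
      then have "\<bar>f x\<bar> * \<bar>riesz \<alpha> (y - x) - riesz \<alpha> y\<bar> \<le> \<bar>f x\<bar> * (\<epsilon> * riesz \<alpha> y)"
        by (intro mult_left_mono as) auto
      then show ?thesis by (simp add: mult.commute flip: abs_mult right_diff_distrib)
    qed simp
  qed (use f 1 in auto)
  also have "\<dots> = \<epsilon> * riesz \<alpha> y * (\<integral>x. \<bar>f x\<bar> \<partial>lborel)" by simp
  finally show ?thesis .
qed

text \<open>Far out the kernel is nearly constant on the support, so \<open>T f\<close> behaves as
  if the masses of f and \<beta> f were concentrated at the origin.\<close>

lemma T_asymptotic:
  assumes f: "f \<in> borel_measurable borel" "\<And>x. \<bar>f x\<bar> \<le> c" "\<And>x. x \<notin> cball 0 \<rho> \<Longrightarrow> f x = 0"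
    and y: "\<rho> < norm y"
    and as: "\<And>x. norm x \<le> \<rho> \<Longrightarrow> \<bar>riesz \<alpha> (y - x) - riesz \<alpha> y\<bar> \<le> \<epsilon> * riesz \<alpha> y"
  shows "\<bar>T f y - riesz \<alpha> y * (\<beta> y * (\<integral>x. f x \<partial>lborel) - (\<integral>x. \<beta> x * f x \<partial>lborel))\<bar>
    \<le> \<epsilon> * riesz \<alpha> y * (\<bar>\<beta> y\<bar> * (\<integral>x. \<bar>f x\<bar> \<partial>lborel) + (\<integral>x. \<bar>\<beta> x * f x\<bar> \<partial>lborel))"
proof -
  have d: "0 < norm y - \<rho>" using y by simp
  have dd: "norm y - \<rho> \<le> norm (y - x)" if "f x \<noteq> 0" for x
  proof -
    have "x \<in> cball 0 \<rho>" using f(3) that by blast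
    then show ?thesis using norm_triangle_sub[of y x] by simp
  qed
  have i1: "integrable lborel (\<lambda>x. f x * riesz \<alpha> (y - x))"
    using integrable_\<beta>_cball(1)[OF f] d dd by (rule integrable_mult_riesz)
  have i2: "integrable lborel (\<lambda>x. \<beta> x * f x * riesz \<alpha> (y - x))"
    using integrable_\<beta>_cball(2)[OF f] d by (rule integrable_mult_riesz) (use dd in auto)
  define A where "A = (\<integral>x. f x * riesz \<alpha> (y - x) \<partial>lborel) - riesz \<alpha> y * (\<integral>x. f x \<partial>lborel)"
  define B where "B = (\<integral>x. \<beta> x * f x * riesz \<alpha> (y - x) \<partial>lborel) - riesz \<alpha> y * (\<integral>x. \<beta> x * f x \<partial>lborel)"
  have A: "\<bar>A\<bar> \<le> \<epsilon> * riesz \<alpha> y * (\<integral>x. \<bar>f x\<bar> \<partial>lborel)"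
    unfolding A_def using integrable_\<beta>_cball(1)[OF f] i1 f(3) as by (rule integral_riesz_asymptotic)
  have B: "\<bar>B\<bar> \<le> \<epsilon> * riesz \<alpha> y * (\<integral>x. \<bar>\<beta> x * f x\<bar> \<partial>lborel)"
    unfolding B_def using integrable_\<beta>_cball(2)[OF f] i2 by (rule integral_riesz_asymptotic) (use f(3) as in auto)
  have "T f y - riesz \<alpha> y * (\<beta> y * (\<integral>x. f x \<partial>lborel) - (\<integral>x. \<beta> x * f x \<partial>lborel)) = \<beta> y * A - B"
    by (subst T_split[OF f d dd]) (simp_all add: A_def B_def right_diff_distrib mult.left_commute[of "\<beta> y"])
  also have "\<bar>\<dots>\<bar> \<le> \<bar>\<beta> y\<bar> * \<bar>A\<bar> + \<bar>B\<bar>"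
    using abs_triangle_ineq4[of "\<beta> y * A" B] by (simp add: abs_mult)
  also have "\<dots> \<le> \<bar>\<beta> y\<bar> * (\<epsilon> * riesz \<alpha> y * (\<integral>x. \<bar>f x\<bar> \<partial>lborel)) + \<epsilon> * riesz \<alpha> y * (\<integral>x. \<bar>\<beta> x * f x\<bar> \<partial>lborel)"
    by (intro add_mono mult_left_mono A B) auto
  finally show ?thesis by (simp add: algebra_simps)
qed

lemma riesz_cball_shift_le:
  fixes y :: "(real, 'n) vec"
  shows "(\<integral>\<^sup>+ x. ennreal (riesz \<alpha> (y - x)) * indicator (cball 0 \<rho>) x \<partial>lborel)
    \<le> (\<integral>\<^sup>+ (z :: (real, 'n) vec). ennreal (riesz \<alpha> z) * indicator (cball 0 (norm y + \<rho>)) z \<partial>lborel)"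
proof -
  have "(\<integral>\<^sup>+ x. ennreal (riesz \<alpha> (y - x)) * indicator (cball 0 \<rho>) x \<partial>lborel)
     = (\<integral>\<^sup>+ z. ennreal (riesz \<alpha> (y - (y + z))) * indicator (cball 0 \<rho>) (y + z) \<partial>lborel)"
    by (rule nn_integral_lborel_shift[symmetric]) measurable
  also have "\<dots> \<le> (\<integral>\<^sup>+ (z :: (real, 'n) vec). ennreal (riesz \<alpha> z) * indicator (cball 0 (norm y + \<rho>)) z \<partial>lborel)"
  proof (intro nn_integral_mono)
    fix z :: "(real, 'n) vec"
    have "riesz \<alpha> (y - (y + z)) = riesz \<alpha> z" by (simp add: riesz_def)
    moreover have "norm z \<le> norm y + \<rho>" if "norm (y + z) \<le> \<rho>"
      using norm_triangle_ineq4[of "y + z" y] that by simp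
    ultimately show "ennreal (riesz \<alpha> (y - (y + z))) * indicator (cball 0 \<rho>) (y + z) \<le> ennreal (riesz \<alpha> z) * indicator (cball 0 (norm y + \<rho>)) z"
      by (auto simp: indicator_def)
  qed
  finally show ?thesis .
qed

text \<open>After the substitution y = x + z and an exchange of integrals, the inner integral pairs
  a translate of B, again a block, with \<beta> on a ball. What is left is the local integral of the
  Riesz kernel.\<close>

lemma nn_integral_block_riesz_le:
  assumes B: "is_block q0 q B" "B \<in> borel_measurable borel"
    and C: "\<And>B. is_block q0 q B \<Longrightarrow> B \<in> borel_measurable borel \<Longrightarrow>
      (\<integral>\<^sup>+ x. ennreal \<bar>B x\<bar> * (ennreal \<bar>\<beta> x\<bar> * indicator (cball 0 \<rho>) x) \<partial>lborel) \<le> C"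
  shows "(\<integral>\<^sup>+ y. ennreal \<bar>B y\<bar> * indicator (cball 0 R) y *
      (\<integral>\<^sup>+ x. ennreal \<bar>\<beta> x\<bar> * indicator (cball 0 \<rho>) x * ennreal (riesz \<alpha> (y - x)) \<partial>lborel) \<partial>lborel)
    \<le> (\<integral>\<^sup>+ (z :: (real, 'n) vec). ennreal (riesz \<alpha> z) * indicator (cball 0 (R + \<rho>)) z \<partial>lborel) * C"
proof -
  note [measurable] = B(2)
  define h where "h y x = ennreal \<bar>B y\<bar> * indicator (cball 0 R) y * (ennreal \<bar>\<beta> x\<bar> * indicator (cball 0 \<rho>) x * ennreal (riesz \<alpha> (y - x)))" for y x
  have hm: "(\<lambda>(y, x). h y x) \<in> borel_measurable (borel \<Otimes>\<^sub>M borel)"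
    unfolding h_def case_prod_beta' by measurable
  have hm1: "(\<lambda>y. h y x) \<in> borel_measurable borel" for x unfolding h_def by measurable
  have hm2: "(\<lambda>(x, z). h (x + z) x) \<in> borel_measurable (borel \<Otimes>\<^sub>M borel)"
    unfolding h_def case_prod_beta' by measurable
  have "(\<integral>\<^sup>+ y. ennreal \<bar>B y\<bar> * indicator (cball 0 R) y *
      (\<integral>\<^sup>+ x. ennreal \<bar>\<beta> x\<bar> * indicator (cball 0 \<rho>) x * ennreal (riesz \<alpha> (y - x)) \<partial>lborel) \<partial>lborel)
     = (\<integral>\<^sup>+ y. (\<integral>\<^sup>+ x. h y x \<partial>lborel) \<partial>lborel)"
    unfolding h_def by (intro nn_integral_cong nn_integral_cmult[symmetric]) measurable
  also have "\<dots> = (\<integral>\<^sup>+ x. (\<integral>\<^sup>+ y. h y x \<partial>lborel) \<partial>lborel)"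
    using hm by (intro lborel_pair.Fubini'[symmetric]) simp
  also have "\<dots> = (\<integral>\<^sup>+ x. (\<integral>\<^sup>+ z. h (x + z) x \<partial>lborel) \<partial>lborel)"
    by (intro nn_integral_cong nn_integral_lborel_shift[symmetric] hm1)
  also have "\<dots> = (\<integral>\<^sup>+ z. (\<integral>\<^sup>+ x. h (x + z) x \<partial>lborel) \<partial>lborel)"
    using hm2 by (intro lborel_pair.Fubini'[symmetric]) simp
  also have "\<dots> \<le> (\<integral>\<^sup>+ (z :: (real, 'n) vec). ennreal (riesz \<alpha> z) * indicator (cball 0 (R + \<rho>)) z * C \<partial>lborel)"
  proof (intro nn_integral_mono)
    fix z :: "(real, 'n) vec"
    have "(\<integral>\<^sup>+ x. h (x + z) x \<partial>lborel) \<le> (\<integral>\<^sup>+ x. ennreal (riesz \<alpha> z) * indicator (cball 0 (R + \<rho>)) z * (ennreal \<bar>B (x + z)\<bar> * (ennreal \<bar>\<beta> x\<bar> * indicator (cball 0 \<rho>) x)) \<partial>lborel)"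
    proof (intro nn_integral_mono)
      fix x
      have "norm z \<le> R + \<rho>" if "norm (x + z) \<le> R" "norm x \<le> \<rho>"
        using norm_triangle_ineq4[of "x + z" x] that by simp
      then show "h (x + z) x \<le> ennreal (riesz \<alpha> z) * indicator (cball 0 (R + \<rho>)) z * (ennreal \<bar>B (x + z)\<bar> * (ennreal \<bar>\<beta> x\<bar> * indicator (cball 0 \<rho>) x))"
        by (auto simp: h_def indicator_def mult_ac)
    qed
    also have "\<dots> = ennreal (riesz \<alpha> z) * indicator (cball 0 (R + \<rho>)) z * (\<integral>\<^sup>+ x. ennreal \<bar>B (x + z)\<bar> * (ennreal \<bar>\<beta> x\<bar> * indicator (cball 0 \<rho>) x) \<partial>lborel)"
      by (rule nn_integral_cmult) measurable
    also have "\<dots> \<le> ennreal (riesz \<alpha> z) * indicator (cball 0 (R + \<rho>)) z * C"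
      by (intro mult_left_mono C Q.is_block_shift B) auto
    finally show "(\<integral>\<^sup>+ x. h (x + z) x \<partial>lborel) \<le> ennreal (riesz \<alpha> z) * indicator (cball 0 (R + \<rho>)) z * C" .
  qed
  also have "\<dots> = (\<integral>\<^sup>+ (z :: (real, 'n) vec). ennreal (riesz \<alpha> z) * indicator (cball 0 (R + \<rho>)) z \<partial>lborel) * C"
    by (rule nn_integral_multc) measurable
  finally show ?thesis .
qed

lemma T_pairing_bounded:
  assumes f: "f \<in> borel_measurable borel" "\<And>x. \<bar>f x\<bar> \<le> c" "\<And>x. x \<notin> cball 0 \<rho> \<Longrightarrow> f x = 0"
  obtains C where "0 \<le> C" "\<And>B. is_block q0 q B \<Longrightarrow> B \<in> borel_measurable borel \<Longrightarrow>
    (\<integral>\<^sup>+ y. ennreal \<bar>B y\<bar> * ennreal \<bar>T f y\<bar> \<partial>lborel) \<le> ennreal C"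
proof -
  have fin: "morrey_norm p0 p f < \<infinity>" using f(2,3) by (rule P.morrey_norm_cball_finite)
  then obtain C where C: "0 \<le> C" "morrey_norm p0 p f = ennreal C"
    by (cases "morrey_norm p0 p f") auto
  show thesis
    by (rule that[of "C0 * C"]) (use T_pairing[OF _ _ f(1) fin] C C0 in \<open>auto simp: ennreal_mult\<close>)
qed

text \<open>Far out, \<open>riesz \<alpha>\<close> and \<open>\<beta> * riesz \<alpha>\<close> are recovered from \<open>T f1\<close> and \<open>T f2\<close>, where \<open>f1\<close> is the indicator
  of a ball and \<open>f2\<close> has integral 0 but \<open>\<beta> * f2\<close> has integral 1; such an \<open>f2\<close> exists unless \<open>\<beta>\<close> is constant
  on the ball, and then \<open>S \<rho> = \<bar>T f1\<bar>\<close>.\<close>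

lemma S_eq_T_if_constant:
  assumes c: "AE x in lborel. x \<in> cball 0 \<rho> \<longrightarrow> \<beta> x = c"
  shows "S \<rho> y = ennreal \<bar>T (indicator (cball 0 \<rho>)) y\<bar>"
proof -
  let ?K = "cball (0 :: (real, 'n) vec) \<rho>"
  have fin: "(\<integral>\<^sup>+ x. ennreal (riesz \<alpha> (y - x)) * indicator ?K x \<partial>lborel) < \<infinity>"
    using riesz_cball_shift_le[of y \<rho>] riesz_locally_integrable[OF \<alpha>, of "norm y + \<rho>"] by (rule le_less_trans)
  have i: "integrable lborel (\<lambda>x. indicator ?K x * riesz \<alpha> (y - x))"
    unfolding integrable_iff_bounded
  proof
    have "(\<integral>\<^sup>+ x. ennreal (norm (indicator ?K x * riesz \<alpha> (y - x))) \<partial>lborel) = (\<integral>\<^sup>+ x. ennreal (riesz \<alpha> (y - x)) * indicator ?K x \<partial>lborel)"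
      by (intro nn_integral_cong) (auto simp: indicator_def)
    with fin show "(\<integral>\<^sup>+ x. ennreal (norm (indicator ?K x * riesz \<alpha> (y - x))) \<partial>lborel) < \<infinity>" by simp
  qed measurable
  have "S \<rho> y = (\<integral>\<^sup>+ x. ennreal \<bar>\<beta> y - c\<bar> * ennreal (indicator ?K x * riesz \<alpha> (y - x)) \<partial>lborel)"
    unfolding S_def using c
    by (intro nn_integral_cong_AE, eventually_elim) (auto simp: indicator_def abs_mult ennreal_mult)
  also have "\<dots> = ennreal \<bar>\<beta> y - c\<bar> * (\<integral>\<^sup>+ x. ennreal (indicator ?K x * riesz \<alpha> (y - x)) \<partial>lborel)"
    by (rule nn_integral_cmult) measurable
  also have "\<dots> = ennreal \<bar>\<beta> y - c\<bar> * ennreal (\<integral>x. indicator ?K x * riesz \<alpha> (y - x) \<partial>lborel)"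
    using i by (subst nn_integral_eq_integral) auto
  also have "\<dots> = ennreal \<bar>(\<beta> y - c) * (\<integral>x. indicator ?K x * riesz \<alpha> (y - x) \<partial>lborel)\<bar>"
    by (simp add: abs_mult integral_nonneg_AE ennreal_mult)
  also have "(\<beta> y - c) * (\<integral>x. indicator ?K x * riesz \<alpha> (y - x) \<partial>lborel) = T (indicator ?K) y"
    unfolding T_def integral_mult_right_zero[symmetric] using c
    by (intro integral_cong_AE) (measurable, auto elim!: eventually_mono simp: indicator_def)
  finally show ?thesis .
qed

text \<open>With c the mean of \<beta> over the ball and E the part where \<beta> exceeds c, the
  indicator of E is corrected by a multiple of the indicator of the ball to have integral 0. Its
  pairing with \<beta> is w, the integral of \<beta> - c over E, and w = 0 would force \<beta> = c
  almost everywhere on the ball.\<close>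

lemma exists_zero_mean:
  assumes \<rho>: "0 < \<rho>" and nc: "\<nexists>c. AE x in lborel. x \<in> cball 0 \<rho> \<longrightarrow> \<beta> x = c"
  obtains f c where "f \<in> borel_measurable borel" "\<And>x. \<bar>f x\<bar> \<le> c" "\<And>x. x \<notin> cball 0 \<rho> \<Longrightarrow> f x = 0"
    "(\<integral>x. f x \<partial>lborel) = 0" "(\<integral>x. \<beta> x * f x \<partial>lborel) = 1"
proof -
  let ?K = "cball (0 :: (real, 'n) vec) \<rho>"
  define f1 :: "(real, 'n) vec \<Rightarrow> real" where "f1 = indicator ?K"
  have f1: "f1 \<in> borel_measurable borel" "\<And>x. \<bar>f1 x\<bar> \<le> 1" "\<And>x. x \<notin> ?K \<Longrightarrow> f1 x = 0"
    by (auto simp: f1_def indicator_def)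
  note [measurable] = f1(1)
  note i1 = integrable_\<beta>_cball[OF f1]
  define m where "m = (\<integral>x. f1 x \<partial>lborel)"
  have m: "0 < m" unfolding m_def f1_def using content_cball_pos[of \<rho> "0 :: (real, 'n) vec"] \<rho> by simp
  define c where "c = (\<integral>x. \<beta> x * f1 x \<partial>lborel) / m"
  define E where "E = {x \<in> ?K. c < \<beta> x}"
  have [measurable]: "E \<in> sets borel" unfolding E_def by measurable
  define g :: "(real, 'n) vec \<Rightarrow> real" where "g = indicator E"
  have g: "g \<in> borel_measurable borel" "\<And>x. \<bar>g x\<bar> \<le> 1" "\<And>x. x \<notin> ?K \<Longrightarrow> g x = 0"
    by (auto simp: g_def indicator_def E_def)
  note [measurable] = g(1)
  note i2 = integrable_\<beta>_cball[OF g]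
  define w where "w = (\<integral>x. \<beta> x * g x - c * g x \<partial>lborel)"
  have iw: "integrable lborel (\<lambda>x. \<beta> x * g x - c * g x)" using i2 by simp
  have wnn: "0 \<le> \<beta> x * g x - c * g x" for x by (auto simp: g_def E_def indicator_def)
  have "w \<noteq> 0"
  proof
    assume "w = 0"
    then have "AE x in lborel. \<beta> x * g x - c * g x = 0"
      unfolding w_def using integral_nonneg_eq_0_iff_AE[OF iw] wnn by simp
    then have le: "AE x in lborel. x \<in> ?K \<longrightarrow> \<beta> x \<le> c"
      by eventually_elim (auto simp: g_def E_def indicator_def split: if_splits)
    have i3: "integrable lborel (\<lambda>x. c * f1 x - \<beta> x * f1 x)" using i1 by simp
    have "(\<integral>x. c * f1 x - \<beta> x * f1 x \<partial>lborel) = 0"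
      using i1 m by (subst Bochner_Integration.integral_diff) (auto simp: c_def m_def)
    moreover have "AE x in lborel. 0 \<le> c * f1 x - \<beta> x * f1 x"
      using le by eventually_elim (auto simp: f1_def indicator_def)
    ultimately have "AE x in lborel. c * f1 x - \<beta> x * f1 x = 0"
      using integral_nonneg_eq_0_iff_AE[OF i3] by simp
    then have "AE x in lborel. x \<in> ?K \<longrightarrow> \<beta> x = c"
      by eventually_elim (auto simp: f1_def indicator_def)
    with nc show False by blast
  qed
  define e where "e = (\<integral>x. g x \<partial>lborel)"
  define f where "f x = (1 / w) * (g x - (e / m) * f1 x)" for x
  show thesis
  proof (rule that[of f "\<bar>1 / w\<bar> * (1 + \<bar>e / m\<bar>)"])
    show "f \<in> borel_measurable borel" unfolding f_def[abs_def] by measurable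
    show "f x = 0" if "x \<notin> ?K" for x using f1(3)[OF that] g(3)[OF that] by (simp add: f_def)
    show "\<bar>f x\<bar> \<le> \<bar>1 / w\<bar> * (1 + \<bar>e / m\<bar>)" for x
    proof -
      have "\<bar>g x - (e / m) * f1 x\<bar> \<le> \<bar>g x\<bar> + \<bar>e / m\<bar> * \<bar>f1 x\<bar>"
        using abs_triangle_ineq4[of "g x" "e / m * f1 x"] by (simp add: abs_mult)
      also have "\<dots> \<le> 1 + \<bar>e / m\<bar> * 1" using f1(2)[of x] g(2)[of x] by (intro add_mono mult_left_mono) auto
      finally show ?thesis unfolding f_def abs_mult by (intro mult_left_mono) auto
    qed
    show "(\<integral>x. f x \<partial>lborel) = 0"
      unfolding f_def using i1(1) i2(1) m by (simp add: e_def m_def)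
    have "(\<integral>x. \<beta> x * f x \<partial>lborel) = (\<integral>x. (1 / w) * (\<beta> x * g x - (e / m) * (\<beta> x * f1 x)) \<partial>lborel)"
      by (intro Bochner_Integration.integral_cong) (auto simp: f_def algebra_simps)
    also have "\<dots> = (1 / w) * ((\<integral>x. \<beta> x * g x \<partial>lborel) - (e / m) * (\<integral>x. \<beta> x * f1 x \<partial>lborel))"
      using i1(2) i2(2) by simp
    also have "(\<integral>x. \<beta> x * g x \<partial>lborel) - (e / m) * (\<integral>x. \<beta> x * f1 x \<partial>lborel) = w"
      unfolding w_def using i2 by (subst Bochner_Integration.integral_diff) (auto simp: c_def e_def)
    finally show "(\<integral>x. \<beta> x * f x \<partial>lborel) = 1" using \<open>w \<noteq> 0\<close> by simp
  qed
qed

text \<open>With k = \<open>riesz \<alpha> y\<close>, the leading terms of \<open>T f1\<close> and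
  \<open>T f2\<close> are two linear expressions in k and \<beta> y k, which determine both
  unknowns. The errors involve the same unknowns times \<epsilon> and are absorbed.\<close>

lemma S_far_bound:
  assumes \<rho>: "0 < \<rho>" and nc: "\<nexists>c. AE x in lborel. x \<in> cball 0 \<rho> \<longrightarrow> \<beta> x = c"
  obtains R C f2 c where "0 < R" "0 \<le> C" "f2 \<in> borel_measurable borel" "\<And>x. \<bar>f2 x\<bar> \<le> c" "\<And>x. x \<notin> cball 0 \<rho> \<Longrightarrow> f2 x = 0"
    "\<And>y. R \<le> norm y \<Longrightarrow> S \<rho> y \<le> ennreal (C * (\<bar>T (indicator (cball 0 \<rho>)) y\<bar> + \<bar>T f2 y\<bar>))"
proof -
  let ?K = "cball (0 :: (real, 'n) vec) \<rho>"
  obtain f2 c where f2: "f2 \<in> borel_measurable borel" "\<And>x. \<bar>f2 x\<bar> \<le> c" "\<And>x. x \<notin> ?K \<Longrightarrow> f2 x = 0"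
    and f2_int: "(\<integral>x. f2 x \<partial>lborel) = 0" "(\<integral>x. \<beta> x * f2 x \<partial>lborel) = 1"
    using exists_zero_mean[OF \<rho> nc] by blast
  define f1 :: "(real, 'n) vec \<Rightarrow> real" where "f1 = indicator ?K"
  have f1: "f1 \<in> borel_measurable borel" "\<And>x. \<bar>f1 x\<bar> \<le> 1" "\<And>x. x \<notin> ?K \<Longrightarrow> f1 x = 0"
    by (auto simp: f1_def indicator_def)
  define m where "m = (\<integral>x. f1 x \<partial>lborel)"
  have m: "0 < m" unfolding m_def f1_def using content_cball_pos[of \<rho> "0 :: (real, 'n) vec"] \<rho> by simp
  define b where "b = (\<integral>x. \<bar>\<beta> x * f1 x\<bar> \<partial>lborel)"
  define a2 where "a2 = (\<integral>x. \<bar>f2 x\<bar> \<partial>lborel)"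
  define b2 where "b2 = (\<integral>x. \<bar>\<beta> x * f2 x\<bar> \<partial>lborel)"
  have nn: "0 \<le> b" "0 \<le> a2" "0 \<le> b2" by (auto simp: b_def a2_def b2_def intro!: integral_nonneg_AE)
  \<comment> \<open>Inserting the bound for |\<beta> y| k into the estimate for k produces k again,
    with coefficient \<epsilon> D. Making this at most 1 / 2 absorbs it.\<close>
  define D where "D = b2 + 4 * a2 * b / m"
  have D: "0 \<le> D" using nn m by (simp add: D_def)
  define \<epsilon> where "\<epsilon> = 1 / (2 * (D + 1))"
  have \<epsilon>: "0 < \<epsilon>" "\<epsilon> \<le> 1 / 2" "\<epsilon> * D \<le> 1 / 2" using D by (auto simp: \<epsilon>_def field_simps)
  obtain R where R: "\<rho> < R" "0 < R" and as: "\<And>x y :: (real, 'n) vec. norm x \<le> \<rho> \<Longrightarrow> R \<le> norm y \<Longrightarrow>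
      \<bar>riesz \<alpha> (y - x) - riesz \<alpha> y\<bar> \<le> \<epsilon> * riesz \<alpha> y"
    using riesz_asymptotic[OF \<epsilon>(1), of \<rho> \<alpha>] by blast
  define c' where "c' = 4 * \<epsilon> * a2 / m"
  have c': "0 \<le> c'" using \<epsilon> nn m by (simp add: c'_def)
  \<comment> \<open>From the bound 4 |T f1 y| + 10 b k, with k replaced by \<open>k1\<close>; one
    constant serves both images.\<close>
  define C where "C = 4 + 10 * b * (2 + c')"
  show thesis
  proof (rule that[OF R(2) _ f2])
    show "0 \<le> C" using nn c' by (simp add: C_def)
    fix y :: "(real, 'n) vec" assume y: "R \<le> norm y"
    define k where "k = riesz \<alpha> y"
    define t where "t = \<bar>\<beta> y\<bar> * k"
    have k: "0 \<le> k" by (simp add: k_def)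
    have y\<rho>: "\<rho> < norm y" using R y by simp
    have as_y: "\<bar>riesz \<alpha> (y - x) - k\<bar> \<le> \<epsilon> * k" if "norm x \<le> \<rho>" for x
      unfolding k_def using that y by (rule as)
    have f1abs: "(\<integral>x. \<bar>f1 x\<bar> \<partial>lborel) = m" by (simp add: m_def f1_def)
    have bb: "\<bar>\<integral>x. \<beta> x * f1 x \<partial>lborel\<bar> \<le> b" unfolding b_def by (rule integral_abs_bound)
    have T1: "\<bar>T f1 y - k * (\<beta> y * m - (\<integral>x. \<beta> x * f1 x \<partial>lborel))\<bar> \<le> \<epsilon> * k * (\<bar>\<beta> y\<bar> * m + b)"
      using T_asymptotic[OF f1 y\<rho> as_y[unfolded k_def]] unfolding f1abs m_def[symmetric] b_def[symmetric] k_def[symmetric] .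
    have T2: "\<bar>T f2 y - k * (\<beta> y * 0 - 1)\<bar> \<le> \<epsilon> * k * (\<bar>\<beta> y\<bar> * a2 + b2)"
      using T_asymptotic[OF f2 y\<rho> as_y[unfolded k_def]] unfolding f2_int a2_def[symmetric] b2_def[symmetric] k_def[symmetric] .
    have kb: "\<bar>k * (\<integral>x. \<beta> x * f1 x \<partial>lborel)\<bar> \<le> k * b"
      using k bb by (simp add: abs_mult mult_left_mono)
    have tm: "\<bar>k * (\<beta> y * m)\<bar> = t * m" using k m by (simp add: t_def abs_mult)
    have e1: "\<epsilon> * k * (\<bar>\<beta> y\<bar> * m + b) \<le> 1 / 2 * (t * m + k * b)"
    proof -
      have "\<epsilon> * (t * m + k * b) \<le> 1 / 2 * (t * m + k * b)"
        using \<epsilon> k m nn by (intro mult_right_mono) (auto simp: t_def)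
      then show ?thesis by (simp add: t_def algebra_simps)
    qed
    have t1: "t * m \<le> 2 * \<bar>T f1 y\<bar> + 4 * (k * b)"
      using T1 kb tm e1 mult_nonneg_nonneg[OF k nn(1)] by (simp add: right_diff_distrib)
    have "k \<le> \<bar>T f2 y\<bar> + \<epsilon> * (t * a2) + \<epsilon> * (k * b2)"
      using T2 k by (simp add: t_def algebra_simps)
    moreover have "\<epsilon> * (t * a2) \<le> \<epsilon> * ((2 * \<bar>T f1 y\<bar> + 4 * (k * b)) / m * a2)"
      using t1 m \<epsilon> nn by (intro mult_left_mono mult_right_mono) (auto simp: pos_le_divide_eq)
    moreover have "\<epsilon> * ((2 * \<bar>T f1 y\<bar> + 4 * (k * b)) / m * a2) + \<epsilon> * (k * b2) = c' / 2 * \<bar>T f1 y\<bar> + k * (\<epsilon> * D)"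
      by (simp add: c'_def D_def field_simps add_divide_distrib)
    moreover have "k * (\<epsilon> * D) \<le> k * (1 / 2)" using \<epsilon> k by (intro mult_left_mono) auto
    ultimately have "k \<le> \<bar>T f2 y\<bar> + c' / 2 * \<bar>T f1 y\<bar> + k / 2" by linarith
    then have k1: "k \<le> 2 * \<bar>T f2 y\<bar> + c' * \<bar>T f1 y\<bar>" by simp
    have "S \<rho> y \<le> (\<integral>\<^sup>+ x. ennreal (2 * k * (\<bar>\<beta> y\<bar> * \<bar>f1 x\<bar> + \<bar>\<beta> x * f1 x\<bar>)) \<partial>lborel)"
      unfolding S_def
    proof (intro nn_integral_mono)
      fix x
      show "ennreal \<bar>(\<beta> y - \<beta> x) * riesz \<alpha> (y - x)\<bar> * indicator ?K x \<le> ennreal (2 * k * (\<bar>\<beta> y\<bar> * \<bar>f1 x\<bar> + \<bar>\<beta> x * f1 x\<bar>))"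
      proof (cases "x \<in> ?K")
        case True
        have "\<epsilon> * k \<le> 1 * k" using \<epsilon> k by (intro mult_right_mono) auto
        then have "riesz \<alpha> (y - x) \<le> 2 * k" using as_y[of x] True by simp
        then have "\<bar>\<beta> y - \<beta> x\<bar> * riesz \<alpha> (y - x) \<le> (\<bar>\<beta> y\<bar> + \<bar>\<beta> x\<bar>) * (2 * k)"
          by (intro mult_mono abs_triangle_ineq4) auto
        then show ?thesis using True by (simp add: f1_def abs_mult ennreal_leI mult.commute)
      qed simp
    qed
    also have "\<dots> = ennreal (\<integral>x. 2 * k * (\<bar>\<beta> y\<bar> * \<bar>f1 x\<bar> + \<bar>\<beta> x * f1 x\<bar>) \<partial>lborel)"
      using integrable_\<beta>_cball[OF f1] k by (intro nn_integral_eq_integral) auto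
    also have "(\<integral>x. 2 * k * (\<bar>\<beta> y\<bar> * \<bar>f1 x\<bar> + \<bar>\<beta> x * f1 x\<bar>) \<partial>lborel) = 2 * k * (\<bar>\<beta> y\<bar> * m + b)"
      unfolding f1abs[symmetric] b_def using integrable_\<beta>_cball[OF f1] by simp
    also have "\<dots> = 2 * (t * m) + 2 * (k * b)" by (simp add: t_def algebra_simps)
    also have "\<dots> \<le> 4 * \<bar>T f1 y\<bar> + 10 * b * k" using t1 by (simp add: mult.commute)
    also have "\<dots> \<le> 4 * \<bar>T f1 y\<bar> + 10 * b * (2 * \<bar>T f2 y\<bar> + c' * \<bar>T f1 y\<bar>)"
      using k1 nn by (intro add_left_mono mult_left_mono) auto
    also have "\<dots> \<le> C * (\<bar>T f1 y\<bar> + \<bar>T f2 y\<bar>)"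
    proof -
      have "C * (\<bar>T f1 y\<bar> + \<bar>T f2 y\<bar>) - (4 * \<bar>T f1 y\<bar> + 10 * b * (2 * \<bar>T f2 y\<bar> + c' * \<bar>T f1 y\<bar>))
         = 4 * \<bar>T f2 y\<bar> + 20 * (b * \<bar>T f1 y\<bar>) + 10 * (b * c' * \<bar>T f2 y\<bar>)"
        by (simp add: C_def algebra_simps)
      also have "0 \<le> \<dots>" using nn c' by simp
      finally show ?thesis by simp
    qed
    finally show "S \<rho> y \<le> ennreal (C * (\<bar>T (indicator ?K) y\<bar> + \<bar>T f2 y\<bar>))"
      by (simp add: f1_def ennreal_leI)
  qed
qed

end

section \<open>Absolute convergence of the double integral\<close>

lemma nn_integral_lincomb:
  assumes [measurable]: "u1 \<in> borel_measurable M" "u2 \<in> borel_measurable M" "u3 \<in> borel_measurable M" "u4 \<in> borel_measurable M"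
  shows "(\<integral>\<^sup>+ y. a * u1 y + u2 y + c * (u3 y + u4 y) \<partial>M)
    = a * (\<integral>\<^sup>+ y. u1 y \<partial>M) + (\<integral>\<^sup>+ y. u2 y \<partial>M) + c * ((\<integral>\<^sup>+ y. u3 y \<partial>M) + (\<integral>\<^sup>+ y. u4 y \<partial>M))"
  by (simp add: nn_integral_add nn_integral_cmult)

context commutator
begin

text \<open>At bounded distance the triangle inequality is good enough: the first term is left to
  \<open>\<beta>_block_bound\<close>, the second to
  \<open>nn_integral_block_riesz_le\<close>.\<close>

lemma S_near_le:
  assumes "norm y \<le> R"
  shows "S \<rho> y \<le> ennreal \<bar>\<beta> y\<bar> * (\<integral>\<^sup>+ (z :: (real, 'n) vec). ennreal (riesz \<alpha> z) * indicator (cball 0 (R + \<rho>)) z \<partial>lborel)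
    + (\<integral>\<^sup>+ x. ennreal \<bar>\<beta> x\<bar> * indicator (cball 0 \<rho>) x * ennreal (riesz \<alpha> (y - x)) \<partial>lborel)"
proof -
  have "S \<rho> y \<le> (\<integral>\<^sup>+ x. ennreal \<bar>\<beta> y\<bar> * (ennreal (riesz \<alpha> (y - x)) * indicator (cball 0 \<rho>) x)
      + ennreal \<bar>\<beta> x\<bar> * indicator (cball 0 \<rho>) x * ennreal (riesz \<alpha> (y - x)) \<partial>lborel)"
    unfolding S_def
  proof (intro nn_integral_mono)
    fix x
    have "\<bar>\<beta> y - \<beta> x\<bar> * riesz \<alpha> (y - x) \<le> (\<bar>\<beta> y\<bar> + \<bar>\<beta> x\<bar>) * riesz \<alpha> (y - x)"
      by (intro mult_right_mono abs_triangle_ineq4) auto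
    then have "\<bar>(\<beta> y - \<beta> x) * riesz \<alpha> (y - x)\<bar> \<le> \<bar>\<beta> y\<bar> * riesz \<alpha> (y - x) + \<bar>\<beta> x\<bar> * riesz \<alpha> (y - x)"
      by (simp add: abs_mult distrib_right)
    then have "ennreal \<bar>(\<beta> y - \<beta> x) * riesz \<alpha> (y - x)\<bar> \<le> ennreal \<bar>\<beta> y\<bar> * ennreal (riesz \<alpha> (y - x)) + ennreal \<bar>\<beta> x\<bar> * ennreal (riesz \<alpha> (y - x))"
      by (simp add: ennreal_leI flip: ennreal_mult ennreal_plus)
    then show "ennreal \<bar>(\<beta> y - \<beta> x) * riesz \<alpha> (y - x)\<bar> * indicator (cball 0 \<rho>) x
      \<le> ennreal \<bar>\<beta> y\<bar> * (ennreal (riesz \<alpha> (y - x)) * indicator (cball 0 \<rho>) x)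
      + ennreal \<bar>\<beta> x\<bar> * indicator (cball 0 \<rho>) x * ennreal (riesz \<alpha> (y - x))"
      by (simp add: indicator_def)
  qed
  also have "\<dots> = ennreal \<bar>\<beta> y\<bar> * (\<integral>\<^sup>+ x. ennreal (riesz \<alpha> (y - x)) * indicator (cball 0 \<rho>) x \<partial>lborel)
      + (\<integral>\<^sup>+ x. ennreal \<bar>\<beta> x\<bar> * indicator (cball 0 \<rho>) x * ennreal (riesz \<alpha> (y - x)) \<partial>lborel)"
    by (subst nn_integral_add) (simp_all add: nn_integral_cmult)
  also have "(\<integral>\<^sup>+ x. ennreal (riesz \<alpha> (y - x)) * indicator (cball 0 \<rho>) x \<partial>lborel)
      \<le> (\<integral>\<^sup>+ (z :: (real, 'n) vec). ennreal (riesz \<alpha> z) * indicator (cball 0 (norm y + \<rho>)) z \<partial>lborel)"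
    by (rule riesz_cball_shift_le)
  also have "\<dots> \<le> (\<integral>\<^sup>+ (z :: (real, 'n) vec). ennreal (riesz \<alpha> z) * indicator (cball 0 (R + \<rho>)) z \<partial>lborel)"
    using assms by (intro nn_integral_mono) (auto simp: indicator_def)
  finally show ?thesis by (simp add: mult_left_mono)
qed

text \<open>For nonconstant \<beta> the estimate splits at norm y = R: the near bound inside, images
  of two test functions outside. Uniformity over blocks lets it pass to block series by
  \<open>decomposable_nn_integral_borel_le\<close>.\<close>

lemma S_block_bound:
  assumes \<rho>: "0 < \<rho>"
  shows "\<exists>C\<ge>0. \<forall>B. is_block q0 q B \<longrightarrow> B \<in> borel_measurable borel \<longrightarrow>
    (\<integral>\<^sup>+ y. ennreal \<bar>B y\<bar> * S \<rho> y \<partial>lborel) \<le> ennreal C"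
proof -
  let ?K = "cball (0 :: (real, 'n) vec) \<rho>"
  let ?f1 = "indicator ?K :: (real, 'n) vec \<Rightarrow> real"
  have f1: "?f1 \<in> borel_measurable borel" "\<And>x. \<bar>?f1 x\<bar> \<le> 1" "\<And>x. x \<notin> ?K \<Longrightarrow> ?f1 x = 0"
    by (auto simp: indicator_def)
  obtain C1 where C1: "0 \<le> C1" "\<And>B. is_block q0 q B \<Longrightarrow> B \<in> borel_measurable borel \<Longrightarrow>
      (\<integral>\<^sup>+ y. ennreal \<bar>B y\<bar> * ennreal \<bar>T ?f1 y\<bar> \<partial>lborel) \<le> ennreal C1"
    using T_pairing_bounded[OF f1] by blast
  show ?thesis
  proof (cases "\<exists>c. AE x in lborel. x \<in> ?K \<longrightarrow> \<beta> x = c")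
    case True
    then obtain c where "AE x in lborel. x \<in> ?K \<longrightarrow> \<beta> x = c" ..
    from S_eq_T_if_constant[OF this] C1 show ?thesis by auto
  next
    case False
    then obtain R C f2 c where RC: "0 < R" "0 \<le> C" and f2: "f2 \<in> borel_measurable borel" "\<And>x. \<bar>f2 x\<bar> \<le> c" "\<And>x. x \<notin> ?K \<Longrightarrow> f2 x = 0"
      and far: "\<And>y. R \<le> norm y \<Longrightarrow> S \<rho> y \<le> ennreal (C * (\<bar>T ?f1 y\<bar> + \<bar>T f2 y\<bar>))"
      using S_far_bound[OF \<rho>] by blast
    note [measurable] = f2(1)
    obtain C2 where C2: "0 \<le> C2" "\<And>B. is_block q0 q B \<Longrightarrow> B \<in> borel_measurable borel \<Longrightarrow>
        (\<integral>\<^sup>+ y. ennreal \<bar>B y\<bar> * ennreal \<bar>T f2 y\<bar> \<partial>lborel) \<le> ennreal C2"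
      using T_pairing_bounded[OF f2] by blast
    obtain C3 where C3: "0 \<le> C3" "\<And>B. is_block q0 q B \<Longrightarrow> B \<in> borel_measurable borel \<Longrightarrow>
        (\<integral>\<^sup>+ y. ennreal \<bar>B y\<bar> * (ennreal \<bar>\<beta> y\<bar> * indicator (cball 0 R) y) \<partial>lborel) \<le> ennreal C3"
      using \<beta>_block_bound[of R] by blast
    obtain C4 where C4: "0 \<le> C4" "\<And>B. is_block q0 q B \<Longrightarrow> B \<in> borel_measurable borel \<Longrightarrow>
        (\<integral>\<^sup>+ y. ennreal \<bar>B y\<bar> * (ennreal \<bar>\<beta> y\<bar> * indicator (cball 0 \<rho>) y) \<partial>lborel) \<le> ennreal C4"
      using \<beta>_block_bound[of \<rho>] by blast
    obtain \<kappa> where \<kappa>: "0 \<le> \<kappa>" "(\<integral>\<^sup>+ (z :: (real, 'n) vec). ennreal (riesz \<alpha> z) * indicator (cball 0 (R + \<rho>)) z \<partial>lborel) = ennreal \<kappa>"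
      using riesz_locally_integrable[OF \<alpha>, of "R + \<rho>"]
      by (cases "(\<integral>\<^sup>+ (z :: (real, 'n) vec). ennreal (riesz \<alpha> z) * indicator (cball 0 (R + \<rho>)) z \<partial>lborel)") auto
    define V where "V y = (\<integral>\<^sup>+ x. ennreal \<bar>\<beta> x\<bar> * indicator ?K x * ennreal (riesz \<alpha> (y - x)) \<partial>lborel)" for y
    have Vm [measurable]: "V \<in> borel_measurable borel"
    proof -
      have "(\<lambda>z. ennreal \<bar>\<beta> (snd z)\<bar> * indicator ?K (snd z) * ennreal (riesz \<alpha> (fst z - snd z))) \<in> borel_measurable (borel \<Otimes>\<^sub>M lborel)"
        by measurable
      then have "(\<lambda>y. \<integral>\<^sup>+ x. ennreal \<bar>\<beta> x\<bar> * indicator ?K x * ennreal (riesz \<alpha> (y - x)) \<partial>lborel) \<in> borel_measurable borel"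
        by (intro lborel.borel_measurable_nn_integral) (simp add: case_prod_beta')
      then show ?thesis unfolding V_def[abs_def] .
    qed
    have pt: "S \<rho> y \<le> ennreal \<kappa> * (ennreal \<bar>\<beta> y\<bar> * indicator (cball 0 R) y) + indicator (cball 0 R) y * V y
        + ennreal C * (ennreal \<bar>T ?f1 y\<bar> + ennreal \<bar>T f2 y\<bar>)" for y
    proof (cases "norm y \<le> R")
      case True
      have "S \<rho> y \<le> ennreal \<bar>\<beta> y\<bar> * ennreal \<kappa> + V y"
        using S_near_le[OF True, of \<rho>] unfolding \<kappa>(2) V_def .
      also have "\<dots> = ennreal \<kappa> * (ennreal \<bar>\<beta> y\<bar> * indicator (cball 0 R) y) + indicator (cball 0 R) y * V y"
        using True by (simp add: mult.commute)
      also have "\<dots> \<le> \<dots> + ennreal C * (ennreal \<bar>T ?f1 y\<bar> + ennreal \<bar>T f2 y\<bar>)" by simp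
      finally show ?thesis .
    next
      case False
      then have "S \<rho> y \<le> ennreal C * (ennreal \<bar>T ?f1 y\<bar> + ennreal \<bar>T f2 y\<bar>)"
        using far[of y] RC by (simp add: ennreal_mult)
      then show ?thesis using False by simp
    qed
    define D where "D = \<kappa> * C3 + \<kappa> * C4 + C * (C1 + C2)"
    have D: "0 \<le> D" using \<kappa>(1) C1(1) C2(1) C3(1) C4(1) RC(2) by (simp add: D_def)
    have "(\<integral>\<^sup>+ y. ennreal \<bar>B y\<bar> * S \<rho> y \<partial>lborel) \<le> ennreal D" if B: "is_block q0 q B" "B \<in> borel_measurable borel" for B
    proof -
      note [measurable] = B(2)
      let ?b = "\<lambda>y. ennreal \<bar>B y\<bar>"
      have V_le: "(\<integral>\<^sup>+ y. ?b y * indicator (cball 0 R) y * V y \<partial>lborel) \<le> ennreal \<kappa> * ennreal C4"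
        unfolding V_def \<kappa>(2)[symmetric] by (rule nn_integral_block_riesz_le[OF B]) (rule C4(2))
      have m1: "(\<lambda>y. ?b y * (ennreal \<bar>\<beta> y\<bar> * indicator (cball 0 R) y)) \<in> borel_measurable lborel" by measurable
      have m2: "(\<lambda>y. ?b y * indicator (cball 0 R) y * V y) \<in> borel_measurable lborel" using Vm by measurable
      have m3: "(\<lambda>y. ?b y * ennreal \<bar>T ?f1 y\<bar>) \<in> borel_measurable lborel" using T_measurable[OF f1(1)] by measurable
      have m4: "(\<lambda>y. ?b y * ennreal \<bar>T f2 y\<bar>) \<in> borel_measurable lborel" using T_measurable[OF f2(1)] by measurable
      have "(\<integral>\<^sup>+ y. ?b y * S \<rho> y \<partial>lborel) \<le> (\<integral>\<^sup>+ y. ennreal \<kappa> * (?b y * (ennreal \<bar>\<beta> y\<bar> * indicator (cball 0 R) y)) + ?b y * indicator (cball 0 R) y * V y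
          + ennreal C * (?b y * ennreal \<bar>T ?f1 y\<bar> + ?b y * ennreal \<bar>T f2 y\<bar>) \<partial>lborel)"
      proof (intro nn_integral_mono)
        fix y
        have "?b y * S \<rho> y \<le> ?b y * (ennreal \<kappa> * (ennreal \<bar>\<beta> y\<bar> * indicator (cball 0 R) y) + indicator (cball 0 R) y * V y
          + ennreal C * (ennreal \<bar>T ?f1 y\<bar> + ennreal \<bar>T f2 y\<bar>))"
          by (intro mult_left_mono pt) simp
        then show "?b y * S \<rho> y \<le> ennreal \<kappa> * (?b y * (ennreal \<bar>\<beta> y\<bar> * indicator (cball 0 R) y)) + ?b y * indicator (cball 0 R) y * V y
          + ennreal C * (?b y * ennreal \<bar>T ?f1 y\<bar> + ?b y * ennreal \<bar>T f2 y\<bar>)"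
          by (simp only: distrib_left mult_ac)
      qed
      also have "\<dots> = ennreal \<kappa> * (\<integral>\<^sup>+ y. ?b y * (ennreal \<bar>\<beta> y\<bar> * indicator (cball 0 R) y) \<partial>lborel)
          + (\<integral>\<^sup>+ y. ?b y * indicator (cball 0 R) y * V y \<partial>lborel)
          + ennreal C * ((\<integral>\<^sup>+ y. ?b y * ennreal \<bar>T ?f1 y\<bar> \<partial>lborel) + (\<integral>\<^sup>+ y. ?b y * ennreal \<bar>T f2 y\<bar> \<partial>lborel))"
        by (rule nn_integral_lincomb[OF m1 m2 m3 m4])
      also have "\<dots> \<le> ennreal \<kappa> * ennreal C3 + ennreal \<kappa> * ennreal C4 + ennreal C * (ennreal C1 + ennreal C2)"
        using C1(2)[OF B] C2(2)[OF B] C3(2)[OF B] V_le by (intro add_mono mult_left_mono) auto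
      also have "\<dots> = ennreal D"
        using \<kappa>(1) C1(1) C2(1) C3(1) C4(1) RC(2) by (simp add: D_def flip: ennreal_mult ennreal_plus)
      finally show ?thesis .
    qed
    with D show ?thesis by blast
  qed
qed

section \<open>The duality argument\<close>

lemma hbox_subset_cball: "hbox k \<subseteq> cball (0 :: (real, 'n) vec) (real CARD('n) * real k + 1)"
proof
  fix x :: "(real, 'n) vec" assume "x \<in> hbox k"
  then have "\<bar>x $ i\<bar> \<le> real k" for i by (auto simp: hbox_def abs_le_iff minus_le_iff less_imp_le)
  then have "(\<Sum>i\<in>UNIV. \<bar>x $ i\<bar>) \<le> (\<Sum>i\<in>(UNIV :: 'n set). real k)" by (intro sum_mono)
  then show "x \<in> cball 0 (real CARD('n) * real k + 1)"
    using norm_le_l1_cart[of x] by simp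
qed

theorem T_dual:
  assumes f: "Q.decomposable \<Lambda> f" and fm [measurable]: "f \<in> borel_measurable borel"
    and g: "P.test_fun g" "morrey_norm p0 p g \<le> 1"
  shows "(\<integral>\<^sup>+ x. ennreal \<bar>T f x * g x\<bar> \<partial>lborel) \<le> ennreal (\<Lambda> * C0)"
proof -
  obtain c k where gm [measurable]: "g \<in> borel_measurable borel" and gc: "\<And>x. \<bar>g x\<bar> \<le> c" and gk: "\<And>x. x \<notin> hbox k \<Longrightarrow> g x = 0"
    using g(1) by (auto simp: P.test_fun_def)
  \<comment> \<open>The l^1 norm dominates the Euclidean norm; adding 1 keeps the radius positive
    for k = 0.\<close>
  define \<rho> where "\<rho> = real CARD('n) * real k + 1"
  have \<rho>: "0 < \<rho>" unfolding \<rho>_def by (simp add: add_nonneg_pos)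
  have g0: "g x = 0" if "x \<notin> cball 0 \<rho>" for x
    using gk hbox_subset_cball[of k] that unfolding \<rho>_def by blast
  have c: "0 \<le> c" using order_trans[OF abs_ge_zero gc[of 0]] .
  have \<Lambda>: "0 \<le> \<Lambda>" using f by (rule Q.decomposable_nonneg)
  \<comment> \<open>The sign makes \<open>h x * T f x\<close> equal to
    \<open>\<bar>T f x * g x\<bar>\<close>, so a signed Fubini identity controls the absolute
    pairing, while the Morrey norm does not grow.\<close>
  define h where "h x = \<bar>g x\<bar> * sgn (T f x)" for x
  have hm [measurable]: "h \<in> borel_measurable borel" unfolding h_def[abs_def] by measurable
  have hg: "\<bar>h x\<bar> \<le> \<bar>g x\<bar>" for x by (simp add: h_def abs_mult sgn_if)
  have h_norm: "morrey_norm p0 p h \<le> 1"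
    using P.morrey_norm_mono[of h g] hg g(2) order_trans by blast
  define w where "w x y = h x * ((\<beta> x - \<beta> y) * f y * riesz \<alpha> (x - y))" for x y
  have wm: "(\<lambda>(x, y). w x y) \<in> borel_measurable (lborel \<Otimes>\<^sub>M lborel)"
    unfolding w_def case_prod_beta' by measurable
  have wm': "(\<lambda>(x, y). ennreal (norm (w x y))) \<in> borel_measurable (lborel \<Otimes>\<^sub>M lborel)"
    unfolding w_def case_prod_beta' by measurable
  obtain C where C: "0 \<le> C" "\<And>B. is_block q0 q B \<Longrightarrow> B \<in> borel_measurable borel \<Longrightarrow>
      (\<integral>\<^sup>+ y. ennreal \<bar>B y\<bar> * S \<rho> y \<partial>lborel) \<le> ennreal C"
    using S_block_bound[OF \<rho>] by blast
  \<comment> \<open>The x-integral of |w| is at most c |f y| times \<open>S \<rho> y\<close>, and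
    the bound of S against blocks passes to f through its decomposition.\<close>
  have w_int: "integrable (lborel \<Otimes>\<^sub>M lborel) (\<lambda>(x, y). w x y)"
    unfolding integrable_iff_bounded
  proof
    have "(\<integral>\<^sup>+ z. ennreal (norm (case z of (x, y) \<Rightarrow> w x y)) \<partial>(lborel \<Otimes>\<^sub>M lborel)) = (\<integral>\<^sup>+ y. (\<integral>\<^sup>+ x. ennreal (norm (w x y)) \<partial>lborel) \<partial>lborel)"
      using lborel_pair.nn_integral_snd[OF wm'] by (simp add: case_prod_beta')
    also have "\<dots> \<le> (\<integral>\<^sup>+ y. ennreal c * (ennreal \<bar>f y\<bar> * S \<rho> y) \<partial>lborel)"
    proof (intro nn_integral_mono)
      fix y
      have "(\<integral>\<^sup>+ x. ennreal (norm (w x y)) \<partial>lborel) \<le> (\<integral>\<^sup>+ x. ennreal (c * \<bar>f y\<bar>) * (ennreal \<bar>(\<beta> y - \<beta> x) * riesz \<alpha> (y - x)\<bar> * indicator (cball 0 \<rho>) x) \<partial>lborel)"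
      proof (intro nn_integral_mono)
        fix x
        show "ennreal (norm (w x y)) \<le> ennreal (c * \<bar>f y\<bar>) * (ennreal \<bar>(\<beta> y - \<beta> x) * riesz \<alpha> (y - x)\<bar> * indicator (cball 0 \<rho>) x)"
        proof (cases "x \<in> cball 0 \<rho>")
          case True
          have "norm (w x y) = \<bar>h x\<bar> * (\<bar>f y\<bar> * \<bar>(\<beta> y - \<beta> x) * riesz \<alpha> (y - x)\<bar>)"
            by (simp add: w_def abs_mult riesz_minus[of \<alpha> x y] abs_minus_commute[of "\<beta> x"])
          also have "\<dots> \<le> c * (\<bar>f y\<bar> * \<bar>(\<beta> y - \<beta> x) * riesz \<alpha> (y - x)\<bar>)"
            using order_trans[OF hg gc] by (intro mult_right_mono) auto
          finally show ?thesis using True c by (simp add: ennreal_leI mult.assoc flip: ennreal_mult)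
        next
          case False
          then show ?thesis using g0 by (simp add: w_def h_def)
        qed
      qed
      also have "\<dots> = ennreal c * (ennreal \<bar>f y\<bar> * S \<rho> y)"
        unfolding S_def using c by (subst nn_integral_cmult) (auto simp: ennreal_mult mult.assoc)
      finally show "(\<integral>\<^sup>+ x. ennreal (norm (w x y)) \<partial>lborel) \<le> ennreal c * (ennreal \<bar>f y\<bar> * S \<rho> y)" .
    qed
    also have "\<dots> = ennreal c * (\<integral>\<^sup>+ y. ennreal \<bar>f y\<bar> * S \<rho> y \<partial>lborel)"
      by (rule nn_integral_cmult) measurable
    also have "(\<integral>\<^sup>+ y. ennreal \<bar>f y\<bar> * S \<rho> y \<partial>lborel) = (\<integral>\<^sup>+ y. ennreal \<bar>f y\<bar> * S \<rho> y \<partial>lebesgue)"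
      by (rule nn_integral_completion[symmetric])
    also have "ennreal c * \<dots> \<le> ennreal c * (ennreal \<Lambda> * ennreal C)"
      by (intro mult_left_mono Q.decomposable_nn_integral_borel_le f C(2) S_measurable) auto
    also have "\<dots> < \<infinity>" by (simp add: ennreal_mult_less_top)
    finally show "(\<integral>\<^sup>+ z. ennreal (norm (case z of (x, y) \<Rightarrow> w x y)) \<partial>(lborel \<Otimes>\<^sub>M lborel)) < \<infinity>" .
  qed (rule wm)
  have w1: "(\<integral>y. w x y \<partial>lborel) = \<bar>T f x * g x\<bar>" for x
  proof -
    have "(\<integral>y. w x y \<partial>lborel) = h x * T f x" by (simp add: w_def T_def)
    also have "\<dots> = \<bar>T f x * g x\<bar>"
      unfolding h_def abs_mult abs_sgn[of "T f x"] by (simp add: mult_ac)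
    finally show ?thesis .
  qed
  have w2: "(\<integral>x. w x y \<partial>lborel) = - (f y * T h y)" for y
  proof -
    have "(\<integral>x. w x y \<partial>lborel) = (\<integral>x. - f y * ((\<beta> y - \<beta> x) * h x * riesz \<alpha> (y - x)) \<partial>lborel)"
      by (intro Bochner_Integration.integral_cong) (auto simp: w_def riesz_minus[of \<alpha> _ y] algebra_simps)
    then show ?thesis by (simp add: T_def)
  qed
  have i1: "integrable lborel (\<lambda>x. \<bar>T f x * g x\<bar>)"
    using lborel_pair.integrable_fst[OF w_int] by (simp add: w1)
  have i2: "integrable lborel (\<lambda>y. - (f y * T h y))"
    using lborel_pair.integrable_snd[OF w_int] by (simp only: w2)
  have "(\<integral>\<^sup>+ x. ennreal \<bar>T f x * g x\<bar> \<partial>lborel) = ennreal (\<integral>x. \<bar>T f x * g x\<bar> \<partial>lborel)"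
    using i1 by (intro nn_integral_eq_integral) auto
  also have "(\<integral>x. \<bar>T f x * g x\<bar> \<partial>lborel) = (\<integral>y. - (f y * T h y) \<partial>lborel)"
    using lborel_pair.Fubini_integral[OF w_int] by (simp only: w1 w2)
  also have "ennreal \<dots> \<le> (\<integral>\<^sup>+ y. ennreal \<bar>f y * T h y\<bar> \<partial>lborel)"
    using integral_norm_bound_ennreal[OF i2] by (auto intro: order_trans[rotated] ennreal_leI)
  also have "\<dots> = (\<integral>\<^sup>+ y. ennreal \<bar>f y * T h y\<bar> \<partial>lebesgue)"
    by (rule nn_integral_completion[symmetric])
  also have "\<dots> \<le> ennreal \<Lambda> * morrey_norm q0 q (T h)"
    by (intro Q.decomposable_pairing f Q.borel_imp_lebesgue) measurable
  also have "\<dots> \<le> ennreal \<Lambda> * (ennreal C0 * 1)"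
  proof (rule mult_left_mono)
    have "morrey_norm q0 q (T h) \<le> ennreal C0 * morrey_norm p0 p h"
      unfolding T_def[abs_def] by (rule bounded[OF hm]) (use h_norm in \<open>auto intro: le_less_trans\<close>)
    also have "\<dots> \<le> ennreal C0 * 1" by (intro mult_left_mono h_norm) simp
    finally show "morrey_norm q0 q (T h) \<le> ennreal C0 * 1" .
  qed simp
  also have "\<dots> = ennreal (\<Lambda> * C0)" using \<Lambda> C0 by (simp add: ennreal_mult)
  finally show ?thesis .
qed

corollary T_decomposable:
  assumes "Q.decomposable \<Lambda> f" "f \<in> borel_measurable borel" "0 < \<Lambda>"
  shows "P.decomposable (2 * (2 + 12 * 3 powr P.\<theta>) * (\<Lambda> * (C0 + 1))) (T f)"
proof (rule P.dual_bound_decomposable)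
  \<comment> \<open>C0 may be 0, while \<open>dual_bound_decomposable\<close> asks for a positive
    bound; hence C0 + 1.\<close>
  show "P.dual_bound (\<Lambda> * (C0 + 1)) (T f)"
    unfolding P.dual_bound_def
  proof (intro conjI allI impI)
    fix g assume "P.test_fun g" "morrey_norm p0 p g \<le> 1"
    with assms have "(\<integral>\<^sup>+ x. ennreal \<bar>T f x * g x\<bar> \<partial>lborel) \<le> ennreal (\<Lambda> * C0)" by (intro T_dual)
    also have "\<dots> \<le> ennreal (\<Lambda> * (C0 + 1))" using assms(3) by (intro ennreal_leI mult_left_mono) auto
    finally show "(\<integral>\<^sup>+ x. ennreal \<bar>T f x * g x\<bar> \<partial>lborel) \<le> ennreal (\<Lambda> * (C0 + 1))" .
  qed (use assms(2) T_measurable in blast)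
  show "0 < \<Lambda> * (C0 + 1)" using assms(3) C0 by simp
qed

end

section \<open>Passage to Borel representatives, and the conclusion\<close>

lemma borel_measurable_lebesgue_AE:
  fixes f g :: "'a::euclidean_space \<Rightarrow> real"
  assumes g: "g \<in> borel_measurable lebesgue" and e: "AE x in lebesgue. f x = g x"
  shows "f \<in> borel_measurable lebesgue"
proof -
  have "{x \<in> space lebesgue. f x \<le> a} \<in> sets lebesgue" for a
  proof (rule completion.in_sets_AE)
    show "AE x in lebesgue. x \<in> {x \<in> space lebesgue. g x \<le> a} \<longleftrightarrow> x \<in> {x \<in> space lebesgue. f x \<le> a}"
      using e by eventually_elim simp
    show "{x \<in> space lebesgue. g x \<le> a} \<in> sets lebesgue" using g by measurable
  qed auto
  then show ?thesis by (simp add: borel_measurable_iff_le)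
qed

lemma (in morrey_block) decomposable_borel_AE_eq:
  assumes "decomposable c F"
  obtains F' where "F' \<in> borel_measurable borel" "AE x in lebesgue. F x = F' x"
proof -
  obtain lam B where d: "\<And>i. is_block r0 r (B i)" "AE x in lebesgue. (\<lambda>i. lam i * B i x) sums F x"
    using assms unfolding decomposable_def by blast
  have "\<forall>i. \<exists>B'. B' \<in> borel_measurable borel \<and> (AE x in lebesgue. B i x = B' x)"
  proof
    fix i
    obtain B' where "B' \<in> borel_measurable borel" "AE x in lebesgue. B i x = B' x"
      using d(1)[of i] by (rule block_borel_AE_eq)
    then show "\<exists>B'. B' \<in> borel_measurable borel \<and> (AE x in lebesgue. B i x = B' x)" by blast
  qed
  then obtain B' where "\<forall>i. B' i \<in> borel_measurable borel \<and> (AE x in lebesgue. B i x = B' i x)"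
    unfolding choice_iff by (elim exE)
  then have B': "B' i \<in> borel_measurable borel" and e: "AE x in lebesgue. B i x = B' i x" for i by simp_all
  note [measurable] = B'
  have "AE x in lebesgue. \<forall>i. B i x = B' i x" by (rule AE_all_countable[THEN iffD2]) (rule allI, rule e)
  then have "AE x in lebesgue. F x = (\<Sum>i. lam i * B' i x)"
    using d(2) by eventually_elim (simp add: sums_iff)
  then show thesis by (rule that[rotated]) measurable
qed

text \<open>The exceptional set consists of the outer points x at which b and \<beta> differ. At any
  other x the integrands agree for almost every y, so the two integrals are equal.\<close>

lemma comm_riesz_AE_eq:
  fixes b f \<beta> g :: "real^'n \<Rightarrow> real"
  assumes \<beta> [measurable]: "\<beta> \<in> borel_measurable borel" and g [measurable]: "g \<in> borel_measurable borel"
    and b: "AE x in lebesgue. b x = \<beta> x" and f: "AE x in lebesgue. f x = g x"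
  shows "AE x in lebesgue. comm_riesz b \<alpha> f x = (\<integral>y. (\<beta> x - \<beta> y) * g y * riesz \<alpha> (x - y) \<partial>lborel)"
proof -
  have [measurable]: "\<beta> \<in> borel_measurable lebesgue" "g \<in> borel_measurable lebesgue"
    using \<beta> g by (auto simp: measurable_completion)
  have [measurable]: "b \<in> borel_measurable lebesgue" "f \<in> borel_measurable lebesgue"
    using borel_measurable_lebesgue_AE[OF _ b] borel_measurable_lebesgue_AE[OF _ f] by auto
  show ?thesis
    using b
  proof eventually_elim
    case (elim x)
    have km: "(\<lambda>y. norm (x - y) powr (real CARD('n) - \<alpha>)) \<in> borel_measurable lborel" by measurable
    then have [measurable]: "(\<lambda>y. norm (x - y) powr (real CARD('n) - \<alpha>)) \<in> borel_measurable lebesgue"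
      by (rule measurable_completion)
    have "comm_riesz b \<alpha> f x = (\<integral>y. (\<beta> x - \<beta> y) * g y / norm (x - y) powr (real CARD('n) - \<alpha>) \<partial>lebesgue)"
      unfolding comm_riesz_def elim using b f
      by (intro integral_cong_AE) (measurable, auto elim: eventually_elim2)
    also have "\<dots> = (\<integral>y. (\<beta> x - \<beta> y) * g y / norm (x - y) powr (real CARD('n) - \<alpha>) \<partial>lborel)"
      by (intro integral_completion) measurable
    finally show ?case by (simp add: riesz_def)
  qed
qed

lemma locally_integrable_borel_AE_eq:
  fixes b :: "real^'n \<Rightarrow> real"
  assumes "locally_integrable b"
  obtains \<beta> where "\<beta> \<in> borel_measurable borel" "AE x in lebesgue. b x = \<beta> x"
    "\<And>\<rho>. (\<integral>\<^sup>+ x. ennreal \<bar>\<beta> x\<bar> * indicator (cball 0 \<rho>) x \<partial>lborel) < \<infinity>"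
proof -
  have int: "integrable lebesgue (\<lambda>x. indicator (cball 0 \<rho>) x *\<^sub>R b x)" for \<rho>
    using assms compact_cball by (auto simp: locally_integrable_def set_integrable_def)
  \<comment> \<open>Integrability is known for the cutoffs of b only; b is their pointwise
    limit.\<close>
  have "b \<in> borel_measurable lebesgue"
  proof (rule borel_measurable_LIMSEQ_real)
    show "(\<lambda>x. indicator (cball 0 (real n)) x *\<^sub>R b x) \<in> borel_measurable lebesgue" for n
      using int by (rule borel_measurable_integrable)
    fix x :: "real^'n"
    obtain n0 :: nat where n0: "norm x \<le> real n0" using real_arch_simple by blast
    have "\<forall>\<^sub>F n in sequentially. indicator (cball 0 (real n)) x *\<^sub>R b x = b x"
      using eventually_ge_at_top[of n0] by eventually_elim (use n0 in auto)
    then show "(\<lambda>n. indicator (cball 0 (real n)) x *\<^sub>R b x) \<longlonglongrightarrow> b x" by (rule tendsto_eventually)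
  qed
  then obtain \<beta> where \<beta> [measurable]: "\<beta> \<in> borel_measurable borel" and e: "AE x in lebesgue. b x = \<beta> x"
    by (rule lebesgue_borel_AE_eq)
  have "(\<integral>\<^sup>+ x. ennreal \<bar>\<beta> x\<bar> * indicator (cball 0 \<rho>) x \<partial>lborel) < \<infinity>" for \<rho>
  proof -
    have "(\<integral>\<^sup>+ x. ennreal \<bar>\<beta> x\<bar> * indicator (cball 0 \<rho>) x \<partial>lborel) = (\<integral>\<^sup>+ x. ennreal \<bar>\<beta> x\<bar> * indicator (cball 0 \<rho>) x \<partial>lebesgue)"
      by (rule nn_integral_completion[symmetric])
    also have "\<dots> = (\<integral>\<^sup>+ x. ennreal (norm (indicator (cball 0 \<rho>) x *\<^sub>R b x)) \<partial>lebesgue)"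
      using e by (intro nn_integral_cong_AE, eventually_elim) (auto simp: indicator_def)
    also have "\<dots> < \<infinity>" using int by (simp add: integrable_iff_bounded)
    finally show ?thesis .
  qed
  with \<beta> e show thesis by (rule that)
qed

theorem theorem6p3:
  fixes p q :: "real^('n::{finite,linorder})" and p0 q0 \<alpha> :: real and b :: "real^('n::{finite,linorder}) \<Rightarrow> real"
  assumes "0 < \<alpha>" "\<alpha> < real CARD('n)"
    and "1 < p0" "1 < q0"
    and "\<forall>i. 1 < p $ i" "\<forall>i. 1 < q $ i"
    and "real CARD('n) / p0 < (\<Sum>i\<in>UNIV. 1 / p $ i)"
    and "real CARD('n) / q0 < (\<Sum>i\<in>UNIV. 1 / q $ i)"
    and "locally_integrable b"
    and "\<exists>C. \<forall>f. f \<in> borel_measurable lebesgue \<and> morrey_norm p0 p f < \<infinity> \<longrightarrow>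
            comm_riesz b \<alpha> f \<in> borel_measurable lebesgue \<and>
            morrey_norm q0 q (comm_riesz b \<alpha> f) \<le> ennreal C * morrey_norm p0 p f"
  shows "\<exists>C>0. \<forall>f. block_norm q0 q f < \<infinity> \<longrightarrow>
            block_norm p0 p (comm_riesz b \<alpha> f) \<le> ennreal C * block_norm q0 q f"
proof -
  obtain \<beta> where \<beta>: "\<beta> \<in> borel_measurable borel" "AE x in lebesgue. b x = \<beta> x"
    "\<And>\<rho>. (\<integral>\<^sup>+ x. ennreal \<bar>\<beta> x\<bar> * indicator (cball 0 \<rho>) x \<partial>lborel) < \<infinity>"
    using locally_integrable_borel_AE_eq[OF assms(9)] by blast
  obtain C' where C': "\<And>f. f \<in> borel_measurable lebesgue \<Longrightarrow> morrey_norm p0 p f < \<infinity> \<Longrightarrow>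
      morrey_norm q0 q (comm_riesz b \<alpha> f) \<le> ennreal C' * morrey_norm p0 p f"
    using assms(10) by blast
  \<comment> \<open>The constant of the hypothesis may be negative, where \<open>ennreal\<close>
    reads it as 0.\<close>
  define C0 where "C0 = max C' 0"
  interpret P: morrey_block p0 p using assms by unfold_locales auto
  interpret Q: morrey_block q0 q using assms by unfold_locales auto
  interpret commutator p0 q0 p q \<alpha> \<beta> C0
  proof
    fix f :: "(real, 'n) vec \<Rightarrow> real" assume f: "f \<in> borel_measurable borel" "morrey_norm p0 p f < \<infinity>"
    have "morrey_norm q0 q (\<lambda>x. \<integral>y. (\<beta> x - \<beta> y) * f y * riesz \<alpha> (x - y) \<partial>lborel) = morrey_norm q0 q (comm_riesz b \<alpha> f)"
      using comm_riesz_AE_eq[OF \<beta>(1) f(1) \<beta>(2), of f \<alpha>]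
      by (intro Q.morrey_norm_cong_AE) (auto elim: eventually_mono)
    also have "\<dots> \<le> ennreal C' * morrey_norm p0 p f"
      using f by (intro C' P.borel_imp_lebesgue)
    also have "\<dots> \<le> ennreal C0 * morrey_norm p0 p f"
      by (intro mult_right_mono ennreal_leI) (auto simp: C0_def)
    finally show "morrey_norm q0 q (\<lambda>x. \<integral>y. (\<beta> x - \<beta> y) * f y * riesz \<alpha> (x - y) \<partial>lborel) \<le> ennreal C0 * morrey_norm p0 p f" .
  qed (use assms \<beta> in \<open>auto simp: C0_def\<close>)
  define C where "C = 2 * (2 + 12 * 3 powr P.\<theta>) * (C0 + 1)"
  have C: "0 < C" using C0 by (simp add: C_def add_pos_nonneg)
  have "block_norm p0 p (comm_riesz b \<alpha> f) \<le> ennreal C * block_norm q0 q f" if fin: "block_norm q0 q f < \<infinity>" for f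
  proof (rule ennreal_le_epsilon)
    fix e :: real assume e: "0 < e"
    obtain v where v: "0 \<le> v" "block_norm q0 q f = ennreal v"
      using fin by (cases "block_norm q0 q f") auto
    \<comment> \<open>The block norm is an infimum that need not be attained, and v may be 0. The
      excess e / C yields an actual decomposition with a positive bound and costs e in the
      end.\<close>
    define \<Lambda> where "\<Lambda> = v + e / C"
    have \<Lambda>: "0 < \<Lambda>" using v e C by (simp add: \<Lambda>_def add_nonneg_pos)
    have "block_norm q0 q f < ennreal \<Lambda>" using v e C by (simp add: \<Lambda>_def ennreal_lessI)
    then have d: "Q.decomposable \<Lambda> f" by (rule Q.block_norm_less_imp_decomposable)
    then obtain g where g: "g \<in> borel_measurable borel" "AE x in lebesgue. f x = g x"
      by (rule Q.decomposable_borel_AE_eq)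
    have "P.decomposable (2 * (2 + 12 * 3 powr P.\<theta>) * (\<Lambda> * (C0 + 1))) (T g)"
      using Q.decomposable_cong_AE[OF d g(2)] g(1) \<Lambda> by (rule T_decomposable)
    then have "P.decomposable (C * \<Lambda>) (T g)" by (simp add: C_def mult_ac)
    moreover have "AE x in lebesgue. T g x = comm_riesz b \<alpha> f x"
      using comm_riesz_AE_eq[OF \<beta>(1) g(1) \<beta>(2) g(2), of \<alpha>] by eventually_elim (simp add: T_def)
    ultimately have "P.decomposable (C * \<Lambda>) (comm_riesz b \<alpha> f)" by (rule P.decomposable_cong_AE)
    then have "block_norm p0 p (comm_riesz b \<alpha> f) \<le> ennreal (C * \<Lambda>)" by (rule P.decomposable_imp_block_norm)
    also have "C * \<Lambda> = C * v + e" using C by (simp add: \<Lambda>_def distrib_left)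
    also have "ennreal (C * v + e) = ennreal C * block_norm q0 q f + ennreal e"
      using C v e by (simp add: ennreal_mult)
    finally show "block_norm p0 p (comm_riesz b \<alpha> f) \<le> ennreal C * block_norm q0 q f + ennreal e" .
  qed
  with C show ?thesis by blast
qed

end
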